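(* Let $E\subset(-\infty,0]$ be a closed unbounded set all of whose points are Dirichlet regular for $\Omega=\mathbb C\setminus E$, let $M$ be a symmetric Martin function of $\Omega$ at infinity, and let $\pi:\mathbb C_+\to\Omega$ be a universal covering. Then the representing measure of the positive harmonic function $M\circ\pi$ on $\mathbb C_+$ is singular, and it is either pure point or purely continuous (without atoms), never a mixture of the two: if it has at least one atom in $\mathbb R\cup\{\infty\}$, then it is pure point.
   Context: A symmetric Martin function of $\Omega$ at infinity is a non-zero positive harmonic function $M$ in $\Omega$ that extends continuously by $0$ to $E$ and satisfies $M(\bar z)=M(z)$; since $E\subset(-\infty,0]$ it is unique up to a positive factor, and every positive harmonic function in $\Omega$ vanishing on $E$ is a multiple of it. Every positive harmonic function on $\mathbb C_+$ has a unique representation $p(\xi+i\eta)=b\eta+\int_{\mathbb R}\frac{\eta}{(\xi-t)^2+\eta^2}\,d\mu(t)$ with $b\ge0$, $\mu\ge0$; its representing measure is $b\delta_\infty+\mu$ on $\mathbb R\cup\{\infty\}$. It is called singular if $\mu$ is singular with respect to Lebesgue measure, and pure point if it is a countable sum of point masses. *)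

theory Defs
  imports "HOL-Analysis.Analysis"
begin

section \<open>Harmonic functions and the Dirichlet problem in the plane\<close>

definition harmonic_on :: "(complex \<Rightarrow> real) \<Rightarrow> complex set \<Rightarrow> bool" where
  "harmonic_on u S \<longleftrightarrow> open S \<and>
     (\<exists>ux uy uxx uxy uyx uyy.
        continuous_on S uxx \<and> continuous_on S uxy \<and>
        continuous_on S uyx \<and> continuous_on S uyy \<and>
        (\<forall>z\<in>S.
          (u has_derivative (\<lambda>h. ux z * Re h + uy z * Im h)) (at z) \<and>
          (ux has_derivative (\<lambda>h. uxx z * Re h + uxy z * Im h)) (at z) \<and>
          (uy has_derivative (\<lambda>h. uyx z * Re h + uyy z * Im h)) (at z) \<and>
          uxx z + uyy z = 0))"

text \<open>Continuous real-valued subharmonic functions: they suffice for Perron's method.\<close>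

definition subharmonic_on :: "(complex \<Rightarrow> real) \<Rightarrow> complex set \<Rightarrow> bool" where
  "subharmonic_on u S \<longleftrightarrow> open S \<and> continuous_on S u \<and>
     (\<forall>a r. 0 < r \<and> cball a r \<subseteq> S \<longrightarrow>
        u a \<le> (1 / (2 * pi)) * integral {0..2 * pi} (\<lambda>t. u (a + of_real r * cis t)))"

text \<open>
  The Dirichlet problem is posed on the Riemann sphere: if \<open>S\<close> is unbounded, then infinity
  is a boundary point and carries the boundary value \<open>L\<close>. If \<open>S\<close> is bounded, the filter
  \<open>inf at_infinity (principal S)\<close> is \<open>bot\<close> and the condition at infinity is void.
\<close>

definition perron_family ::
  "complex set \<Rightarrow> (complex \<Rightarrow> real) \<Rightarrow> real \<Rightarrow> (complex \<Rightarrow> real) set" where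
  "perron_family S f L =
     {u. subharmonic_on u S \<and>
         (\<forall>\<zeta>\<in>frontier S. Limsup (at \<zeta> within S) (\<lambda>z. ereal (u z)) \<le> ereal (f \<zeta>)) \<and>
         Limsup (inf at_infinity (principal S)) (\<lambda>z. ereal (u z)) \<le> ereal L}"

definition perron_solution ::
  "complex set \<Rightarrow> (complex \<Rightarrow> real) \<Rightarrow> real \<Rightarrow> complex \<Rightarrow> real" where
  "perron_solution S f L z = (SUP u\<in>perron_family S f L. u z)"

definition dirichlet_regular :: "complex set \<Rightarrow> complex \<Rightarrow> bool" where
  "dirichlet_regular S \<zeta> \<longleftrightarrow> \<zeta> \<in> frontier S \<and>
     (\<forall>f L. continuous_on (frontier S) f \<and>
            (f \<longlongrightarrow> L) (inf at_infinity (principal (frontier S))) \<longrightarrow>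
            (perron_solution S f L \<longlongrightarrow> f \<zeta>) (at \<zeta> within S))"

section \<open>Symmetric Martin functions and universal coverings\<close>

definition symmetric_martin_function :: "complex set \<Rightarrow> (complex \<Rightarrow> real) \<Rightarrow> bool" where
  "symmetric_martin_function E M \<longleftrightarrow>
     harmonic_on M (- E) \<and>
     (\<forall>z\<in>- E. 0 \<le> M z) \<and> (\<exists>z\<in>- E. M z \<noteq> 0) \<and>
     continuous_on UNIV (\<lambda>z. if z \<in> E then 0 else M z) \<and>
     (\<forall>z\<in>- E. M (cnj z) = M z)"

definition upper_half_plane :: "complex set" where
  "upper_half_plane = {z. 0 < Im z}"

definition holomorphic_universal_covering ::
  "complex set \<Rightarrow> (complex \<Rightarrow> complex) \<Rightarrow> complex set \<Rightarrow> bool" where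
  "holomorphic_universal_covering C \<pi> S \<longleftrightarrow>
     simply_connected C \<and> covering_space C \<pi> S \<and> \<pi> holomorphic_on C"

section \<open>Poisson representation in the upper half-plane\<close>

definition poisson_representation ::
  "(complex \<Rightarrow> real) \<Rightarrow> real \<Rightarrow> real measure \<Rightarrow> bool" where
  "poisson_representation p b \<mu> \<longleftrightarrow> 0 \<le> b \<and> sets \<mu> = sets borel \<and>
     (\<forall>\<xi> \<eta>. 0 < \<eta> \<longrightarrow>
        integrable \<mu> (\<lambda>t. \<eta> / ((\<xi> - t)\<^sup>2 + \<eta>\<^sup>2)) \<and>
        p (Complex \<xi> \<eta>) = b * \<eta> + (\<integral>t. \<eta> / ((\<xi> - t)\<^sup>2 + \<eta>\<^sup>2) \<partial>\<mu>))"

text \<open>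
  The measure \<open>b \<delta>\<^sub>\<infinity> + \<mu>\<close> on the real line with the point infinity added;
  \<open>Some t\<close> is the real point \<open>t\<close>, and \<open>None\<close> is the point infinity.
\<close>

definition representing_measure :: "real \<Rightarrow> real measure \<Rightarrow> real option measure" where
  "representing_measure b \<mu> =
     measure_of UNIV {A. Some -` A \<in> sets borel}
       (\<lambda>A. ennreal b * indicator A None + emeasure \<mu> (Some -` A))"

definition mutually_singular :: "'a measure \<Rightarrow> 'a measure \<Rightarrow> bool" where
  "mutually_singular \<mu> \<nu> \<longleftrightarrow> sets \<mu> = sets \<nu> \<and>
     (\<exists>N\<in>sets \<mu>. emeasure \<nu> N = 0 \<and> emeasure \<mu> (space \<mu> - N) = 0)"

definition atom_of :: "'a measure \<Rightarrow> 'a \<Rightarrow> bool" where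
  "atom_of \<nu> x \<longleftrightarrow> emeasure \<nu> {x} \<noteq> 0"

definition pure_point :: "'a measure \<Rightarrow> bool" where
  "pure_point \<nu> \<longleftrightarrow>
     (\<exists>(x :: nat \<Rightarrow> 'a) (w :: nat \<Rightarrow> ennreal).
        \<forall>A\<in>sets \<nu>. emeasure \<nu> A = (\<Sum>n. w n * indicator A (x n)))"

definition purely_continuous :: "'a measure \<Rightarrow> bool" where
  "purely_continuous \<nu> \<longleftrightarrow> (\<forall>x. \<not> atom_of \<nu> x)"

lemma sets_representing_measure:
  "sets (representing_measure b \<mu>) = {A. Some -` A \<in> sets borel}"
proof -
  have "sigma_algebra UNIV {A. Some -` A \<in> sets (borel :: real measure)}"
    by (auto simp: sigma_algebra_iff2 vimage_Diff Compl_eq_Diff_UNIV[symmetric] vimage_Compl vimage_UN)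
  then show ?thesis
    by (simp add: representing_measure_def sigma_algebra.sigma_sets_eq)
qed

lemma emeasure_representing_measure:
  assumes "sets \<mu> = sets borel" "Some -` A \<in> sets borel"
  shows "emeasure (representing_measure b \<mu>) A =
           ennreal b * indicator A None + emeasure \<mu> (Some -` A)"
proof (rule emeasure_measure_of[OF representing_measure_def])
  show "A \<in> sets (representing_measure b \<mu>)"
    using assms by (simp add: sets_representing_measure)
  show "positive (sets (representing_measure b \<mu>))
          (\<lambda>A. ennreal b * indicator A None + emeasure \<mu> (Some -` A))"
    by (simp add: positive_def)
  show "countably_additive (sets (representing_measure b \<mu>))
          (\<lambda>A. ennreal b * indicator A None + emeasure \<mu> (Some -` A))"
  proof (rule countably_additiveI)
    fix B :: "nat \<Rightarrow> real option set"
    assume B: "range B \<subseteq> sets (representing_measure b \<mu>)" "disjoint_family B"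
    have "(\<Sum>i. emeasure \<mu> (Some -` B i)) = emeasure \<mu> (\<Union>i. Some -` B i)"
      using B assms(1)
      by (intro suminf_emeasure) (auto simp: sets_representing_measure disjoint_family_on_def)
    moreover have "(\<Sum>i. ennreal b * indicator (B i) None) = ennreal b * indicator (\<Union>i. B i) None"
      using suminf_indicator[OF B(2)] by simp
    ultimately show "(\<Sum>i. ennreal b * indicator (B i) None + emeasure \<mu> (Some -` B i)) =
        ennreal b * indicator (\<Union> (range B)) None + emeasure \<mu> (Some -` \<Union> (range B))"
      by (subst suminf_add[symmetric]) (auto simp: vimage_UN)
  qed
qed auto

end

theory Submission
  imports Defs "HOL-Complex_Analysis.Complex_Analysis" "HOL-Probability.Sinc_Integral"
begin

text \<open>
  The pure point part of \<open>p = M \<circ> \<pi>\<close> is the sum of the kernels \<open>c * P\<^sub>x\<close>, where \<open>c\<close> is the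
  largest constant with \<open>c * P\<^sub>x \<le> p\<close>. This description is invariant under the deck transformations,
  which are real Moebius maps and permute the kernels up to factors. The pure point part therefore
  descends to a positive harmonic function on the complement of \<open>E\<close> that is dominated by \<open>M\<close>, hence
  vanishes on \<open>E\<close>, hence is a multiple of \<open>M\<close>; if there is an atom, the factor must be 1.

  Uniqueness of \<open>M\<close> up to a factor follows from a boundary Harnack principle with constants that do
  not depend on \<open>E\<close>. It uses that \<open>E\<close> lies on a line: Harnack's inequality in the slit plane
  controls the functions away from the slit, and explicit harmonic functions serve as barriers near it.

  If \<open>\<mu>\<close> were not singular, it would dominate a measure with bounded density, so there would be a bounded
  positive harmonic \<open>h \<le> p\<close>. Its supremum over the fibres of \<open>\<pi>\<close> is a bounded subharmonic function on the
  complement of \<open>E\<close> with boundary values 0, which must vanish.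
\<close>

section \<open>Functions that are locally real parts of holomorphic functions\<close>

text \<open>Real parts of holomorphic functions on balls let the Schwarz lemma carry all the
  potential theory: it yields Harnack's inequality, and Harnack yields the maximum principle, also
  for fibre suprema, which are no longer harmonic. The obstacle to uniqueness is that
  \<open>E\<close> may be any closed subset of the half-line, so nothing is known about the rate at
  which functions vanish there. Estimates are therefore proved in the unit disc for all
  \<open>E\<close> at once and carried to radius \<open>R\<close> by dilation. Used at
  \<open>z\<close> and at 1, they compare ratios with the ratio at \<open>R\<close>, which then
  cancels. Two-sided comparability becomes proportionality once the largest admissible multiple is
  subtracted. The factor is 1 for this reason: if the pure point part is \<open>c * p\<close>, then
  each point mass divided by \<open>c\<close> is still an admissible coefficient in
  \<open>p\<close>, so it cannot exceed that mass. Hence \<open>c\<close> is at least 1, while the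
  pure point part never exceeds \<open>p\<close>.\<close>

lemma mixed_partials_eq:
  fixes u ux uy uxy uyx :: "complex \<Rightarrow> real"
  assumes S: "open S" "p \<in> S"
    and cont: "continuous_on S uxy" "continuous_on S uyx"
    and du: "\<And>z. z \<in> S \<Longrightarrow> (u has_derivative (\<lambda>h. ux z * Re h + uy z * Im h)) (at z)"
    and dux: "\<And>z. z \<in> S \<Longrightarrow> (ux has_derivative (\<lambda>h. uxx z * Re h + uxy z * Im h)) (at z)"
    and duy: "\<And>z. z \<in> S \<Longrightarrow> (uy has_derivative (\<lambda>h. uyx z * Re h + uyy z * Im h)) (at z)"
  shows "uxy p = uyx p"
proof -
  obtain r where r: "r > 0" "ball p r \<subseteq> S"
    using S openE by blast
  have hor: "((\<lambda>x. f (Complex x y)) has_real_derivative fx (Complex x y)) (at x)"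
    if "\<And>z. z \<in> S \<Longrightarrow> (f has_derivative (\<lambda>h. fx z * Re h + fy z * Im h)) (at z)" "Complex x y \<in> S" for f fx fy x y
  proof -
    have "((\<lambda>x. Complex x y) has_derivative (\<lambda>h. Complex h 0)) (at x)"
      unfolding Complex_eq by (auto intro!: derivative_eq_intros)
    from has_derivative_compose[OF this that(1)[OF that(2)]] show ?thesis
      by (simp add: has_field_derivative_def)
  qed
  have ver: "((\<lambda>y. f (Complex x y)) has_real_derivative fy (Complex x y)) (at y)"
    if "\<And>z. z \<in> S \<Longrightarrow> (f has_derivative (\<lambda>h. fx z * Re h + fy z * Im h)) (at z)" "Complex x y \<in> S" for f fx fy x y
  proof -
    have "((\<lambda>y. Complex x y) has_derivative (\<lambda>h. Complex 0 h)) (at y)"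
      unfolding Complex_eq by (auto intro!: derivative_eq_intros)
    from has_derivative_compose[OF this that(1)[OF that(2)]] show ?thesis
      by (simp add: has_field_derivative_def)
  qed
  \<comment> \<open>The mixed second difference of \<open>u\<close> over the square of side
    \<open>s\<close> at \<open>p\<close>, resolved by the mean value theorem in either order, is
    \<open>s\<^sup>2 * uxy q\<close> and also \<open>s\<^sup>2 * uyx q'\<close>. The radius
    \<open>2 * s\<close> exceeds the diagonal \<open>sqrt 2 * s\<close>.\<close>
  have ex: "\<exists>q q'. q \<in> ball p (2 * s) \<and> q' \<in> ball p (2 * s) \<and> uxy q = uyx q'" if s: "0 < s" "2 * s < r" for s
  proof -
    define a b where "a = Re p" and "b = Im p"
    have near: "Complex x y \<in> ball p (2 * s)" if "a \<le> x" "x \<le> a + s" "b \<le> y" "y \<le> b + s" for x y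
    proof -
      have "norm (Complex x y - p) \<le> \<bar>x - a\<bar> + \<bar>y - b\<bar>"
        using cmod_le[of "Complex x y - p"] by (simp add: a_def b_def)
      moreover have "norm (Complex x y - p) < 2 * s"
      proof (cases "x = a + s \<and> y = b + s")
        case True
        then have "Complex x y - p = of_real s * (1 + \<i>)"
          by (auto simp: complex_eq_iff a_def b_def)
        then have "norm (Complex x y - p) = s * sqrt 2"
          using s by (simp only: norm_mult) (simp add: cmod_def)
        also have "\<dots> < s * 2" using s sqrt2_less_2 by simp
        finally show ?thesis by simp
      next
        case False
        then show ?thesis using that calculation by auto
      qed
      ultimately show ?thesis by (simp add: dist_norm norm_minus_commute)
    qed
    have inS: "Complex x y \<in> S" if "a \<le> x" "x \<le> a + s" "b \<le> y" "y \<le> b + s" for x y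
      using near[OF that] r s by (meson order_less_imp_le subset_ball subset_iff)
    have "\<exists>z>a. z < a + s \<and> (u (Complex (a+s) (b+s)) - u (Complex (a+s) b)) - (u (Complex a (b+s)) - u (Complex a b))
        = (a + s - a) * (ux (Complex z (b+s)) - ux (Complex z b))"
      by (rule MVT2) (use s inS in \<open>auto intro!: derivative_intros hor[OF du]\<close>)
    then obtain x where x: "a < x" "x < a + s" "(u (Complex (a+s) (b+s)) - u (Complex (a+s) b)) - (u (Complex a (b+s)) - u (Complex a b))
        = s * (ux (Complex x (b+s)) - ux (Complex x b))" by auto
    have "\<exists>z>b. z < b + s \<and> ux (Complex x (b+s)) - ux (Complex x b) = (b + s - b) * uxy (Complex x z)"
      by (rule MVT2) (use s x inS in \<open>auto intro!: derivative_intros ver[OF dux]\<close>)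
    then obtain y where y: "b < y" "y < b + s" "ux (Complex x (b+s)) - ux (Complex x b) = s * uxy (Complex x y)" by auto
    have "\<exists>z>b. z < b + s \<and> (u (Complex (a+s) (b+s)) - u (Complex a (b+s))) - (u (Complex (a+s) b) - u (Complex a b))
        = (b + s - b) * (uy (Complex (a+s) z) - uy (Complex a z))"
      by (rule MVT2) (use s inS in \<open>auto intro!: derivative_intros ver[OF du]\<close>)
    then obtain y' where y': "b < y'" "y' < b + s" "(u (Complex (a+s) (b+s)) - u (Complex a (b+s))) - (u (Complex (a+s) b) - u (Complex a b))
        = s * (uy (Complex (a+s) y') - uy (Complex a y'))" by auto
    have "\<exists>z>a. z < a + s \<and> uy (Complex (a+s) y') - uy (Complex a y') = (a + s - a) * uyx (Complex z y')"
      by (rule MVT2) (use s y' inS in \<open>auto intro!: derivative_intros hor[OF duy]\<close>)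
    then obtain x' where x': "a < x'" "x' < a + s" "uy (Complex (a+s) y') - uy (Complex a y') = s * uyx (Complex x' y')" by auto
    have "s * (s * uxy (Complex x y)) = s * (s * uyx (Complex x' y'))"
      using x(3)[unfolded y(3)] y'(3)[unfolded x'(3)] by linarith
    then have "uxy (Complex x y) = uyx (Complex x' y')" using s by simp
    then show ?thesis using near x y x' y' by (meson less_imp_le)
  qed
  show ?thesis
  proof (rule ccontr)
    assume ne: "uxy p \<noteq> uyx p"
    define e where "e = \<bar>uxy p - uyx p\<bar> / 2"
    have e: "e > 0" using ne by (simp add: e_def)
    obtain d1 where d1: "d1 > 0" "\<And>q. q \<in> S \<Longrightarrow> dist q p < d1 \<Longrightarrow> dist (uxy q) (uxy p) < e"
      using cont(1) S e unfolding continuous_on_iff by metis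
    obtain d2 where d2: "d2 > 0" "\<And>q. q \<in> S \<Longrightarrow> dist q p < d2 \<Longrightarrow> dist (uyx q) (uyx p) < e"
      using cont(2) S e unfolding continuous_on_iff by metis
    define s where "s = min r (min d1 d2) / 3"
    have s: "0 < s" "2 * s < r" "2 * s < d1" "2 * s < d2"
      using r d1 d2 by (auto simp: s_def)
    obtain q q' where q: "q \<in> ball p (2 * s)" "q' \<in> ball p (2 * s)" "uxy q = uyx q'" using ex s by blast
    have "q \<in> S" "q' \<in> S" using q s r by (auto simp: subset_iff)
    then have "dist (uxy q) (uxy p) < e" "dist (uyx q') (uyx p) < e"
      using q s d1(2)[of q] d2(2)[of q'] by (auto simp: dist_commute)
    moreover have "dist (uxy p) (uyx p) \<le> dist (uxy q) (uxy p) + dist (uyx q') (uyx p)"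
      using dist_triangle3[of "uxy p" "uyx p" "uxy q"] q(3) by simp
    ultimately show False by (simp add: e_def dist_real_def)
  qed
qed

text \<open>A conjugate is required on every ball in \<open>D\<close>, not just near each point:
  balls are simply connected, so nothing is lost, and Harnack's inequality can be used at full
  radius. A conjugate on all of \<open>D\<close> would be too much, as \<open>ln (norm z)\<close> on
  an annulus shows.\<close>

definition locally_Re_holomorphic_on :: "(complex \<Rightarrow> real) \<Rightarrow> complex set \<Rightarrow> bool"
  (infixl "(locally'_Re'_holomorphic'_on)" 50) where
  "u locally_Re_holomorphic_on D \<longleftrightarrow> (\<forall>a r. 0 < r \<and> ball a r \<subseteq> D \<longrightarrow>
     (\<exists>f. f holomorphic_on ball a r \<and> (\<forall>z\<in>ball a r. u z = Re (f z))))"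

text \<open>Equality of the mixed partials and the Laplace equation are the Cauchy-Riemann equations
  for \<open>ux - \<i> * uy\<close>. The real part of its primitive on the ball has the same
  gradient as \<open>u\<close>.\<close>

lemma harmonic_on_imp_locally_Re_holomorphic:
  assumes "harmonic_on u S"
  shows "u locally_Re_holomorphic_on S"
  unfolding locally_Re_holomorphic_on_def
proof (intro allI impI)
  fix a :: complex and r :: real
  assume ar: "0 < r \<and> ball a r \<subseteq> S"
  from assms obtain ux uy uxx uxy uyx uyy where S: "open S" and
    cont: "continuous_on S uxy" "continuous_on S uyx" and
    H: "\<forall>z\<in>S. (u has_derivative (\<lambda>h. ux z * Re h + uy z * Im h)) (at z) \<and>
          (ux has_derivative (\<lambda>h. uxx z * Re h + uxy z * Im h)) (at z) \<and>
          (uy has_derivative (\<lambda>h. uyx z * Re h + uyy z * Im h)) (at z) \<and>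
          uxx z + uyy z = 0"
    unfolding harmonic_on_def by (elim conjE exE)
  have d: "\<And>z. z \<in> S \<Longrightarrow> (u has_derivative (\<lambda>h. ux z * Re h + uy z * Im h)) (at z)"
      "\<And>z. z \<in> S \<Longrightarrow> (ux has_derivative (\<lambda>h. uxx z * Re h + uxy z * Im h)) (at z)"
      "\<And>z. z \<in> S \<Longrightarrow> (uy has_derivative (\<lambda>h. uyx z * Re h + uyy z * Im h)) (at z)"
      "\<And>z. z \<in> S \<Longrightarrow> uxx z + uyy z = 0"
    using H by blast+
  define D where "D z = Complex (ux z) (- uy z)" for z
  have D: "(D has_field_derivative Complex (uxx z) (- uyx z)) (at z)" if z: "z \<in> S" for z
  proof -
    have eq: "uxy z = uyx z" by (rule mixed_partials_eq[OF S z cont d(1-3)])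
    have "((\<lambda>z. of_real (ux z) - \<i> * of_real (uy z)) has_derivative
       (\<lambda>h. of_real (uxx z * Re h + uxy z * Im h) - \<i> * of_real (uyx z * Re h + uyy z * Im h))) (at z)"
      by (intro derivative_intros d[OF z])
    moreover have "(\<lambda>z. of_real (ux z) - \<i> * of_real (uy z)) = D"
      by (auto simp: D_def complex_eq_iff)
    moreover have "(\<lambda>h. of_real (uxx z * Re h + uxy z * Im h) - \<i> * of_real (uyx z * Re h + uyy z * Im h))
       = (*) (Complex (uxx z) (- uyx z))"
      using eq d(4)[OF z] by (auto simp: complex_eq_iff fun_eq_iff add_eq_0_iff)
    ultimately show ?thesis by (simp add: has_field_derivative_def)
  qed
  have "D holomorphic_on ball a r"
    using D ar by (fastforce simp: holomorphic_on_open subset_iff)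
  from holomorphic_convex_primitive'[OF convex_ball open_ball this]
  obtain g where g: "\<And>x. x \<in> ball a r \<Longrightarrow> (g has_field_derivative D x) (at x)"
    by (metis at_within_open open_ball)
  define c where "c = u a - Re (g a)"
  have "((\<lambda>z. u z - Re (g z)) has_derivative (\<lambda>h. 0)) (at z)" if z: "z \<in> ball a r" for z
  proof -
    have "(g has_derivative (\<lambda>h. D z * h)) (at z)" using g[OF z] by (simp add: has_field_derivative_def)
    then have "((\<lambda>z. u z - Re (g z)) has_derivative (\<lambda>h. (ux z * Re h + uy z * Im h) - Re (D z * h))) (at z)"
      using z ar by (intro derivative_intros d(1)) auto
    then show ?thesis by (simp add: D_def)
  qed
  then have "\<exists>c. \<forall>z\<in>ball a r. u z - Re (g z) = c"
    by (intro has_derivative_zero_constant) (auto intro: has_derivative_at_withinI)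
  then obtain c where c: "\<And>z. z \<in> ball a r \<Longrightarrow> u z - Re (g z) = c" by blast
  show "\<exists>f. f holomorphic_on ball a r \<and> (\<forall>z\<in>ball a r. u z = Re (f z))"
  proof (intro exI conjI ballI)
    show "(\<lambda>z. g z + of_real c) holomorphic_on ball a r"
      using g by (intro holomorphic_intros) (fastforce simp: holomorphic_on_open)
    show "u z = Re (g z + of_real c)" if "z \<in> ball a r" for z using c[OF that] by simp
  qed
qed

text \<open>The Cayley map of the right half-plane that sends \<open>f 0\<close> to 0 turns
  \<open>f\<close> into a self-map of the disc fixing 0, to which the Schwarz lemma applies. The
  symmetric form of the bound contains both the upper and the lower Harnack inequality.\<close>

lemma harnack_aux:
  assumes f: "f holomorphic_on ball 0 1" and pos: "\<And>z. z \<in> ball 0 1 \<Longrightarrow> 0 < Re (f z)" and z: "norm z < 1"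
    and real: "Im (f 0) = 0"
  shows "\<bar>Re (f z) - Re (f 0)\<bar> \<le> norm z * (Re (f z) + Re (f 0))"
proof -
  define \<alpha> where "\<alpha> = Re (f 0)"
  have \<alpha>: "\<alpha> > 0" "f 0 = of_real \<alpha>" using pos real by (auto simp: \<alpha>_def complex_eq_iff)
  define g where "g w = (f w - of_real \<alpha>) / (f w + of_real \<alpha>)" for w
  have nz: "f w + of_real \<alpha> \<noteq> 0" if "w \<in> ball 0 1" for w
    using pos[OF that] \<alpha> by (auto simp: complex_eq_iff)
  have lt: "norm (f w - of_real \<alpha>) < norm (f w + of_real \<alpha>)" if "w \<in> ball 0 1" for w
  proof -
    have "(norm (f w - of_real \<alpha>))\<^sup>2 < (norm (f w + of_real \<alpha>))\<^sup>2"
      unfolding cmod_power2 using pos[OF that] \<alpha>(1) by (simp add: power2_eq_square algebra_simps)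
    then show ?thesis by (rule power_less_imp_less_base) simp
  qed
  have "norm (g z) \<le> norm z"
  proof (rule Schwarz_Lemma(1))
    show "g holomorphic_on ball 0 1" unfolding g_def by (intro holomorphic_intros f nz)
    show "norm (g w) < 1" if "norm w < 1" for w
      using lt[of w] nz[of w] that by (simp add: g_def norm_divide divide_less_eq)
  qed (use \<alpha> z in \<open>auto simp: g_def\<close>)
  then have "norm (f z - of_real \<alpha>) \<le> norm z * norm (f z + of_real \<alpha>)"
    using nz[of z] z by (simp add: g_def norm_divide divide_le_eq)
  then have "(norm (f z - of_real \<alpha>))\<^sup>2 \<le> (norm z * norm (f z + of_real \<alpha>))\<^sup>2"
    by (rule power_mono) simp
  then have 1: "(Re (f z) - \<alpha>)\<^sup>2 + (Im (f z))\<^sup>2 \<le> (norm z)\<^sup>2 * ((Re (f z) + \<alpha>)\<^sup>2 + (Im (f z))\<^sup>2)"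
    by (simp add: power_mult_distrib cmod_power2)
  have "(norm z)\<^sup>2 \<le> 1" using z by (simp add: power_le_one)
  then have "(norm z)\<^sup>2 * (Im (f z))\<^sup>2 \<le> (Im (f z))\<^sup>2" by (simp add: mult_left_le_one_le)
  with 1 have "(Re (f z) - \<alpha>)\<^sup>2 \<le> (norm z * (Re (f z) + \<alpha>))\<^sup>2"
    unfolding power_mult_distrib[of "norm z"] distrib_left[of "(norm z)\<^sup>2"] by linarith
  moreover have "0 \<le> norm z * (Re (f z) + \<alpha>)" using pos[of z] z \<alpha> by simp
  ultimately show ?thesis unfolding \<alpha>_def[symmetric]
    by (simp add: abs_le_square_iff[symmetric])
qed

lemma harnack_Re:
  assumes f: "f holomorphic_on ball a \<rho>" and pos: "\<And>z. z \<in> ball a \<rho> \<Longrightarrow> 0 \<le> Re (f z)" and z: "z \<in> ball a \<rho>"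
  shows "\<rho> * \<bar>Re (f z) - Re (f a)\<bar> \<le> dist a z * (Re (f z) + Re (f a))"
proof -
  have \<rho>: "\<rho> > 0" using z by (metis ball_eq_empty empty_iff not_le)
  define w where "w = (z - a) / of_real \<rho>"
  have w: "norm w = dist a z / \<rho>" "norm w < 1" 
    using z \<rho> by (auto simp: w_def norm_divide dist_norm norm_minus_commute)
  have za: "z = a + of_real \<rho> * w" using \<rho> by (simp add: w_def)
  \<comment> \<open>Adding \<open>e\<close> makes the real part strictly positive, and subtracting
    the imaginary part of \<open>f a\<close> makes the value at the centre real, as the normalised
    version demands. Afterwards \<open>e\<close> tends to 0.\<close>
  have eps: "\<bar>Re (f z) - Re (f a)\<bar> \<le> dist a z / \<rho> * (Re (f z) + Re (f a) + 2 * e)" if e: "e > 0" for e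
  proof -
    define g where "g w = f (a + of_real \<rho> * w) - \<i> * of_real (Im (f a)) + of_real e" for w
    have im: "a + of_real \<rho> * v \<in> ball a \<rho>" if "v \<in> ball 0 1" for v
      using that \<rho> by (simp add: dist_norm norm_mult)
    have "\<bar>Re (g w) - Re (g 0)\<bar> \<le> norm w * (Re (g w) + Re (g 0))"
    proof (rule harnack_aux)
      have "(f \<circ> (\<lambda>w. a + of_real \<rho> * w)) holomorphic_on ball 0 1"
        by (rule holomorphic_on_compose_gen[OF _ f]) (use im in \<open>auto intro!: holomorphic_intros\<close>)
      then show "g holomorphic_on ball 0 1" unfolding g_def by (intro holomorphic_intros) (simp add: o_def)
      show "0 < Re (g v)" if "v \<in> ball 0 1" for v
        using pos[OF im[OF that]] e by (simp add: g_def)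
    qed (use w in \<open>auto simp: g_def\<close>)
    then show ?thesis by (simp add: g_def w za algebra_simps)
  qed
  have "((\<lambda>e. dist a z / \<rho> * (Re (f z) + Re (f a) + 2 * e)) \<longlongrightarrow> dist a z / \<rho> * (Re (f z) + Re (f a) + 2 * 0)) (at_right 0)"
    by (intro tendsto_intros)
  then have "\<bar>Re (f z) - Re (f a)\<bar> \<le> dist a z / \<rho> * (Re (f z) + Re (f a) + 2 * 0)"
    by (rule tendsto_lowerbound) (use eps in \<open>auto simp: eventually_at_right_field intro!: exI[of _ 1]\<close>)
  then show ?thesis using \<rho> by (simp add: field_simps)
qed

text \<open>This substitute for subharmonicity contains the suprema of a harmonic function over the fibres of a
  covering, and its maximum principle follows from Harnack's inequality alone.\<close>

definition Re_holomorphic_sup_on :: "(complex \<Rightarrow> real) \<Rightarrow> complex set \<Rightarrow> bool" where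
  "Re_holomorphic_sup_on S D \<longleftrightarrow> (\<forall>a r. 0 < r \<and> ball a r \<subseteq> D \<longrightarrow>
     (\<exists>F. F \<noteq> {} \<and> (\<forall>f\<in>F. f holomorphic_on ball a r) \<and>
        (\<forall>z\<in>ball a r. bdd_above ((\<lambda>f. Re (f z)) ` F) \<and> S z = (SUP f\<in>F. Re (f z)))))"

section \<open>Closure properties of local real parts and of their suprema\<close>

lemma locally_Re_holomorphic_onE:
  assumes "u locally_Re_holomorphic_on D" "0 < r" "ball a r \<subseteq> D"
  obtains f where "f holomorphic_on ball a r" "\<forall>z\<in>ball a r. u z = Re (f z)"
  using assms(1)[unfolded locally_Re_holomorphic_on_def, rule_format, of r a] assms(2,3) by blast

lemma Re_holomorphic_sup_onE:
  assumes "Re_holomorphic_sup_on S D" "0 < r" "ball a r \<subseteq> D"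
  obtains F where "F \<noteq> {}" "\<forall>f\<in>F. f holomorphic_on ball a r"
    "\<forall>z\<in>ball a r. bdd_above ((\<lambda>f. Re (f z)) ` F) \<and> S z = (SUP f\<in>F. Re (f z))"
proof -
  have "\<exists>F. F \<noteq> {} \<and> (\<forall>f\<in>F. f holomorphic_on ball a r) \<and>
        (\<forall>z\<in>ball a r. bdd_above ((\<lambda>f. Re (f z)) ` F) \<and> S z = (SUP f\<in>F. Re (f z)))"
    using assms(1)[unfolded Re_holomorphic_sup_on_def, rule_format, of r a] assms(2,3) by simp
  then show ?thesis using that by (elim exE conjE)
qed

lemma locally_Re_holomorphic_imp_sup:
  assumes "u locally_Re_holomorphic_on D"
  shows "Re_holomorphic_sup_on u D"
  unfolding Re_holomorphic_sup_on_def
proof (intro allI impI)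
  fix a r assume "0 < r \<and> ball a r \<subseteq> D"
  then obtain f where f: "f holomorphic_on ball a r" "\<forall>z\<in>ball a r. u z = Re (f z)"
    using assms by (auto elim: locally_Re_holomorphic_onE)
  show "\<exists>F. F \<noteq> {} \<and> (\<forall>f\<in>F. f holomorphic_on ball a r) \<and>
        (\<forall>z\<in>ball a r. bdd_above ((\<lambda>f. Re (f z)) ` F) \<and> u z = (SUP f\<in>F. Re (f z)))"
    by (rule exI[of _ "{f}"]) (use f in auto)
qed

lemma locally_Re_holomorphic_on_subset:
  "u locally_Re_holomorphic_on D \<Longrightarrow> D' \<subseteq> D \<Longrightarrow> u locally_Re_holomorphic_on D'"
  unfolding locally_Re_holomorphic_on_def by (elim all_forward imp_forward) auto

lemma Re_holomorphic_sup_on_subset: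
  "Re_holomorphic_sup_on u D \<Longrightarrow> D' \<subseteq> D \<Longrightarrow> Re_holomorphic_sup_on u D'"
  unfolding Re_holomorphic_sup_on_def by (elim all_forward imp_forward) auto

lemma Re_holomorphic_sup_on_diff:
  assumes S: "Re_holomorphic_sup_on S D" and v: "v locally_Re_holomorphic_on D"
  shows "Re_holomorphic_sup_on (\<lambda>z. S z - v z) D"
  unfolding Re_holomorphic_sup_on_def
proof (intro allI impI)
  fix a r assume ar: "0 < r \<and> ball a r \<subseteq> D"
  then obtain g where g: "g holomorphic_on ball a r" "\<forall>z\<in>ball a r. v z = Re (g z)"
    using v by (auto elim: locally_Re_holomorphic_onE)
  from ar obtain F where F: "F \<noteq> {}" "\<forall>f\<in>F. f holomorphic_on ball a r"
    and SF: "\<forall>z\<in>ball a r. bdd_above ((\<lambda>f. Re (f z)) ` F) \<and> S z = (SUP f\<in>F. Re (f z))"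
    by (elim Re_holomorphic_sup_onE[OF S] conjE)
  define G where "G = (\<lambda>f z. f z - g z) ` F"
  have im: "(\<lambda>f. Re (f z)) ` G = (\<lambda>x. x - Re (g z)) ` (\<lambda>f. Re (f z)) ` F" for z
    by (auto simp: G_def image_image)
  show "\<exists>F. F \<noteq> {} \<and> (\<forall>f\<in>F. f holomorphic_on ball a r) \<and>
        (\<forall>z\<in>ball a r. bdd_above ((\<lambda>f. Re (f z)) ` F) \<and> S z - v z = (SUP f\<in>F. Re (f z)))"
  proof (intro exI[of _ G] conjI ballI)
    show "G \<noteq> {}" using F by (simp add: G_def)
    show "f holomorphic_on ball a r" if "f \<in> G" for f
      using that F g by (auto simp: G_def intro!: holomorphic_intros)
    fix z assume z: "z \<in> ball a r"
    have b: "bdd_above ((\<lambda>f. Re (f z)) ` F)" "S z = (SUP f\<in>F. Re (f z))" using SF z by auto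
    show bG: "bdd_above ((\<lambda>f. Re (f z)) ` G)"
      unfolding im using b(1) by (auto simp: bdd_above_def) (metis diff_right_mono)
    show "S z - v z = (SUP f\<in>G. Re (f z))"
    proof (rule antisym)
      have "Re (f z) \<le> (SUP f\<in>G. Re (f z)) + v z" if "f \<in> F" for f
        using cSUP_upper[OF _ bG, of "\<lambda>z. f z - g z"] that g z by (auto simp: G_def)
      then have "S z \<le> (SUP f\<in>G. Re (f z)) + v z"
        unfolding b(2) using F by (intro cSUP_least) auto
      then show "S z - v z \<le> (SUP f\<in>G. Re (f z))" by simp
      show "(SUP f\<in>G. Re (f z)) \<le> S z - v z"
        using \<open>G \<noteq> {}\<close> cSUP_upper[OF _ b(1)] g z
        by (intro cSUP_least) (auto simp: G_def b(2))
    qed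
  qed
qed

lemma locally_Re_holomorphic_on_lincomb:
  assumes "u locally_Re_holomorphic_on D" "v locally_Re_holomorphic_on D"
  shows "(\<lambda>z. \<alpha> * u z + \<beta> * v z) locally_Re_holomorphic_on D"
  unfolding locally_Re_holomorphic_on_def
proof (intro allI impI)
  fix a r assume ar: "0 < r \<and> ball a r \<subseteq> D"
  then obtain f g where fg: "f holomorphic_on ball a r" "\<forall>z\<in>ball a r. u z = Re (f z)"
    "g holomorphic_on ball a r" "\<forall>z\<in>ball a r. v z = Re (g z)"
    using assms by (metis locally_Re_holomorphic_onE)
  then show "\<exists>h. h holomorphic_on ball a r \<and> (\<forall>z\<in>ball a r. \<alpha> * u z + \<beta> * v z = Re (h z))"
    by (intro exI[of _ "\<lambda>z. of_real \<alpha> * f z + of_real \<beta> * g z"]) (auto intro!: holomorphic_intros)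
qed

lemma locally_Re_holomorphic_on_Re:
  assumes "f holomorphic_on D"
  shows "(\<lambda>z. Re (f z)) locally_Re_holomorphic_on D"
  unfolding locally_Re_holomorphic_on_def
  by (intro allI impI exI[of _ f]) (auto intro: holomorphic_on_subset[OF assms])

lemma locally_Re_holomorphic_on_cong:
  assumes "\<And>z. z \<in> D \<Longrightarrow> u z = v z" "u locally_Re_holomorphic_on D"
  shows "v locally_Re_holomorphic_on D"
  unfolding locally_Re_holomorphic_on_def
proof (intro allI impI)
  fix a r assume ar: "0 < r \<and> ball a r \<subseteq> D"
  then obtain f where "f holomorphic_on ball a r" "\<forall>z\<in>ball a r. u z = Re (f z)"
    by (auto intro: locally_Re_holomorphic_onE[OF assms(2)])
  then show "\<exists>f. f holomorphic_on ball a r \<and> (\<forall>z\<in>ball a r. v z = Re (f z))"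
    using assms(1) ar by (intro exI[of _ f]) (auto simp: subset_iff)
qed

text \<open>A ball that misses 0, divided by its centre, lies in the unit disc about 1, where
  \<open>Ln\<close> is holomorphic.\<close>

lemma ln_norm_locally_Re_holomorphic:
  assumes "0 \<notin> D"
  shows "(\<lambda>z. ln (norm z)) locally_Re_holomorphic_on D"
  unfolding locally_Re_holomorphic_on_def
proof (intro allI impI)
  fix a :: complex and r assume ar: "0 < r \<and> ball a r \<subseteq> D"
  then have 0: "0 \<notin> ball a r" using assms by blast
  then have a: "r \<le> norm a" "a \<noteq> 0" using ar by auto
  show "\<exists>f. f holomorphic_on ball a r \<and> (\<forall>z\<in>ball a r. ln (norm z) = Re (f z))"
  proof (intro exI[of _ "\<lambda>z. Ln (z / a) + of_real (ln (norm a))"] conjI ballI)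
    have "z / a \<notin> \<real>\<^sub>\<le>\<^sub>0" if z: "z \<in> ball a r" for z
    proof -
      have "norm (1 - z / a) = norm (a - z) / norm a" using a by (simp add: norm_divide[symmetric] diff_divide_distrib)
      also have "\<dots> < 1" using z a ar by (simp add: dist_norm)
      finally have "Re (1 - z / a) < 1" using complex_Re_le_cmod[of "1 - z / a"] by linarith
      then show ?thesis by (simp add: complex_nonpos_Reals_iff)
    qed
    then show "(\<lambda>z. Ln (z / a) + of_real (ln (norm a))) holomorphic_on ball a r"
      using a by (intro holomorphic_intros) auto
    fix z assume "z \<in> ball a r"
    then have "z \<noteq> 0" using 0 by auto
    then show "ln (norm z) = Re (Ln (z / a) + of_real (ln (norm a)))"
      using a by (simp add: Re_Ln norm_divide ln_div)
  qed
qed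

lemma locally_Re_holomorphic_on_scale:
  assumes u: "u locally_Re_holomorphic_on D" and R: "R > 0"
  shows "(\<lambda>z. u (of_real R * z)) locally_Re_holomorphic_on {z. of_real R * z \<in> D}"
  unfolding locally_Re_holomorphic_on_def
proof (intro allI impI)
  fix a r assume ar: "0 < r \<and> ball a r \<subseteq> {z. of_real R * z \<in> D}"
  have "ball (of_real R * a) (R * r) \<subseteq> D"
  proof
    fix w assume w: "w \<in> ball (of_real R * a) (R * r)"
    have "dist (of_real R * a) w = R * dist a (w / of_real R)"
    proof -
      have "of_real R * a - w = of_real R * (a - w / of_real R)" using R by (simp add: field_simps)
      then show ?thesis using R by (simp only: dist_norm norm_mult) simp
    qed
    then have "w / of_real R \<in> ball a r" using w R by simp
    then have "of_real R * (w / of_real R) \<in> D" using ar by blast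
    then show "w \<in> D" using R by simp
  qed
  moreover have "R * r > 0" using ar R by simp
  ultimately obtain f where f: "f holomorphic_on ball (of_real R * a) (R * r)" "\<forall>z\<in>ball (of_real R * a) (R * r). u z = Re (f z)"
    using locally_Re_holomorphic_onE[OF u] by metis
  have im: "of_real R * z \<in> ball (of_real R * a) (R * r)" if "z \<in> ball a r" for z
  proof -
    have "of_real R * a - of_real R * z = of_real R * (a - z)" by (simp add: algebra_simps)
    then show ?thesis using that R by (simp only: dist_norm norm_mult mem_ball) simp
  qed
  show "\<exists>f. f holomorphic_on ball a r \<and> (\<forall>z\<in>ball a r. u (of_real R * z) = Re (f z))"
  proof (intro exI[of _ "f \<circ> (\<lambda>z. of_real R * z)"] conjI ballI)
    show "f \<circ> (\<lambda>z. of_real R * z) holomorphic_on ball a r"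
      by (rule holomorphic_on_compose_gen[OF _ f(1)]) (use im in \<open>auto intro!: holomorphic_intros\<close>)
  qed (use f(2) im in auto)
qed

lemma locally_Re_holomorphic_on_cnj:
  assumes u: "u locally_Re_holomorphic_on D"
  shows "(\<lambda>z. u (cnj z)) locally_Re_holomorphic_on {z. cnj z \<in> D}"
  unfolding locally_Re_holomorphic_on_def
proof (intro allI impI)
  fix a r assume ar: "0 < r \<and> ball a r \<subseteq> {z. cnj z \<in> D}"
  have d: "dist (cnj x) y = dist x (cnj y)" for x y
    by (metis complex_cnj_cnj complex_cnj_diff complex_mod_cnj dist_norm)
  have "ball (cnj a) r \<subseteq> D"
  proof
    fix y assume "y \<in> ball (cnj a) r"
    then have "cnj y \<in> ball a r" using d[of a y] by simp
    then show "y \<in> D" using ar by auto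
  qed
  then obtain f where f: "f holomorphic_on ball (cnj a) r" "\<forall>z\<in>ball (cnj a) r. u z = Re (f z)"
    using ar by (auto intro: locally_Re_holomorphic_onE[OF u])
  have im: "cnj ` ball a r = ball (cnj a) r"
    using d by (auto simp: image_iff intro!: bexI[of _ "cnj _"])
  show "\<exists>f. f holomorphic_on ball a r \<and> (\<forall>z\<in>ball a r. u (cnj z) = Re (f z))"
  proof (intro exI[of _ "cnj \<circ> f \<circ> cnj"] conjI ballI)
    show "cnj \<circ> f \<circ> cnj holomorphic_on ball a r"
      using f(1) by (subst holomorphic_on_compose_cnj_cnj) (auto simp: im)
    show "u (cnj z) = Re ((cnj \<circ> f \<circ> cnj) z)" if "z \<in> ball a r" for z
      using f(2) im that by auto
  qed
qed

lemma locally_Re_holomorphic_imp_continuous_on: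
  assumes "u locally_Re_holomorphic_on D" "open D"
  shows "continuous_on D u"
  unfolding continuous_on_eq_continuous_at[OF assms(2)]
proof
  fix x assume "x \<in> D"
  then obtain r where r: "r > 0" "ball x r \<subseteq> D" using assms(2) openE by blast
  then obtain f where f: "f holomorphic_on ball x r" "\<forall>z\<in>ball x r. u z = Re (f z)"
    by (rule locally_Re_holomorphic_onE[OF assms(1)])
  have "continuous_on (ball x r) (\<lambda>z. Re (f z))"
    using f(1) by (intro continuous_intros holomorphic_on_imp_continuous_on)
  then have "continuous_on (ball x r) u"
    by (rule continuous_on_eq) (use f(2) in auto)
  then show "isCont u x" using r by (simp add: continuous_on_eq_continuous_at)
qed

section \<open>Harnack's inequality and the maximum principle\<close>

lemma harnack:
  assumes u: "u locally_Re_holomorphic_on D" and D: "ball a \<rho> \<subseteq> D"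
    and pos: "\<And>z. z \<in> ball a \<rho> \<Longrightarrow> 0 \<le> u z" and z: "z \<in> ball a \<rho>"
  shows "\<rho> * \<bar>u z - u a\<bar> \<le> dist a z * (u z + u a)"
proof -
  have \<rho>: "\<rho> > 0" using z by (metis ball_eq_empty empty_iff not_le)
  then obtain f where f: "f holomorphic_on ball a \<rho>" "\<forall>z\<in>ball a \<rho>. u z = Re (f z)"
    by (rule locally_Re_holomorphic_onE[OF u _ D])
  show ?thesis using harnack_Re[OF f(1) _ z] pos f(2) z \<rho> by simp
qed

text \<open>Harnack's inequality holds for each nonnegative \<open>m - Re f\<close>. In the form
  \<open>(r - d) * (m - Re (f x)) \<le> (r + d) * (m - Re (f y))\<close> with
  \<open>d = dist a z\<close> it survives the supremum over \<open>f\<close>, because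
  \<open>r - d\<close> and \<open>r + d\<close> are positive.\<close>

lemma harnack_Re_holomorphic_sup:
  assumes S: "Re_holomorphic_sup_on S D" and D: "ball a r \<subseteq> D"
    and le: "\<And>z. z \<in> ball a r \<Longrightarrow> S z \<le> m" and z: "z \<in> ball a r"
  shows "r * \<bar>S z - S a\<bar> \<le> dist a z * ((m - S z) + (m - S a))"
proof -
  have r: "r > 0" using z by (metis ball_eq_empty empty_iff not_le)
  obtain F where F: "F \<noteq> {}" "\<forall>f\<in>F. f holomorphic_on ball a r"
    and SF: "\<forall>z\<in>ball a r. bdd_above ((\<lambda>f. Re (f z)) ` F) \<and> S z = (SUP f\<in>F. Re (f z))"
    by (rule Re_holomorphic_sup_onE[OF S r D])
  have up: "Re (f w) \<le> S w" if "f \<in> F" "w \<in> ball a r" for f w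
    using SF that by (auto intro: cSUP_upper)
  have dz: "dist a z < r" and a: "a \<in> ball a r" using z r by auto
  have one: "(r + dist a z) * S y \<le> (r - dist a z) * S x + 2 * dist a z * m"
    if xy: "x \<in> ball a r" "y \<in> ball a r" and
      h: "\<And>f. f \<in> F \<Longrightarrow> (r - dist a z) * (m - Re (f x)) \<le> (r + dist a z) * (m - Re (f y))" for x y
  proof -
    have pos: "r + dist a z > 0" using r by (simp add: add_pos_nonneg)
    have "Re (f y) \<le> ((r - dist a z) * S x + 2 * dist a z * m) / (r + dist a z)" if f: "f \<in> F" for f
    proof -
      have "(r - dist a z) * (m - S x) \<le> (r - dist a z) * (m - Re (f x))"
        using up[OF f xy(1)] dz by (intro mult_left_mono) auto
      also note h[OF f]
      finally have "(r + dist a z) * Re (f y) \<le> (r - dist a z) * S x + 2 * dist a z * m"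
        by (simp add: algebra_simps)
      then show ?thesis using pos by (simp add: pos_le_divide_eq mult.commute)
    qed
    then have "S y \<le> ((r - dist a z) * S x + 2 * dist a z * m) / (r + dist a z)"
      using SF xy(2) F(1) by (auto intro: cSUP_least)
    then show ?thesis using pos by (simp add: pos_le_divide_eq mult.commute)
  qed
  have h: "r * \<bar>Re (f a) - Re (f z)\<bar> \<le> dist a z * ((m - Re (f z)) + (m - Re (f a)))" if f: "f \<in> F" for f
  proof -
    have "r * \<bar>Re (m - f z) - Re (m - f a)\<bar> \<le> dist a z * (Re (m - f z) + Re (m - f a))"
      by (rule harnack_Re) (use F f order_trans[OF up le] z in \<open>auto intro!: holomorphic_intros\<close>)
    then show ?thesis by simp
  qed
  have "(r + dist a z) * S a \<le> (r - dist a z) * S z + 2 * dist a z * m"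
  proof (rule one[OF z a])
    fix f assume "f \<in> F"
    from h[OF this] show "(r - dist a z) * (m - Re (f z)) \<le> (r + dist a z) * (m - Re (f a))"
      using mult_left_mono[OF abs_ge_self[of "Re (f a) - Re (f z)"], of r] r by (simp add: algebra_simps)
  qed
  moreover have "(r + dist a z) * S z \<le> (r - dist a z) * S a + 2 * dist a z * m"
  proof (rule one[OF a z])
    fix f assume "f \<in> F"
    from h[OF this] show "(r - dist a z) * (m - Re (f a)) \<le> (r + dist a z) * (m - Re (f z))"
      using mult_left_mono[OF abs_ge_minus_self[of "Re (f a) - Re (f z)"], of r] r by (simp add: algebra_simps)
  qed
  ultimately have "r * (S z - S a) \<le> dist a z * ((m - S z) + (m - S a))"
    "r * (S a - S z) \<le> dist a z * ((m - S z) + (m - S a))" by (simp_all add: algebra_simps)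
  then show ?thesis by (cases "S z \<ge> S a") (auto simp: abs_if)
qed

lemma Re_holomorphic_sup_max_propagates:
  assumes S: "Re_holomorphic_sup_on S D" and D: "ball a r \<subseteq> D"
    and le: "\<And>z. z \<in> ball a r \<Longrightarrow> S z \<le> m" and eq: "S a = m" and z: "z \<in> ball a r"
  shows "S z = m"
proof -
  have "r * \<bar>S z - m\<bar> \<le> dist a z * (m - S z)"
    using harnack_Re_holomorphic_sup[OF S D le z] eq by simp
  then have "(r - dist a z) * (m - S z) \<le> 0"
    using le[OF z] by (simp add: algebra_simps)
  then show ?thesis using le[OF z] z by (simp add: mult_le_0_iff)
qed

text \<open>A supremum of continuous functions is in general only semicontinuous. Two-sided bounds
  turn the Harnack estimate into a Lipschitz bound at \<open>a\<close> with constant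
  \<open>2 * K / r\<close>, and so make fibre suprema accessible to the maximum principle.\<close>

lemma isCont_Re_holomorphic_sup:
  assumes S: "Re_holomorphic_sup_on S D" "open D" "a \<in> D" and bd: "\<And>z. z \<in> D \<Longrightarrow> 0 \<le> S z" "\<And>z. z \<in> D \<Longrightarrow> S z \<le> K"
  shows "isCont S a"
proof -
  obtain r where r: "r > 0" "ball a r \<subseteq> D" using S openE by blast
  have "\<bar>S z - S a\<bar> \<le> dist a z * (2 * K / r)" if z: "z \<in> ball a r" for z
  proof -
    have zD: "z \<in> D" using z r by auto
    have "r * \<bar>S z - S a\<bar> \<le> dist a z * ((K - S z) + (K - S a))"
      by (rule harnack_Re_holomorphic_sup[OF S(1) r(2) _ z]) (use bd r in auto)
    also have "\<dots> \<le> dist a z * (2 * K)" using bd(1)[OF zD] bd(1)[OF S(3)] by (intro mult_left_mono) auto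
    finally have "\<bar>S z - S a\<bar> \<le> (dist a z * (2 * K)) / r" using r(1) by (simp add: pos_le_divide_eq mult.commute)
    then show ?thesis by simp
  qed
  then have "\<forall>\<^sub>F z in at a. norm (S z - S a) \<le> dist z a * (2 * K / r)"
    using eventually_at_ball[OF r(1), of a UNIV] by (auto elim!: eventually_mono simp: dist_commute simp del: times_divide_eq_right)
  moreover have "((\<lambda>z. dist z a * (2 * K / r)) \<longlongrightarrow> 0) (at a)" using r(1) by (auto intro!: tendsto_eq_intros)
  ultimately have "((\<lambda>z. S z - S a) \<longlongrightarrow> 0) (at a)" by (rule Lim_null_comparison)
  then show ?thesis by (simp add: isCont_def LIM_zero_iff)
qed

lemma Re_holomorphic_sup_max_principle:
  assumes S: "Re_holomorphic_sup_on S U" and U: "open U" and K: "compact K" "U \<subseteq> K"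
    and cont: "continuous_on K S" and le: "\<And>z. z \<in> K - U \<Longrightarrow> S z \<le> c" and z: "z \<in> K"
  shows "S z \<le> c"
proof (rule ccontr)
  assume "\<not> S z \<le> c"
  obtain w where w: "w \<in> K" "\<And>y. y \<in> K \<Longrightarrow> S y \<le> S w"
    using continuous_attains_sup[OF K(1) _ cont] z by blast
  define Z where "Z = {y\<in>K. S y = S w}"
  have "S w > c" using \<open>\<not> S z \<le> c\<close> w(2)[OF z] by simp
  then have ZU: "Z \<subseteq> U" using le by (force simp: Z_def)
  have "closed Z" unfolding Z_def 
    using continuous_closed_preimage_constant[OF cont compact_imp_closed[OF K(1)]] by auto
  then have "compact Z" using compact_Int_closed[OF K(1), of Z] by (simp add: Z_def Int_absorb1 Collect_conj_eq)
  moreover have "w \<in> Z" using w by (simp add: Z_def)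
  \<comment> \<open>Of all maximum points a rightmost one is taken. The maximum spreads to a ball
    around it, which contains a point further right. This replaces a connectedness argument on
    \<open>U\<close>.\<close>
  ultimately obtain y where y: "y \<in> Z" "\<And>x. x \<in> Z \<Longrightarrow> Re x \<le> Re y"
    using continuous_attains_sup[of Z Re] continuous_on_Re[OF continuous_on_id] by (metis empty_iff id_apply)
  obtain r where r: "r > 0" "ball y r \<subseteq> U" using U y ZU openE by blast
  define x where "x = y + of_real (r/2)"
  have x: "x \<in> ball y r" using r by (simp add: x_def dist_norm)
  have "S x = S w"
    by (rule Re_holomorphic_sup_max_propagates[OF S r(2) _ _ x]) (use w(2) r(2) K(2) y(1) in \<open>auto simp: Z_def subset_iff\<close>)
  then have "x \<in> Z" using x r K by (auto simp: Z_def)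
  then show False using y(2)[of x] r by (simp add: x_def)
qed

section \<open>A boundary Harnack principle\<close>

definition vanishing_positive :: "complex set \<Rightarrow> (complex \<Rightarrow> real) \<Rightarrow> bool" where
  "vanishing_positive E u \<longleftrightarrow> closed E \<and> E \<subseteq> \<real>\<^sub>\<le>\<^sub>0 \<and> continuous_on UNIV u \<and> (\<forall>z. 0 \<le> u z) \<and>
     (\<forall>z\<in>E. u z = 0) \<and> u locally_Re_holomorphic_on - E"

text \<open>Dilation replaces \<open>E\<close> by another closed subset of the half-line. A bound in
  the unit disc whose constant is the same for all \<open>E\<close> thus becomes a bound at every
  scale.\<close>

lemma vanishing_positive_scale:
  assumes "vanishing_positive E u" "R > 0"
  shows "vanishing_positive {z. of_real R * z \<in> E} (\<lambda>z. u (of_real R * z))"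
  unfolding vanishing_positive_def
proof (intro conjI)
  show "closed {z. complex_of_real R * z \<in> E}"
    using assms(1) unfolding vanishing_positive_def
    by (intro closed_vimage[of E "\<lambda>z. of_real R * z", unfolded vimage_def] continuous_intros) auto
  show "{z. complex_of_real R * z \<in> E} \<subseteq> \<real>\<^sub>\<le>\<^sub>0"
  proof
    fix z assume "z \<in> {z. complex_of_real R * z \<in> E}"
    then have "of_real R * z \<in> \<real>\<^sub>\<le>\<^sub>0" using assms(1) unfolding vanishing_positive_def by blast
    then show "z \<in> \<real>\<^sub>\<le>\<^sub>0" using assms(2) by (simp add: complex_nonpos_Reals_iff mult_le_0_iff)
  qed
  show "continuous_on UNIV (\<lambda>z. u (complex_of_real R * z))"
    using assms(1) continuous_on_compose2[of UNIV u UNIV "\<lambda>z. of_real R * z"]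
    unfolding vanishing_positive_def by (auto intro!: continuous_intros)
  show "(\<lambda>z. u (complex_of_real R * z)) locally_Re_holomorphic_on - {z. complex_of_real R * z \<in> E}"
    using locally_Re_holomorphic_on_scale[of u "- E" R] assms unfolding vanishing_positive_def
    by (simp add: Collect_neg_eq[symmetric])
qed (use assms in \<open>auto simp: vanishing_positive_def\<close>)

lemma vanishing_positive_cnj:
  assumes "vanishing_positive E u"
  shows "vanishing_positive E (\<lambda>z. u (cnj z))"
proof -
  have E: "cnj z \<in> E \<longleftrightarrow> z \<in> E" for z
  proof -
    have "cnj z = z" if "z \<in> E \<or> cnj z \<in> E" 
      using that assms unfolding vanishing_positive_def
      by (auto simp: complex_eq_iff subset_iff complex_nonpos_Reals_iff)
    then show ?thesis by metis
  qed
  show ?thesis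
    using assms locally_Re_holomorphic_on_cnj[of u "- E"] continuous_on_compose2[of UNIV u UNIV cnj]
    unfolding vanishing_positive_def
    by (auto simp: E Compl_eq intro!: continuous_intros)
qed

text \<open>At half the radius the Harnack factor is \<open>(1 + 1/2) / (1 - 1/2) = 3\<close>, the
  source of the powers of 3 in all later constants.\<close>

lemma harnack_half:
  assumes u: "vanishing_positive E u" and D: "ball a \<rho> \<subseteq> - \<real>\<^sub>\<le>\<^sub>0" and z: "2 * dist a z \<le> \<rho>"
  shows "u z \<le> 3 * u a" "u a \<le> 3 * u z"
proof -
  have pos: "0 \<le> u w" for w using u by (simp add: vanishing_positive_def)
  have "u z \<le> 3 * u a \<and> u a \<le> 3 * u z"
  proof (cases "a = z")
    case False
    then have \<rho>: "dist a z > 0" by simp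
    then have z': "dist a z < \<rho>" using z by linarith
    have "\<rho> * \<bar>u z - u a\<bar> \<le> dist a z * (u z + u a)"
      by (rule harnack[of u "- E"]) (use u D z' pos in \<open>auto simp: vanishing_positive_def\<close>)
    also have "2 * dist a z * \<bar>u z - u a\<bar> \<le> \<rho> * \<bar>u z - u a\<bar>"
      using z by (intro mult_right_mono) auto
    finally have "dist a z * (2 * \<bar>u z - u a\<bar>) \<le> dist a z * (u z + u a)" by simp
    then have "2 * \<bar>u z - u a\<bar> \<le> u z + u a" using \<rho> by simp
    then show ?thesis using abs_ge_self[of "u z - u a"] abs_ge_minus_self[of "u z - u a"] by auto
  qed (use pos[of a] in auto)
  then show "u z \<le> 3 * u a" "u a \<le> 3 * u z" by auto
qed

lemma ball_off_slit:
  assumes "0 < Re a \<and> \<rho> \<le> Re a \<or> \<rho> \<le> \<bar>Im a\<bar>"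
  shows "ball a \<rho> \<subseteq> - \<real>\<^sub>\<le>\<^sub>0"
proof
  fix z assume "z \<in> ball a \<rho>"
  then have "norm (a - z) < \<rho>" by (simp add: dist_norm)
  moreover have "\<bar>Re a - Re z\<bar> \<le> norm (a - z)" "\<bar>Im a - Im z\<bar> \<le> norm (a - z)"
    using abs_Re_le_cmod[of "a - z"] abs_Im_le_cmod[of "a - z"] by auto
  ultimately show "z \<in> - \<real>\<^sub>\<le>\<^sub>0" using assms by (auto simp: complex_nonpos_Reals_iff)
qed

lemma dist_Complex_le: "dist (Complex x y) (Complex x' y') \<le> \<bar>x - x'\<bar> + \<bar>y - y'\<bar>"
  using cmod_le[of "Complex x y - Complex x' y'"] by (simp add: dist_norm)

text \<open>A Harnack chain of eight steps: from 1 up to \<open>1 + \<i>/2\<close> and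
  \<open>1 + \<i>\<close>, then six horizontal steps to \<open>x + \<i>\<close>. Unit balls about
  points with real or imaginary part 1 miss the slit.\<close>

lemma harnack_chain_top:
  assumes u: "vanishing_positive E u" and x: "-2 \<le> x" "x \<le> 1"
  shows "u (Complex x 1) \<le> 3^8 * u 1" "u 1 \<le> 3^8 * u (Complex x 1)"
proof -
  have pos: "0 \<le> u w" for w using u by (simp add: vanishing_positive_def)
  have step: "u z \<le> 3 * u a \<and> u a \<le> 3 * u z"
    if "Re a = 1 \<or> Im a = 1" "\<bar>Re a - Re z\<bar> + \<bar>Im a - Im z\<bar> \<le> 1/2" for a z
  proof -
    have "2 * dist a z \<le> 1" using that dist_Complex_le[of "Re a" "Im a" "Re z" "Im z"] by simp
    then show ?thesis using harnack_half[OF u ball_off_slit[of a 1]] that by auto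
  qed
  \<comment> \<open>Six steps cover the distance \<open>1 - x\<close>, which is at most 3, with
    length at most 1/2 each.\<close>
  define t where "t = (1 - x) / 6"
  have t: "0 \<le> t" "t \<le> 1/2" using x by (auto simp: t_def)
  have s1: "u (Complex 1 (1/2)) \<le> 3 * u 1 \<and> u 1 \<le> 3 * u (Complex 1 (1/2))"
    using step[of 1 "Complex 1 (1/2)"] by simp
  have s2: "u (Complex 1 1) \<le> 3 * u (Complex 1 (1/2)) \<and> u (Complex 1 (1/2)) \<le> 3 * u (Complex 1 1)"
    using step[of "Complex 1 (1/2)" "Complex 1 1"] by simp
  have s3: "u (Complex (1 - real k * t) 1) \<le> 3^k * u (Complex 1 1) \<and> u (Complex 1 1) \<le> 3^k * u (Complex (1 - real k * t) 1)" for k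
  proof (induction k)
    case (Suc k)
    have "u (Complex (1 - real (Suc k) * t) 1) \<le> 3 * u (Complex (1 - real k * t) 1) \<and>
          u (Complex (1 - real k * t) 1) \<le> 3 * u (Complex (1 - real (Suc k) * t) 1)"
      using step[of "Complex (1 - real k * t) 1" "Complex (1 - real (Suc k) * t) 1"] t by (simp add: algebra_simps)
    moreover from this have "3^k * u (Complex (1 - real k * t) 1) \<le> 3^k * (3 * u (Complex (1 - real (Suc k) * t) 1))"
      by (intro mult_left_mono) auto
    ultimately show ?case using Suc unfolding power_Suc by linarith
  qed simp
  have "1 - real 6 * t = x" by (simp add: t_def diff_divide_distrib)
  with s3[of 6] have s3': "u (Complex x 1) \<le> 3^6 * u (Complex 1 1) \<and> u (Complex 1 1) \<le> 3^6 * u (Complex x 1)" by simp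
  show "u (Complex x 1) \<le> 3^8 * u 1" "u 1 \<le> 3^8 * u (Complex x 1)"
    using s1 s2 s3' by auto
qed

text \<open>In the unit ball about \<open>x + \<i>\<close> the Harnack factor at height
  \<open>y\<close> is \<open>(2 - y) / y\<close>, so the comparison with the value at 1 loses a
  factor of order \<open>1 / y\<close>. The factor \<open>3^8\<close> is the chain to 1.\<close>

lemma harnack_near_slit_upper:
  assumes u: "vanishing_positive E u" and x: "-2 \<le> x" "x \<le> 1" and y: "0 < y" "y \<le> 1"
  shows "y * u (Complex x y) \<le> 2 * 3^8 * u 1" "y * u 1 \<le> 2 * 3^8 * u (Complex x y)"
proof -
  have pos: "0 \<le> u w" for w using u by (simp add: vanishing_positive_def)
  define a where "a = Complex x 1"
  define z where "z = Complex x y"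
  have d: "dist a z = 1 - y" using y by (simp add: a_def z_def dist_norm cmod_def)
  have "1 * \<bar>u z - u a\<bar> \<le> dist a z * (u z + u a)"
  proof (rule harnack[of u "- E"])
    show "ball a 1 \<subseteq> - E" using ball_off_slit[of a 1] u by (auto simp: a_def vanishing_positive_def)
  qed (use u d y pos in \<open>auto simp: vanishing_positive_def\<close>)
  then have 1: "\<bar>u z - u a\<bar> \<le> (1 - y) * (u z + u a)" by (simp add: d)
  then have "y * u z \<le> (2 - y) * u a" "y * u a \<le> (2 - y) * u z" by (auto simp: abs_le_iff algebra_simps)
  moreover have "(2 - y) * u a \<le> 2 * u a" "(2 - y) * u z \<le> 2 * u z" using pos y by (auto intro!: mult_right_mono)
  ultimately have 2: "y * u z \<le> 2 * u a" "y * u a \<le> 2 * u z" by auto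
  note top = harnack_chain_top[OF u x, folded a_def]
  show "y * u (Complex x y) \<le> 2 * 3^8 * u 1" using 2 top by (simp add: z_def)
  have "y * u 1 \<le> y * (3^8 * u a)" using top y by (intro mult_left_mono) auto
  then show "y * u 1 \<le> 2 * 3^8 * u (Complex x y)" using 2 by (simp add: z_def)
qed

lemma harnack_near_slit:
  assumes u: "vanishing_positive E u" and z: "-2 \<le> Re z" "Re z \<le> 1" "\<bar>Im z\<bar> \<le> 1"
  shows "\<bar>Im z\<bar> * u z \<le> 2 * 3^8 * u 1" "\<bar>Im z\<bar> * u 1 \<le> 2 * 3^8 * u z"
proof -
  have pos: "0 \<le> u w" for w using u by (simp add: vanishing_positive_def)
  consider "Im z = 0" | "Im z > 0" | "Im z < 0" by linarith
  then have "\<bar>Im z\<bar> * u z \<le> 2 * 3^8 * u 1 \<and> \<bar>Im z\<bar> * u 1 \<le> 2 * 3^8 * u z"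
  proof cases
    case 1 then show ?thesis using pos by simp
  next
    case 2
    then show ?thesis using harnack_near_slit_upper[OF u z(1,2), of "Im z"] z by simp
  next
    case 3
    have "Complex (Re z) (- Im z) = cnj z" by (simp add: complex_eq_iff)
    then show ?thesis using harnack_near_slit_upper[OF vanishing_positive_cnj[OF u] z(1,2), of "- Im z"] z 3 by simp
  qed
  then show "\<bar>Im z\<bar> * u z \<le> 2 * 3^8 * u 1" "\<bar>Im z\<bar> * u 1 \<le> 2 * 3^8 * u z" by auto
qed

text \<open>The barrier \<open>Re (1/(z - a)) + Re (1/(b - z))\<close> is harmonic and dominates \<open>1/(2 \<bar>Im z\<bar>)\<close>
  on the edges of the rhombus with corners \<open>a\<close> and \<open>b\<close>, whose angle there is \<open>\<pi>/2\<close>.\<close>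

lemma carleson_estimate:
  assumes u: "vanishing_positive E u" and ab: "-2 \<le> a" "a < b" "b \<le> 1" "b - a \<le> 2" and L: "2 * 3^8 * u 1 < L"
    and z: "a < Re z" "Re z < b" "\<bar>Im z\<bar> \<le> Re z - a" "\<bar>Im z\<bar> \<le> b - Re z"
  shows "u z \<le> 2 * L * Re (1 / (z - of_real a) + 1 / (of_real b - z))"
proof -
  have pos: "0 \<le> u w" for w using u by (simp add: vanishing_positive_def)
  then have "0 \<le> 2 * 3^8 * u 1" by simp
  \<comment> \<open>The strict lower bound on \<open>L\<close> matters if \<open>u 1 = 0\<close>: a
    positive \<open>L\<close> is needed to find \<open>e\<close> with
    \<open>N * e \<le> L\<close>.\<close>
  with L have L0: "L > 0" by linarith
  define B where "B w = 1 / (w - of_real a) + 1 / (of_real b - w)" for w :: complex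
  have B1: "Re (1 / (w - of_real a)) = (Re w - a) / ((Re w - a)\<^sup>2 + (Im w)\<^sup>2)" for w
    by (simp add: Re_divide power2_eq_square)
  have B2: "Re (1 / (of_real b - w)) = (b - Re w) / ((b - Re w)\<^sup>2 + (Im w)\<^sup>2)" for w
    by (simp add: Re_divide power2_eq_square)
  have "compact (cball (0::complex) 10)" by simp
  moreover have "continuous_on (cball 0 10) u" using u by (auto simp: vanishing_positive_def intro: continuous_on_subset)
  ultimately obtain N where N: "\<And>w. norm w \<le> 10 \<Longrightarrow> u w \<le> N"
    using continuous_attains_sup[of "cball (0::complex) 10" u] by (auto simp: dist_norm) (metis mem_cball_0)
  \<comment> \<open>The rhombus is cut off at distance \<open>e\<close> from its corners, where the
    barrier is singular. The first term keeps \<open>z\<close> inside; the second gives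
    \<open>u \<le> N \<le> L / e\<close> on the vertical cuts, where the barrier is at least
    \<open>1 / (2 * e)\<close>. The uncontrolled constant \<open>N\<close> affects only the cut, not
    the final bound.\<close>
  define e where "e = min (min (Re z - a) (b - Re z) / 2) (L / (\<bar>N\<bar> + 1))"
  have e: "e > 0" "e < Re z - a" "e < b - Re z" "N * e \<le> L"
  proof -
    have "0 < L / (\<bar>N\<bar> + 1)" using L0 by (intro divide_pos_pos) auto
    then show "e > 0" using z L0 by (auto simp: e_def)
    have "e \<le> min (Re z - a) (b - Re z) / 2" unfolding e_def by (rule min.cobounded1)
    then have "2 * e \<le> Re z - a" "2 * e \<le> b - Re z" by auto
    then show "e < Re z - a" "e < b - Re z" using \<open>e > 0\<close> by auto
    have "e \<le> L / (\<bar>N\<bar> + 1)" by (simp add: e_def)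
    then have "e * (\<bar>N\<bar> + 1) \<le> L" by (simp add: pos_le_divide_eq)
    moreover have "N * e \<le> e * (\<bar>N\<bar> + 1)" using \<open>e > 0\<close> by (simp add: mult.commute mult_left_mono)
    ultimately show "N * e \<le> L" by linarith
  qed
  define K where "K = {w. \<bar>Im w\<bar> \<le> Re w - a \<and> \<bar>Im w\<bar> \<le> b - Re w \<and> a + e \<le> Re w \<and> Re w \<le> b - e}"
  define G where "G = {w. \<bar>Im w\<bar> < Re w - a \<and> \<bar>Im w\<bar> < b - Re w \<and> a + e < Re w \<and> Re w < b - e}"
  have Kim: "\<bar>Im w\<bar> \<le> 1" "-2 \<le> Re w" "Re w \<le> 1" "Re w - a > 0" "b - Re w > 0" if "w \<in> K" for w
    using that ab e by (auto simp: K_def)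
  have Bpos: "0 \<le> Re (1 / (w - of_real a))" "0 \<le> Re (1 / (of_real b - w))" if "w \<in> K" for w
    unfolding B1 B2 using Kim[OF that] by auto
  have corner: "1 / (2 * s) \<le> s / (s\<^sup>2 + y\<^sup>2)" if "\<bar>y\<bar> \<le> s" "0 < s" for s y :: real
  proof -
    have "y\<^sup>2 \<le> s\<^sup>2" using that by (simp add: abs_le_square_iff[symmetric])
    moreover have "s\<^sup>2 > 0" using that by simp
    ultimately show ?thesis using that by (simp add: field_simps power2_eq_square add_pos_nonneg)
  qed
  have bd: "u w - 2 * L * Re (B w) \<le> 0" if w: "w \<in> K - (G \<inter> - E)" for w
  proof -
    have wK: "w \<in> K" using w by auto
    have Bw: "0 \<le> Re (B w)" using Bpos[OF wK] by (simp add: B_def)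
    consider "w \<in> E" | "Re w = a + e \<or> Re w = b - e" | "\<bar>Im w\<bar> = Re w - a \<or> \<bar>Im w\<bar> = b - Re w"
      using w by (auto simp: K_def G_def)
    then show ?thesis
    proof cases
      case 1 then show ?thesis using u Bw L0 by (auto simp: vanishing_positive_def)
    next
      case 2
      have "1 / (2 * e) \<le> Re (B w)"
        using 2
      proof
        assume "Re w = a + e"
        then have "1 / (2 * e) \<le> Re (1 / (w - of_real a))"
          unfolding B1 using corner[of "Im w" e] wK e by (simp add: K_def)
        then show ?thesis using Bpos[OF wK] by (simp add: B_def)
      next
        assume "Re w = b - e"
        then have "1 / (2 * e) \<le> Re (1 / (of_real b - w))"
          unfolding B2 using corner[of "Im w" e] wK e by (simp add: K_def)
        then show ?thesis using Bpos[OF wK] by (simp add: B_def)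
      qed
      then have "2 * L * (1 / (2 * e)) \<le> 2 * L * Re (B w)" using L0 by (intro mult_left_mono) auto
      moreover have "N \<le> L / e" using e by (simp add: pos_le_divide_eq)
      moreover have "u w \<le> N"
        using cmod_le[of w] Kim[OF wK] by (intro N) linarith
      ultimately show ?thesis by simp
    next
      case 3
      have y: "\<bar>Im w\<bar> > 0" using 3 Kim[OF wK] by auto
      have "1 / (2 * \<bar>Im w\<bar>) \<le> Re (B w)"
        using 3
      proof
        assume *: "\<bar>Im w\<bar> = Re w - a"
        have "1 / (2 * \<bar>Im w\<bar>) \<le> Re (1 / (w - of_real a))"
          unfolding B1 using corner[of "Im w" "Re w - a"] * y by simp
        then show ?thesis using Bpos[OF wK] by (simp add: B_def)
      next
        assume *: "\<bar>Im w\<bar> = b - Re w"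
        have "1 / (2 * \<bar>Im w\<bar>) \<le> Re (1 / (of_real b - w))"
          unfolding B2 using corner[of "Im w" "b - Re w"] * y by simp
        then show ?thesis using Bpos[OF wK] by (simp add: B_def)
      qed
      then have "2 * L * (1 / (2 * \<bar>Im w\<bar>)) \<le> 2 * L * Re (B w)" using L0 by (intro mult_left_mono) auto
      moreover have "u w \<le> L / \<bar>Im w\<bar>"
        using harnack_near_slit(1)[OF u Kim(2,3,1)[OF wK]] L y by (simp add: pos_le_divide_eq mult.commute)
      ultimately show ?thesis by simp
    qed
  qed
  have "u z - 2 * L * Re (B z) \<le> 0"
  proof (rule Re_holomorphic_sup_max_principle[where U = "G \<inter> - E" and K = K and S = "\<lambda>z. u z - 2 * L * Re (B z)"])
    show "open (G \<inter> - E)"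
    proof (rule open_Int)
      show "open G" unfolding G_def
        by (intro open_Collect_conj open_Collect_less continuous_intros)
      show "open (- E)" using u by (auto simp: vanishing_positive_def)
    qed
    show "G \<inter> - E \<subseteq> K" by (auto simp: G_def K_def)
    have "closed K" unfolding K_def
      by (intro closed_Collect_conj closed_Collect_le continuous_intros)
    moreover have "bounded K"
      unfolding bounded_iff
    proof (intro exI ballI)
      show "norm w \<le> 10" if "w \<in> K" for w using cmod_le[of w] Kim[OF that] by linarith
    qed
    ultimately show "compact K" by (simp add: compact_eq_bounded_closed)
    have nz: "w - of_real a \<noteq> 0" "of_real b - w \<noteq> 0" if "w \<in> K" for w
      using Kim[OF that] by (auto simp: complex_eq_iff)
    show "continuous_on K (\<lambda>z. u z - 2 * L * Re (B z))" unfolding B_def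
      using nz u by (intro continuous_intros) (auto simp: vanishing_positive_def intro: continuous_on_subset)
    have "(\<lambda>z. 2 * of_real L * B z) holomorphic_on G"
      unfolding B_def using nz \<open>closed K\<close> by (intro holomorphic_intros) (auto simp: G_def complex_eq_iff)
    from locally_Re_holomorphic_on_Re[OF this]
    have "(\<lambda>z. 2 * L * Re (B z)) locally_Re_holomorphic_on G" by simp
    then show "Re_holomorphic_sup_on (\<lambda>z. u z - 2 * L * Re (B z)) (G \<inter> - E)"
      using u by (intro Re_holomorphic_sup_on_diff locally_Re_holomorphic_imp_sup)
        (auto simp: vanishing_positive_def elim: locally_Re_holomorphic_on_subset)
    show "z \<in> K" using z e by (auto simp: K_def)
  qed (use bd in auto)
  then show ?thesis by (simp add: B_def)
qed

lemma unit_circle_near_real_axis: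
  assumes "norm z = 1" "\<bar>Im z\<bar> < 1/8"
  shows "\<bar>Re z\<bar> > 49/50"
proof -
  have "(Re z)\<^sup>2 + (Im z)\<^sup>2 = 1" using assms(1) by (metis cmod_power2 one_power2)
  moreover have "(Im z)\<^sup>2 < (1/8)\<^sup>2" using assms(2) by (metis abs_ge_zero power2_abs power_strict_mono zero_less_numeral)
  ultimately have "(Re z)\<^sup>2 > (49/50)\<^sup>2" by (simp add: power2_eq_square)
  then have "(49/50)\<^sup>2 < \<bar>Re z\<bar>\<^sup>2" by simp
  then show ?thesis by (rule power_less_imp_less_base) simp
qed

text \<open>Three arcs: away from the real axis the bound with loss
  \<open>1 / \<bar>Im z\<bar>\<close> suffices, and near 1 a single Harnack step. Near -1, where
  \<open>E\<close> may be arbitrary, the Carleson estimate is used on the rhombus with corners -3/2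
  and -1/2. Its barrier is at most 5 there, whence
  \<open>2 * 5 * 2 * 3^8 = 20 * 3^8\<close>.\<close>

lemma vanishing_positive_le_on_circle:
  assumes u: "vanishing_positive E u" and z: "norm z = 1"
  shows "u z \<le> 20 * 3^8 * u 1"
proof -
  have pos: "0 \<le> u w" for w using u by (simp add: vanishing_positive_def)
  have le: "\<bar>Re z\<bar> \<le> 1" "\<bar>Im z\<bar> \<le> 1" using z abs_Re_le_cmod[of z] abs_Im_le_cmod[of z] by auto
  show ?thesis
  proof (cases "\<bar>Im z\<bar> < 1/8")
    case False
    have "1/8 * u z \<le> \<bar>Im z\<bar> * u z" using False pos by (intro mult_right_mono) auto
    also have "\<dots> \<le> 2 * 3^8 * u 1" by (rule harnack_near_slit[OF u]) (use le in auto)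
    finally show ?thesis using pos[of 1] by simp
  next
    case True
    note Re = unit_circle_near_real_axis[OF z True]
    show ?thesis
    proof (cases "Re z > 0")
      case True': True
      have "dist 1 z \<le> \<bar>1 - Re z\<bar> + \<bar>0 - Im z\<bar>"
        using cmod_le[of "1 - z"] by (simp add: dist_norm)
      then have "2 * dist 1 z \<le> 1" using True True' Re le by auto
      then have "u z \<le> 3 * u 1" by (intro harnack_half(1)[OF u ball_off_slit]) auto
      then show ?thesis using pos[of 1] by simp
    next
      case False
      then have x: "-1 \<le> Re z" "Re z < -49/50" using Re le by auto
      have "u z \<le> 10 * L" if L: "2 * 3^8 * u 1 < L" for L
      proof -
        have "0 \<le> 2 * 3^8 * u 1" using pos[of 1] by simp
        with L have "L > 0" by linarith
        have "Re (1 / (z - of_real (-3/2))) \<le> 2"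
        proof -
          have "(Re z + 3/2) / ((Re z + 3/2)\<^sup>2 + (Im z)\<^sup>2) \<le> (Re z + 3/2) / ((Re z + 3/2)\<^sup>2)"
            using x by (intro divide_left_mono mult_pos_pos add_pos_nonneg) auto
          also have "\<dots> = 1 / (Re z + 3/2)" by (simp add: power2_eq_square)
          also have "\<dots> \<le> 2" using x by (simp add: pos_divide_le_eq)
          finally show ?thesis by (simp add: Re_divide power2_eq_square)
        qed
        moreover have "Re (1 / (of_real (-1/2) - z)) \<le> 3"
        proof -
          have "(-1/2 - Re z) / ((-1/2 - Re z)\<^sup>2 + (Im z)\<^sup>2) \<le> (-1/2 - Re z) / ((-1/2 - Re z)\<^sup>2)"
            using x by (intro divide_left_mono mult_pos_pos add_pos_nonneg) auto
          also have "\<dots> = 1 / (-1/2 - Re z)" by (simp add: power2_eq_square)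
          also have "\<dots> \<le> 3" using x by (simp add: pos_divide_le_eq)
          finally show ?thesis by (simp add: Re_divide power2_eq_square)
        qed
        ultimately have "Re (1 / (z - of_real (-3/2)) + 1 / (of_real (-1/2) - z)) \<le> 5" by simp
        then have "2 * L * Re (1 / (z - of_real (-3/2)) + 1 / (of_real (-1/2) - z)) \<le> 2 * L * 5"
          using \<open>L > 0\<close> by (intro mult_left_mono) auto
        moreover have "u z \<le> 2 * L * Re (1 / (z - of_real (-3/2)) + 1 / (of_real (-1/2) - z))"
          by (rule carleson_estimate[OF u _ _ _ _ L]) (use x True in auto)
        ultimately show ?thesis by linarith
      qed
      then have "u z / 10 \<le> L" if "2 * 3^8 * u 1 < L" for L using that by fastforce
      then have "u z / 10 \<le> 2 * 3^8 * u 1" by (rule dense_ge)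
      then show ?thesis by simp
    qed
  qed
qed

text \<open>Near -1 no such bound can hold in general, since \<open>v\<close> vanishes on
  \<open>E\<close>. At distance 1/8 from the axis the loss \<open>1 / \<bar>Im z\<bar>\<close> is at
  most 8, which gives \<open>8 * 2 = 16\<close>.\<close>

lemma vanishing_positive_ge_on_circle:
  assumes v: "vanishing_positive E v" and z: "norm z = 1" "\<bar>Im z\<bar> \<ge> 1/8"
  shows "v 1 \<le> 16 * 3^8 * v z"
proof -
  have pos: "0 \<le> v w" for w using v by (simp add: vanishing_positive_def)
  have le: "\<bar>Re z\<bar> \<le> 1" "\<bar>Im z\<bar> \<le> 1" using z abs_Re_le_cmod[of z] abs_Im_le_cmod[of z] by auto
  have "1/8 * v 1 \<le> \<bar>Im z\<bar> * v 1" using z pos by (intro mult_right_mono) auto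
  also have "\<dots> \<le> 2 * 3^8 * v z" by (rule harnack_near_slit[OF v]) (use le in auto)
  finally show ?thesis by simp
qed

section \<open>Comparison in the unit disc and passage to all scales\<close>

lemma vanishing_positive_max_principle:
  assumes S: "Re_holomorphic_sup_on S (- E)" "closed E" "continuous_on UNIV S"
    and le: "\<And>z. z \<in> E \<Longrightarrow> norm z \<le> r \<Longrightarrow> S z \<le> c" "\<And>z. norm z = r \<Longrightarrow> S z \<le> c" and z: "norm z \<le> r"
  shows "S z \<le> c"
proof (rule Re_holomorphic_sup_max_principle[where U = "ball 0 r - E" and K = "cball 0 r"])
  show "Re_holomorphic_sup_on S (ball 0 r - E)"
    by (rule Re_holomorphic_sup_on_subset[OF S(1)]) auto
  show "continuous_on (cball 0 r) S" using S(3) by (rule continuous_on_subset) simp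
  show "S z \<le> c" if "z \<in> cball 0 r - (ball 0 r - E)" for z
    using that le[of z] by auto
qed (use S z in auto)

lemma vanishing_positive_le_on_disc:
  assumes u: "vanishing_positive E u" and z: "norm z \<le> 1"
  shows "u z \<le> 20 * 3^8 * u 1"
proof (rule vanishing_positive_max_principle[of u E 1])
  show "Re_holomorphic_sup_on u (- E)"
    using u by (auto simp: vanishing_positive_def intro: locally_Re_holomorphic_imp_sup)
qed (use u z vanishing_positive_le_on_circle[OF u] in \<open>auto simp: vanishing_positive_def\<close>)

text \<open>The harmonic polynomial \<open>Re ((z - x0)\<^sup>2)\<close> is nonnegative on \<open>E\<close>, nonpositive on the
  line \<open>Re z = x0\<close>, and bounded below by a positive constant at the points of the unit circle close to
  the real axis. It therefore compensates for the lack of a lower bound for \<open>v\<close> there.\<close>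

lemma boundary_harnack_disc:
  assumes u: "vanishing_positive E u" and v: "vanishing_positive E v" and z: "norm z \<le> 1/2"
  shows "u z * v 1 \<le> (20 * 3^8) * (96 * 3^8) * (u 1 * v z)"
proof -
  have posu: "0 \<le> u w" and posv: "0 \<le> v w" for w using u v by (auto simp: vanishing_positive_def)
  define x where "x = Re z"
  have x: "\<bar>x\<bar> \<le> 1/2" using z abs_Re_le_cmod[of z] by (simp add: x_def)
  define q where "q w = (Re w - x)\<^sup>2 - (Im w)\<^sup>2" for w
  define A :: real where "A = 20 * 3^8"
  define g where "g w = v 1 * u w - A * u 1 * (96 * 3^8 * v w + 5 * v 1 * q w)" for w
  have q: "q w = Re ((w - of_real x)\<^sup>2)" for w by (simp add: q_def power2_eq_square)
  have A: "0 \<le> A * u 1" using posu by (simp add: A_def)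
  \<comment> \<open>Near the real axis \<open>\<bar>Re w\<bar> > 49/50\<close> and
    \<open>\<bar>x\<bar> \<le> 1/2\<close> give
    \<open>q w \<ge> (12/25)\<^sup>2 - (1/8)\<^sup>2 > 1/5\<close>, hence the factor 5. Elsewhere
    \<open>q w \<ge> -1\<close> costs at most \<open>5 * v 1\<close>, so \<open>v w\<close> has to
    pay for \<open>6 * v 1\<close>, and \<open>6 * 16 = 96\<close>.\<close>
  have ge: "v 1 \<le> 96 * 3^8 * v w + 5 * v 1 * q w" if w: "norm w = 1" for w
  proof (cases "\<bar>Im w\<bar> < 1/8")
    case True
    note Re = unit_circle_near_real_axis[OF w True]
    have "12/25 \<le> \<bar>Re w - x\<bar>" using Re x abs_triangle_ineq2[of "Re w" x] by linarith
    then have "(12/25)\<^sup>2 \<le> (Re w - x)\<^sup>2" by (metis abs_ge_zero power2_abs power_mono zero_le_divide_iff zero_le_numeral)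
    moreover have "(Im w)\<^sup>2 \<le> (1/8)\<^sup>2" using True by (metis abs_ge_zero less_imp_le power2_abs power_mono)
    ultimately have "1 \<le> 5 * q w" by (simp add: q_def power2_eq_square)
    then have "v 1 * 1 \<le> v 1 * (5 * q w)" using posv by (intro mult_left_mono) auto
    then show ?thesis using posv[of w] by simp
  next
    case False
    have "(Im w)\<^sup>2 \<le> 1" using abs_Im_le_cmod[of w] w by (simp add: abs_square_le_1)
    then have "-1 \<le> q w" unfolding q_def using zero_le_power2[of "Re w - x"] by linarith
    then have "v 1 * (-5) \<le> v 1 * (5 * q w)" using posv by (intro mult_left_mono) auto
    moreover have "v 1 \<le> 16 * 3^8 * v w" using vanishing_positive_ge_on_circle[OF v w] False by simp
    moreover have "v 1 * (5 * q w) = 5 * v 1 * q w" by simp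
    ultimately show ?thesis using posv[of w] by linarith
  qed
  have "g z \<le> 0"
  proof (rule vanishing_positive_max_principle[of g E 1])
    have "(\<lambda>w. Re ((w - of_real x)\<^sup>2)) locally_Re_holomorphic_on (- E)"
      by (intro locally_Re_holomorphic_on_Re holomorphic_intros)
    then have "(\<lambda>w. 1 * (v 1 * u w + (- A * u 1 * (96 * 3^8)) * v w) + (- A * u 1 * 5 * v 1) * Re ((w - of_real x)\<^sup>2))
        locally_Re_holomorphic_on (- E)"
      using u v by (intro locally_Re_holomorphic_on_lincomb) (auto simp: vanishing_positive_def)
    moreover have "g = (\<lambda>w. 1 * (v 1 * u w + (- A * u 1 * (96 * 3^8)) * v w) + (- A * u 1 * 5 * v 1) * Re ((w - of_real x)\<^sup>2))"
      unfolding g_def q fun_eq_iff by (simp add: algebra_simps)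
    ultimately show "Re_holomorphic_sup_on g (- E)" by (metis locally_Re_holomorphic_imp_sup)
    show "continuous_on UNIV g" unfolding g_def q_def
      using u v by (intro continuous_intros) (auto simp: vanishing_positive_def)
    show "g w \<le> 0" if w: "w \<in> E" for w
    proof -
      have "w \<in> \<real>\<^sub>\<le>\<^sub>0" using w u by (auto simp: vanishing_positive_def)
      then have "0 \<le> q w" by (simp add: q_def complex_nonpos_Reals_iff)
      then have "0 \<le> A * u 1 * (5 * v 1 * q w)" using A posv by simp
      moreover have "u w = 0" "v w = 0" using u v w by (auto simp: vanishing_positive_def)
      ultimately show ?thesis by (simp add: g_def)
    qed
    show "g w \<le> 0" if w: "norm w = 1" for w
    proof -
      have "v 1 * u w \<le> v 1 * (A * u 1)"
        using vanishing_positive_le_on_circle[OF u w] posv by (intro mult_left_mono) (auto simp: A_def)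
      also have "\<dots> = A * u 1 * v 1" by simp
      also have "\<dots> \<le> A * u 1 * (96 * 3^8 * v w + 5 * v 1 * q w)"
        using ge[OF w] A by (rule mult_left_mono)
      finally show ?thesis by (simp add: g_def)
    qed
  qed (use u z in \<open>auto simp: vanishing_positive_def\<close>)
  moreover have "A * u 1 * (5 * v 1 * q z) \<le> 0"
    using A posv[of 1] by (simp add: q_def x_def mult_nonneg_nonpos)
  ultimately have "v 1 * u z \<le> A * u 1 * (96 * 3^8 * v z)"
    unfolding g_def distrib_left by linarith
  then show ?thesis by (simp add: A_def mult_ac)
qed

text \<open>The ball of radius \<open>2^Suc k\<close> about \<open>2^Suc k\<close> misses the slit
  and has \<open>2^k\<close> at half its radius. Positivity thus passes between 1 and the large
  radii at which the disc estimates are applied.\<close>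

lemma vanishing_positive_powers_of_2:
  assumes u: "vanishing_positive E u"
  shows "u 1 \<le> 3^k * u (2^k)" "u (2^k) \<le> 3^k * u 1"
proof -
  have step: "u (2^k) \<le> 3 * u (2^Suc k)" "u (2^Suc k) \<le> 3 * u (2^k)" for k
  proof -
    have "ball (2^Suc k :: complex) (2^Suc k) \<subseteq> - \<real>\<^sub>\<le>\<^sub>0" 
      using ball_off_slit[of "of_real (2^Suc k)" "2^Suc k"] by simp
    moreover have "2 * dist (2^Suc k) (2^k::complex) \<le> 2^Suc k"
      by (simp add: dist_norm norm_power)
    ultimately show "u (2^k) \<le> 3 * u (2^Suc k)" "u (2^Suc k) \<le> 3 * u (2^k)"
      using harnack_half[OF u, of "2^Suc k" "2^Suc k" "2^k"] by auto
  qed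
  show "u 1 \<le> 3^k * u (2^k)"
  proof (induction k)
    case (Suc k)
    also have "3^k * u (2^k) \<le> 3^k * (3 * u (2^Suc k))" using step(1) by (intro mult_left_mono) auto
    finally show ?case by (simp add: mult_ac)
  qed simp
  show "u (2^k) \<le> 3^k * u 1"
  proof (induction k)
    case (Suc k)
    with step(2)[of k] show ?case by simp
  qed simp
qed

lemma obtain_power_of_2:
  fixes x :: real obtains k where "x \<le> 2^k"
  using real_arch_pow[of 2 x] by (metis less_imp_le one_less_numeral_iff semiring_norm(76))

text \<open>If \<open>u\<close> vanished at 1, it would vanish at every power of 2, and the disc
  estimate at that scale would make it zero on arbitrarily large discs. Hence 1 can serve as the
  normalisation point.\<close>

lemma vanishing_positive_pos:
  assumes u: "vanishing_positive E u" and z: "u z \<noteq> 0"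
  shows "u 1 > 0"
proof (rule ccontr)
  have pos: "0 \<le> u w" for w using u by (simp add: vanishing_positive_def)
  assume "\<not> 0 < u 1"
  then have 0: "u (2^k) = 0" for k 
    using vanishing_positive_powers_of_2(2)[OF u, of k] pos[of 1] pos[of "2^k"] by auto
  obtain k where k: "norm z \<le> 2^k" by (rule obtain_power_of_2)
  have "u (of_real (2^k) * (z / 2^k)) \<le> 20 * 3^8 * u (of_real (2^k) * 1)"
    by (rule vanishing_positive_le_on_disc[OF vanishing_positive_scale[OF u]])
      (use k in \<open>auto simp: norm_divide norm_power\<close>)
  then show False using 0[of k] z pos[of z] by simp
qed

text \<open>For \<open>R\<close> at least 2 and \<open>2 * norm z\<close>, the disc estimate at
  scale \<open>R\<close> is used twice: \<open>u z / v z\<close> is at most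
  \<open>C * u R / v R\<close>, and this is at most \<open>C\<^sup>2 * u 1 / v 1\<close>. The radius
  cancels, so one constant serves the whole plane.\<close>

theorem boundary_harnack:
  assumes u: "vanishing_positive E u" and v: "vanishing_positive E v"
  shows "u z * v 1 \<le> ((20 * 3^8) * (96 * 3^8))\<^sup>2 * (u 1 * v z)"
proof (cases "v 1 = 0")
  case True
  then show ?thesis using u v by (simp add: vanishing_positive_def)
next
  case False
  have posu: "0 \<le> u w" and posv: "0 \<le> v w" for w using u v by (auto simp: vanishing_positive_def)
  define C :: real where "C = (20 * 3^8) * (96 * 3^8)"
  obtain k where k: "max (2 * norm z) 2 \<le> 2^k" by (rule obtain_power_of_2)
  define R :: real where "R = 2^k"
  have R: "R > 0" by (simp add: R_def)
  have sc: "u w * v R \<le> C * (u R * v w)" "v w * u R \<le> C * (v R * u w)" if "2 * norm w \<le> R" for w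
  proof -
    have "norm (w / of_real R) \<le> 1/2" using that R by (simp add: norm_divide)
    from boundary_harnack_disc[OF vanishing_positive_scale[OF u R] vanishing_positive_scale[OF v R] this]
      boundary_harnack_disc[OF vanishing_positive_scale[OF v R] vanishing_positive_scale[OF u R] this]
    show "u w * v R \<le> C * (u R * v w)" "v w * u R \<le> C * (v R * u w)"
      using R by (simp_all add: C_def)
  qed
  have vR: "v R > 0"
  proof -
    have "v 1 > 0" using False posv[of 1] by simp
    then have "0 < 3^k * v (2^k)" using vanishing_positive_powers_of_2(1)[OF v, of k] by linarith
    then show ?thesis by (simp add: R_def zero_less_mult_iff)
  qed
  have "(u z * v 1) * v R = (u z * v R) * v 1" by simp
  also have "\<dots> \<le> (C * (u R * v z)) * v 1"
    using sc(1)[of z] k posv by (intro mult_right_mono) (auto simp: R_def)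
  also have "\<dots> = C * v z * (v 1 * u R)" by simp
  also have "\<dots> \<le> C * v z * (C * (v R * u 1))"
    using sc(2)[of 1] k posv by (intro mult_left_mono) (auto simp: R_def C_def)
  also have "\<dots> = (C\<^sup>2 * (u 1 * v z)) * v R" by (simp add: power2_eq_square)
  finally show ?thesis using vR by (simp add: C_def)
qed

text \<open>Let \<open>c\<close> be the largest constant with \<open>c * v \<le> u\<close>. The
  remainder is again in the class. Were it positive at 1, it would dominate a positive multiple of
  \<open>v\<close>, and \<open>c\<close> could be enlarged. So it is zero at 1, and comparison with
  \<open>v\<close> makes it zero everywhere.\<close>

theorem vanishing_positive_unique:
  assumes u: "vanishing_positive E u" and v: "vanishing_positive E v" and v1: "v 1 > 0"
  obtains c where "\<And>z. u z = c * v z"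
proof -
  have posu: "0 \<le> u w" and posv: "0 \<le> v w" for w using u v by (auto simp: vanishing_positive_def)
  define C :: real where "C = ((20 * 3^8) * (96 * 3^8))\<^sup>2"
  have C: "C > 0" by (simp add: C_def)
  define T where "T = {t. \<forall>z. t * v z \<le> u z}"
  have T0: "0 \<in> T" using posu by (simp add: T_def)
  have Tb: "t \<le> u 1 / v 1" if "t \<in> T" for t using that v1 by (simp add: T_def pos_le_divide_eq)
  then have bdd: "bdd_above T" by (rule bdd_aboveI)
  define c where "c = Sup T"
  have c: "c * v z \<le> u z" for z
  proof (cases "v z = 0")
    case False
    then have vz: "v z > 0" using posv[of z] by simp
    have "c \<le> u z / v z" unfolding c_def
    proof (rule cSup_least)
      show "T \<noteq> {}" using T0 by blast
      show "t \<le> u z / v z" if "t \<in> T" for t using that vz by (simp add: T_def pos_le_divide_eq)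
    qed
    then show ?thesis using vz by (simp add: pos_le_divide_eq)
  qed (use posu in simp)
  define w where "w z = u z - c * v z" for z
  have w: "vanishing_positive E w" unfolding vanishing_positive_def
  proof (intro conjI)
    have "(\<lambda>z. 1 * u z + (- c) * v z) locally_Re_holomorphic_on - E"
      using u v by (intro locally_Re_holomorphic_on_lincomb) (auto simp: vanishing_positive_def)
    then show "w locally_Re_holomorphic_on - E" by (simp add: w_def[abs_def])
    show "continuous_on UNIV w" unfolding w_def 
      using u v by (intro continuous_intros) (auto simp: vanishing_positive_def)
  qed (use u v c in \<open>auto simp: vanishing_positive_def w_def\<close>)
  have posw: "0 \<le> w z" for z using w by (simp add: vanishing_positive_def)
  have "w 1 = 0"
  proof (rule ccontr)
    assume "w 1 \<noteq> 0"
    then have w1: "w 1 > 0" using posw[of 1] by simp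
    define d where "d = w 1 / (C * v 1)"
    have d: "d > 0" using w1 v1 C by (simp add: d_def)
    have "d * v z \<le> w z" for z
    proof -
      have "v z * w 1 \<le> C * (v 1 * w z)" unfolding C_def by (rule boundary_harnack[OF v w])
      then show ?thesis using C v1 by (simp add: d_def pos_divide_le_eq mult_ac)
    qed
    then have "c + d \<in> T" by (auto simp: T_def w_def algebra_simps)
    then have "c + d \<le> c" unfolding c_def using bdd by (rule cSup_upper)
    then show False using d by simp
  qed
  have "w z = 0" for z
  proof -
    have "w z * v 1 \<le> 0" using boundary_harnack[OF w v, of z] \<open>w 1 = 0\<close> by simp
    then show ?thesis using v1 posw[of z] by (simp add: mult_le_0_iff)
  qed
  then have "u z = c * v z" for z by (simp add: w_def)
  then show ?thesis by (rule that)
qed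

section \<open>Holomorphic coverings by the half-plane\<close>

lemma open_upper_half_plane: "open upper_half_plane"
  unfolding upper_half_plane_def by (rule open_halfspace_Im_gt)

text \<open>Near \<open>g b\<close> the covering is an injective holomorphic map, and the continuous
  lift is \<open>f\<close> followed by its holomorphic inverse.\<close>

lemma holomorphic_on_lift:
  assumes cov: "covering_space C p S" "p holomorphic_on C" "open C" "open S"
    and B: "open B" and f: "f holomorphic_on B"
    and g: "continuous_on B g" "g \<in> B \<rightarrow> C" "\<And>z. z \<in> B \<Longrightarrow> p (g z) = f z"
  shows "g holomorphic_on B"
  unfolding holomorphic_on_open[OF B]
proof
  fix b assume b: "b \<in> B"
  then have "g b \<in> C" using g by auto
  then obtain T U q where T: "g b \<in> T" "openin (top_of_set C) T" and hom: "homeomorphism T U p q"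
    by (rule covering_space_local_homeomorphism[OF cov(1)])
  have T': "open T" "T \<subseteq> C" using T(2) cov(3) by (auto simp: openin_open_eq)
  have inj: "inj_on p T" using hom by (metis homeomorphism_apply1 inj_onI)
  have pT: "p holomorphic_on T" using cov(2) T' holomorphic_on_subset by blast
  obtain h where h: "h holomorphic_on (p ` T)" "\<And>z. z \<in> T \<Longrightarrow> h (p z) = z"
    using holomorphic_has_inverse[OF pT T'(1) inj] by metis
  have opT: "open (p ` T)" by (rule open_mapping_thm3[OF pT T'(1) inj])
  define V where "V = B \<inter> g -` T"
  have V: "open V" "b \<in> V" "V \<subseteq> B"
    using continuous_open_preimage[OF g(1) B T'(1)] b T by (auto simp: V_def)
  have fV: "f \<in> V \<rightarrow> p ` T" using g(3) by (force simp: V_def)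
  have "(h \<circ> f) holomorphic_on V"
    by (rule holomorphic_on_compose_gen[OF holomorphic_on_subset[OF f V(3)] h(1)]) (use fV in auto)
  moreover have "(h \<circ> f) z = g z" if "z \<in> V" for z
    using h(2)[of "g z"] g(3)[of z] that by (auto simp: V_def)
  ultimately have "g holomorphic_on V" by (metis (no_types, lifting) holomorphic_transform)
  then show "\<exists>f'. (g has_field_derivative f') (at b)"
    using V by (auto simp: holomorphic_on_open)
qed

lemma obtain_holomorphic_lift:
  assumes cov: "covering_space C p S" "p holomorphic_on C" "open C" "open S"
    and B: "open B" "simply_connected B" and f: "f holomorphic_on B" "f \<in> B \<rightarrow> S"
    and z: "z \<in> B" "a \<in> C" "f z = p a"
  obtains g where "g holomorphic_on B" "g \<in> B \<rightarrow> C" "g z = a" "\<And>y. y \<in> B \<Longrightarrow> p (g y) = f y"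
proof -
  obtain g where g: "continuous_on B g" "g \<in> B \<rightarrow> C" "g z = a" "\<And>y. y \<in> B \<Longrightarrow> p (g y) = f y"
    using covering_space_lift_strong[OF cov(1) z(2,1) B(2) open_imp_locally_path_connected[OF B(1)]
      holomorphic_on_imp_continuous_on[OF f(1)] f(2) z(3)] by blast
  show ?thesis
    by (rule that[of g]) (use g holomorphic_on_lift[OF cov B(1) f(1) g(1,2,4)] in auto)
qed

lemma obtain_section_over_ball:
  assumes cov: "covering_space C p S" "p holomorphic_on C" "open C" "open S"
    and B: "ball a r \<subseteq> S" and w: "w \<in> C" "p w \<in> ball a r"
  obtains g where "g holomorphic_on ball a r" "g \<in> ball a r \<rightarrow> C" "g (p w) = w"
    "\<And>z. z \<in> ball a r \<Longrightarrow> p (g z) = z"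
  by (rule obtain_holomorphic_lift[OF cov open_ball convex_imp_simply_connected[OF convex_ball] holomorphic_on_ident _ w(2,1) refl])
    (use B in auto)

text \<open>Both \<open>g \<circ> f\<close> and the identity are lifts of \<open>p\<close> through
  itself that agree at \<open>a\<close>, so they agree on the connected set
  \<open>C\<close>.\<close>

lemma covering_self_maps_inverse:
  fixes p :: "complex \<Rightarrow> complex"
  assumes cov: "covering_space C p S" "p holomorphic_on C" "connected C"
    and f: "f holomorphic_on C" "f \<in> C \<rightarrow> C" "\<And>y. y \<in> C \<Longrightarrow> p (f y) = p y"
    and g: "g holomorphic_on C" "g \<in> C \<rightarrow> C" "\<And>y. y \<in> C \<Longrightarrow> p (g y) = p y"
    and a: "g (f a) = a" "a \<in> C" and z: "z \<in> C"
  shows "g (f z) = z"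
proof -
  have "g \<circ> f holomorphic_on C"
    by (rule holomorphic_on_compose_gen[OF f(1) g(1)]) (use f(2) in auto)
  then have 1: "continuous_on C (g \<circ> f)" by (rule holomorphic_on_imp_continuous_on)
  have 2: "continuous_on C p" using cov(2) by (rule holomorphic_on_imp_continuous_on)
  have 3: "g \<circ> f \<in> C \<rightarrow> C" using f(2) g(2) by auto
  have 4: "p x = p ((g \<circ> f) x)" if "x \<in> C" for x
    using f(2,3) g(3)[of "f x"] that by (auto simp: Pi_iff)
  have 5: "p \<in> C \<rightarrow> S" using covering_space_imp_surjective[OF cov(1)] by auto
  have "(g \<circ> f) z = id z"
    by (rule covering_space_lift_unique[OF cov(1) _ 2 5 1 3 4 _ _ _ cov(3) a(2) z]) (use a in auto)
  then show ?thesis by simp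
qed

text \<open>The transformation is the lift of \<open>p\<close> through itself that sends
  \<open>w\<close> to \<open>w'\<close>, which exists as \<open>C\<close> is simply connected. The
  lift with \<open>w\<close> and \<open>w'\<close> exchanged is its inverse.\<close>

lemma obtain_deck_transformation:
  assumes cov: "covering_space C p S" "p holomorphic_on C" "open C" "open S" "simply_connected C"
    and w: "w \<in> C" "w' \<in> C" "p w = p w'"
  obtains \<gamma> \<delta> where "\<gamma> holomorphic_on C" "\<gamma> \<in> C \<rightarrow> C" "\<delta> holomorphic_on C" "\<delta> \<in> C \<rightarrow> C"
    "\<gamma> w = w'" "\<And>z. z \<in> C \<Longrightarrow> \<delta> (\<gamma> z) = z" "\<And>z. z \<in> C \<Longrightarrow> \<gamma> (\<delta> z) = z"
    "\<And>z. z \<in> C \<Longrightarrow> p (\<gamma> z) = p z"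
proof -
  have pim: "p \<in> C \<rightarrow> S" using covering_space_imp_surjective[OF cov(1)] by auto
  have pc: "continuous_on C p" using cov(2) by (rule holomorphic_on_imp_continuous_on)
  obtain \<gamma> where \<gamma>: "\<gamma> holomorphic_on C" "\<gamma> \<in> C \<rightarrow> C" "\<gamma> w = w'" "\<And>y. y \<in> C \<Longrightarrow> p (\<gamma> y) = p y"
    using obtain_holomorphic_lift[OF cov(1-4) cov(3,5) cov(2) pim w(1,2,3)] by blast
  obtain \<delta> where \<delta>: "\<delta> holomorphic_on C" "\<delta> \<in> C \<rightarrow> C" "\<delta> w' = w" "\<And>y. y \<in> C \<Longrightarrow> p (\<delta> y) = p y"
    using obtain_holomorphic_lift[OF cov(1-4) cov(3,5) cov(2) pim w(2,1) w(3)[symmetric]] by blast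
  note unique = covering_self_maps_inverse[OF cov(1,2) simply_connected_imp_connected[OF cov(5)]]
  show ?thesis
  proof (rule that[of \<gamma> \<delta>])
    show "\<delta> (\<gamma> z) = z" if "z \<in> C" for z
      by (rule unique[OF \<gamma>(1,2,4) \<delta>(1,2,4) _ w(1) that]) (use \<gamma> \<delta> in auto)
    show "\<gamma> (\<delta> z) = z" if "z \<in> C" for z
      by (rule unique[OF \<delta>(1,2,4) \<gamma>(1,2,4) _ w(2) that]) (use \<gamma> \<delta> in auto)
  qed (use \<gamma> \<delta> in auto)
qed

lemma descends_locally_Re_holomorphic:
  assumes cov: "covering_space C p S" "p holomorphic_on C" "open C" "open S"
    and F: "F holomorphic_on C" "\<And>w. w \<in> C \<Longrightarrow> v (p w) = Re (F w)"
  shows "v locally_Re_holomorphic_on S"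
  unfolding locally_Re_holomorphic_on_def
proof (intro allI impI)
  fix a r assume ar: "0 < r \<and> ball a r \<subseteq> S"
  then have "a \<in> S" by auto
  then obtain w where w: "w \<in> C" "p w = a" using covering_space_imp_surjective[OF cov(1)] by auto
  obtain g where g: "g holomorphic_on ball a r" "g \<in> ball a r \<rightarrow> C" "\<And>z. z \<in> ball a r \<Longrightarrow> p (g z) = z"
    by (rule obtain_section_over_ball[OF cov, of a r w]) (use w ar in auto)
  show "\<exists>f. f holomorphic_on ball a r \<and> (\<forall>z\<in>ball a r. v z = Re (f z))"
  proof (intro exI[of _ "F \<circ> g"] conjI ballI)
    show "F \<circ> g holomorphic_on ball a r"
      by (rule holomorphic_on_compose_gen[OF g(1) F(1)]) (use g in auto)
    show "v z = Re ((F \<circ> g) z)" if "z \<in> ball a r" for z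
      using g(3)[OF that] F(2)[of "g z"] g(2) that by (auto simp: Pi_iff)
  qed
qed

text \<open>Over a ball every point of a fibre extends to a holomorphic section, so one fixed family
  of sections runs through all fibres over that ball. The compositions of \<open>H\<close> with
  these sections form the required family.\<close>

lemma fibre_sup_Re_holomorphic_sup:
  assumes cov: "covering_space C p S" "p holomorphic_on C" "open C" "open S"
    and H: "H holomorphic_on C" and h: "\<And>w. w \<in> C \<Longrightarrow> h w = Re (H w)" "\<And>w. w \<in> C \<Longrightarrow> h w \<le> K"
    and v: "\<And>z. z \<in> S \<Longrightarrow> v z = (SUP w\<in>{w\<in>C. p w = z}. h w)"
  shows "Re_holomorphic_sup_on v S"
  unfolding Re_holomorphic_sup_on_def
proof (intro allI impI)
  fix a r assume ar: "0 < r \<and> ball a r \<subseteq> S"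
  define G where "G = {g. g holomorphic_on ball a r \<and> g \<in> ball a r \<rightarrow> C \<and> (\<forall>z\<in>ball a r. p (g z) = z)}"
  have fib: "(\<lambda>g. g z) ` G = {w\<in>C. p w = z}" if z: "z \<in> ball a r" for z
  proof (intro equalityI subsetI)
    show "w \<in> {w\<in>C. p w = z}" if "w \<in> (\<lambda>g. g z) ` G" for w using that z by (auto simp: G_def)
    fix w assume w: "w \<in> {w\<in>C. p w = z}"
    obtain g where "g holomorphic_on ball a r" "g \<in> ball a r \<rightarrow> C" "g (p w) = w" "\<And>z. z \<in> ball a r \<Longrightarrow> p (g z) = z"
      by (rule obtain_section_over_ball[OF cov, of a r w]) (use w z ar in auto)
    then have "g \<in> G" "g z = w" using w by (auto simp: G_def)
    then show "w \<in> (\<lambda>g. g z) ` G" by blast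
  qed
  define F where "F = (\<lambda>g. H \<circ> g) ` G"
  have im: "(\<lambda>f. Re (f z)) ` F = h ` {w\<in>C. p w = z}" if z: "z \<in> ball a r" for z
  proof -
    have "(\<lambda>f. Re (f z)) ` F = (\<lambda>w. Re (H w)) ` (\<lambda>g. g z) ` G" by (auto simp: F_def image_image)
    also have "\<dots> = h ` {w\<in>C. p w = z}" unfolding fib[OF z] using h(1) by (intro image_cong) auto
    finally show ?thesis .
  qed
  show "\<exists>F. F \<noteq> {} \<and> (\<forall>f\<in>F. f holomorphic_on ball a r) \<and>
        (\<forall>z\<in>ball a r. bdd_above ((\<lambda>f. Re (f z)) ` F) \<and> v z = (SUP f\<in>F. Re (f z)))"
  proof (intro exI[of _ F] conjI ballI)
    have a: "a \<in> ball a r" "a \<in> S" using ar by auto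
    then obtain w where "w \<in> C" "p w = a" using covering_space_imp_surjective[OF cov(1)] by auto
    then show "F \<noteq> {}" using fib[OF a(1)] by (auto simp: F_def)
    show "f holomorphic_on ball a r" if f: "f \<in> F" for f
    proof -
      obtain g where g: "g \<in> G" "f = H \<circ> g" using f by (auto simp: F_def)
      show ?thesis unfolding g(2)
        by (rule holomorphic_on_compose_gen[OF _ H]) (use g(1) in \<open>auto simp: G_def\<close>)
    qed
    fix z assume z: "z \<in> ball a r"
    show "bdd_above ((\<lambda>f. Re (f z)) ` F)" unfolding im[OF z] using h(2) by (auto intro!: bdd_aboveI[of _ K])
    show "v z = (SUP f\<in>F. Re (f z))" unfolding im[OF z] using v z ar by auto
  qed
qed

section \<open>Automorphisms of the half-plane and their action on Poisson kernels\<close>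

lemma cayley:
  assumes "Im w > 0"
  shows "norm ((w - \<i>) / (w + \<i>)) < 1" "w + \<i> \<noteq> 0"
proof -
  show "w + \<i> \<noteq> 0" using assms by (auto simp: complex_eq_iff)
  have "(norm (w - \<i>))\<^sup>2 < (norm (w + \<i>))\<^sup>2"
    unfolding cmod_power2 using assms by (simp add: power2_eq_square algebra_simps)
  then have "norm (w - \<i>) < norm (w + \<i>)" by (rule power_less_imp_less_base) simp
  then show "norm ((w - \<i>) / (w + \<i>)) < 1" by (simp add: norm_divide divide_less_eq)
qed

lemma cayley_inverse:
  assumes "norm \<zeta> < 1"
  shows "Im (\<i> * (1 + \<zeta>) / (1 - \<zeta>)) > 0" "1 - \<zeta> \<noteq> 0"
proof -
  show nz: "1 - \<zeta> \<noteq> 0" using assms by auto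
  have "(norm \<zeta>)\<^sup>2 < 1" using assms by (simp add: abs_square_less_1)
  then have "(Re \<zeta>)\<^sup>2 + (Im \<zeta>)\<^sup>2 < 1" by (simp add: cmod_power2)
  moreover have "(1 - Re \<zeta>)\<^sup>2 + (Im \<zeta>)\<^sup>2 > 0"
    using nz by (auto simp: complex_eq_iff sum_power2_gt_zero_iff)
  ultimately show "Im (\<i> * (1 + \<zeta>) / (1 - \<zeta>)) > 0"
    by (simp add: Im_divide power2_eq_square algebra_simps)
qed

text \<open>After conjugation by the Cayley map, the Schwarz lemma for the map and for its inverse
  shows that it is multiplication by a unimodular \<open>\<alpha>\<close>. A square root
  \<open>m\<close> of \<open>\<alpha>\<close> supplies the rotation matrix, with
  \<open>p = Re m\<close> and \<open>q = Im m\<close>.\<close>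

lemma half_plane_automorphism_fixing_i:
  assumes f: "f holomorphic_on upper_half_plane" "f \<in> upper_half_plane \<rightarrow> upper_half_plane"
    and g: "g holomorphic_on upper_half_plane" "g \<in> upper_half_plane \<rightarrow> upper_half_plane"
    and gf: "\<And>w. w \<in> upper_half_plane \<Longrightarrow> g (f w) = w" and fi: "f \<i> = \<i>"
  obtains p q :: real where "p\<^sup>2 + q\<^sup>2 = 1"
    "\<And>w. w \<in> upper_half_plane \<Longrightarrow> f w * (of_real p - of_real q * w) = of_real p * w + of_real q"
proof -
  define c where "c w = (w - \<i>) / (w + \<i>)" for w
  define c' where "c' \<zeta> = \<i> * (1 + \<zeta>) / (1 - \<zeta>)" for \<zeta>
  have c: "c w \<in> ball 0 1" "c' (c w) = w" if "w \<in> upper_half_plane" for w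
  proof -
    note * = cayley[of w]
    show "c w \<in> ball 0 1" using * that by (simp add: c_def upper_half_plane_def)
    have "1 + c w = 2 * w / (w + \<i>)" "1 - c w = 2 * \<i> / (w + \<i>)"
      using * that by (auto simp: c_def upper_half_plane_def field_simps)
    then show "c' (c w) = w" using * that by (simp add: c'_def upper_half_plane_def)
  qed
  have c': "c' \<zeta> \<in> upper_half_plane" "c (c' \<zeta>) = \<zeta>" if "\<zeta> \<in> ball 0 1" for \<zeta>
  proof -
    note * = cayley_inverse[of \<zeta>]
    show "c' \<zeta> \<in> upper_half_plane" using * that by (simp add: c'_def upper_half_plane_def)
    have "c' \<zeta> - \<i> = 2 * \<i> * \<zeta> / (1 - \<zeta>)" "c' \<zeta> + \<i> = 2 * \<i> / (1 - \<zeta>)"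
      using * that by (auto simp: c'_def field_simps)
    then show "c (c' \<zeta>) = \<zeta>" using * that by (simp add: c_def)
  qed
  have hol: "(c \<circ> k \<circ> c') holomorphic_on ball 0 1"
    if "k holomorphic_on upper_half_plane" "k \<in> upper_half_plane \<rightarrow> upper_half_plane" for k
  proof -
    have "c holomorphic_on upper_half_plane" unfolding c_def
      using cayley by (intro holomorphic_intros) (auto simp: upper_half_plane_def)
    moreover have "c' holomorphic_on ball 0 1" unfolding c'_def
      using cayley_inverse by (intro holomorphic_intros) auto
    moreover have "(k \<circ> c') holomorphic_on ball 0 1"
      by (rule holomorphic_on_compose_gen[OF calculation(2) that(1)]) (use c' in auto)
    ultimately have "c \<circ> (k \<circ> c') holomorphic_on ball 0 1"
      by (intro holomorphic_on_compose_gen[OF _ \<open>c holomorphic_on upper_half_plane\<close>]) (use c' that in \<open>auto simp: Pi_iff\<close>)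
    then show ?thesis by (simp add: o_assoc)
  qed
  have ic: "\<i> \<in> upper_half_plane" "c' 0 = \<i>" "c \<i> = 0" by (auto simp: upper_half_plane_def c_def c'_def)
  have gi: "g \<i> = \<i>" using gf[OF ic(1)] fi by simp
  define F where "F = c \<circ> f \<circ> c'"
  define G where "G = c \<circ> g \<circ> c'"
  have FG: "norm (F \<zeta>) < 1" "norm (G \<zeta>) < 1" if "norm \<zeta> < 1" for \<zeta>
    using c(1)[of "f (c' \<zeta>)"] c(1)[of "g (c' \<zeta>)"] c'(1)[of \<zeta>] f(2) g(2) that by (auto simp: F_def G_def Pi_iff)
  have F: "norm (F \<zeta>) \<le> norm \<zeta>" if "norm \<zeta> < 1" for \<zeta>
    by (rule Schwarz_Lemma(1)) (use hol[OF f] FG fi ic that in \<open>auto simp: F_def o_def\<close>)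
  have G: "norm (G \<zeta>) \<le> norm \<zeta>" if "norm \<zeta> < 1" for \<zeta>
    by (rule Schwarz_Lemma(1)) (use hol[OF g] FG gi ic that in \<open>auto simp: G_def o_def\<close>)
  have GF: "G (F \<zeta>) = \<zeta>" if "norm \<zeta> < 1" for \<zeta>
    using that c'[of \<zeta>] c(2)[of "f (c' \<zeta>)"] f(2) gf[of "c' \<zeta>"] by (auto simp: F_def G_def Pi_iff)
  have eq: "norm (F \<zeta>) = norm \<zeta>" if "norm \<zeta> < 1" for \<zeta>
    using F[OF that] G[OF FG(1)[OF that]] GF[OF that] by simp
  have "\<exists>\<alpha>. (\<forall>z. norm z < 1 \<longrightarrow> F z = \<alpha> * z) \<and> norm \<alpha> = 1"
  proof (rule Schwarz_Lemma(3)[of F 0])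
    show "(\<exists>z. norm z < 1 \<and> z \<noteq> 0 \<and> norm (F z) = norm z) \<or> norm (deriv F 0) = 1"
      using eq[of "1/2"] by (intro disjI1 exI[of _ "1/2"]) auto
  qed (use hol[OF f] FG fi ic in \<open>auto simp: F_def o_def\<close>)
  then obtain \<alpha> where \<alpha>: "\<And>z. norm z < 1 \<Longrightarrow> F z = \<alpha> * z" "norm \<alpha> = 1" by blast
  define m where "m = csqrt \<alpha>"
  have m: "m\<^sup>2 = \<alpha>" "norm m = 1"
    using \<alpha>(2) by (auto simp: m_def) 
  have mm: "m * cnj m = 1" using m(2) complex_norm_square[of m] by simp
  show ?thesis
  proof (rule that[of "Re m" "Im m"])
    show "(Re m)\<^sup>2 + (Im m)\<^sup>2 = 1" using m(2) by (metis cmod_power2 one_power2)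
    fix w assume w: "w \<in> upper_half_plane"
    have fw: "f w \<in> upper_half_plane" using f w by auto
    have "c (f w) = \<alpha> * c w" using \<alpha>(1)[of "c w"] c[OF w] by (simp add: F_def)
    then have "(f w - \<i>) * (w + \<i>) = \<alpha> * (w - \<i>) * (f w + \<i>)"
      using cayley(2)[of w] cayley(2)[of "f w"] w fw by (simp add: c_def upper_half_plane_def field_simps)
    \<comment> \<open>Multiplication by \<open>cnj m\<close> distributes
      \<open>\<alpha> = m\<^sup>2\<close> evenly over the two sides, which is what produces real
      coefficients.\<close>
    then have "cnj m * ((f w - \<i>) * (w + \<i>)) = cnj m * (m * m) * (w - \<i>) * (f w + \<i>)"
      using m(1) by (simp add: power2_eq_square mult_ac)
    also have "cnj m * (m * m) = m" using mm by (metis mult.assoc mult.commute mult_1)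
    finally have "cnj m * ((f w - \<i>) * (w + \<i>)) = m * (w - \<i>) * (f w + \<i>)" .
    moreover have "m = of_real (Re m) + \<i> * of_real (Im m)" "cnj m = of_real (Re m) - \<i> * of_real (Im m)"
      by (auto simp: complex_eq_iff)
    ultimately have e: "(of_real (Re m) - \<i> * of_real (Im m)) * ((f w - \<i>) * (w + \<i>)) = 
       (of_real (Re m) + \<i> * of_real (Im m)) * (w - \<i>) * (f w + \<i>)" by simp
    have "2 * \<i> * (f w * (of_real (Re m) - of_real (Im m) * w) - (of_real (Re m) * w + of_real (Im m)))
       = (of_real (Re m) - \<i> * of_real (Im m)) * ((f w - \<i>) * (w + \<i>)) - (of_real (Re m) + \<i> * of_real (Im m)) * (w - \<i>) * (f w + \<i>)"
      by (simp add: algebra_simps)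
    with e show "f w * (of_real (Re m) - of_real (Im m) * w) = of_real (Re m) * w + of_real (Im m)" by simp
  qed
qed

text \<open>Automorphisms mix infinity with the real points, so the kernel \<open>Im w\<close> at
  infinity is put on a par with the others, under the index \<open>None\<close>.\<close>

fun kern :: "real option \<Rightarrow> complex \<Rightarrow> real" where
  "kern None w = Im w"
| "kern (Some t) w = Im w / ((Re w - t)\<^sup>2 + (Im w)\<^sup>2)"

lemma kern_eq_norm: "kern (Some t) w = Im w / (norm (w - of_real t))\<^sup>2"
  by (simp add: cmod_power2)

text \<open>A real affine map takes \<open>f \<i>\<close> back to \<open>\<i>\<close> and reduces
  this to the previous case. The determinant becomes \<open>Im (f \<i>)\<close>.\<close>

lemma half_plane_automorphism:
  assumes f: "f holomorphic_on upper_half_plane" "f \<in> upper_half_plane \<rightarrow> upper_half_plane"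
    and g: "g holomorphic_on upper_half_plane" "g \<in> upper_half_plane \<rightarrow> upper_half_plane"
    and gf: "\<And>w. w \<in> upper_half_plane \<Longrightarrow> g (f w) = w"
  shows "\<exists>a b c d :: real. a * d - b * c > 0 \<and>
    (\<forall>w\<in>upper_half_plane. f w * (of_real c * w + of_real d) = of_real a * w + of_real b)"
proof -
  have ii: "\<i> \<in> upper_half_plane" by (simp add: upper_half_plane_def)
  define x y where "x = Re (f \<i>)" and "y = Im (f \<i>)"
  have y: "y > 0" using f(2) ii by (auto simp: y_def upper_half_plane_def)
  define F where "F w = (f w - of_real x) / of_real y" for w
  define G where "G w = g (of_real y * w + of_real x)" for w
  have Gim: "of_real y * w + of_real x \<in> upper_half_plane" if "w \<in> upper_half_plane" for w
    using that y by (simp add: upper_half_plane_def)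
  obtain p q where pq: "p\<^sup>2 + q\<^sup>2 = 1"
    "\<And>w. w \<in> upper_half_plane \<Longrightarrow> F w * (of_real p - of_real q * w) = of_real p * w + of_real q"
  proof (rule half_plane_automorphism_fixing_i[of F G])
    show "F holomorphic_on upper_half_plane" unfolding F_def using y by (intro holomorphic_intros f) auto
    show "F \<in> upper_half_plane \<rightarrow> upper_half_plane"
      using f(2) y by (auto simp: F_def upper_half_plane_def Pi_iff)
    have "g \<circ> (\<lambda>w. of_real y * w + of_real x) holomorphic_on upper_half_plane"
      by (rule holomorphic_on_compose_gen[OF _ g(1)]) (use Gim in \<open>auto intro!: holomorphic_intros\<close>)
    then show "G holomorphic_on upper_half_plane" by (simp add: G_def[abs_def] o_def)
    show "G \<in> upper_half_plane \<rightarrow> upper_half_plane" using Gim g(2) by (auto simp: G_def Pi_iff)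
    show "G (F w) = w" if "w \<in> upper_half_plane" for w using gf[OF that] y by (simp add: G_def F_def)
    show "F \<i> = \<i>" using y by (simp add: F_def x_def y_def complex_eq_iff)
  qed blast
  show ?thesis
  proof (rule exI[of _ "y * p - x * q"], rule exI[of _ "y * q + x * p"], rule exI[of _ "- q"], rule exI[of _ p],
      intro conjI ballI)
    have "(y * p - x * q) * p - (y * q + x * p) * (- q) = y * (p\<^sup>2 + q\<^sup>2)" by (simp add: power2_eq_square algebra_simps)
    then show "(y * p - x * q) * p - (y * q + x * p) * (- q) > 0" using pq(1) y by simp
    fix w assume w: "w \<in> upper_half_plane"
    have "f w = of_real y * F w + of_real x" using y by (simp add: F_def)
    then have "f w * (of_real (- q) * w + of_real p) = of_real y * (F w * (of_real p - of_real q * w)) + of_real x * (of_real p - of_real q * w)"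
      by (simp add: algebra_simps)
    also have "\<dots> = of_real (y * p - x * q) * w + of_real (y * q + x * p)"
      unfolding pq(2)[OF w] by (simp add: algebra_simps)
    finally show "f w * (of_real (- q) * w + of_real p) = of_real (y * p - x * q) * w + of_real (y * q + x * p)" .
  qed
qed

text \<open>With \<open>D = a * d - b * c\<close>, the factor
  \<open>\<bar>c * w + d\<bar>\<^sup>2\<close> divides both \<open>Im (f w)\<close> and
  \<open>\<bar>f w - t\<bar>\<^sup>2\<close> and cancels in the kernel at \<open>t\<close>. In every
  case \<open>D * Im w\<close> over the squared modulus of a real linear function of
  \<open>w\<close> remains: a multiple of the kernel at its zero, or at infinity if it is
  constant.\<close>

lemma kern_automorphism:
  assumes f: "f holomorphic_on upper_half_plane" "f \<in> upper_half_plane \<rightarrow> upper_half_plane"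
    and g: "g holomorphic_on upper_half_plane" "g \<in> upper_half_plane \<rightarrow> upper_half_plane"
    and gf: "\<And>w. w \<in> upper_half_plane \<Longrightarrow> g (f w) = w"
  shows "\<exists>y k. k > 0 \<and> (\<forall>w\<in>upper_half_plane. kern x (f w) = k * kern y w)"
proof -
  obtain a b c d :: real where D: "a * d - b * c > 0" and
    fw': "\<forall>w\<in>upper_half_plane. f w * (of_real c * w + of_real d) = of_real a * w + of_real b"
    using half_plane_automorphism[OF f g] gf by blast
  note fw = fw'[rule_format]
  define D where "D = a * d - b * c"
  have nz: "of_real c * w + of_real d \<noteq> (0::complex)" if "w \<in> upper_half_plane" for w
  proof
    assume "of_real c * w + of_real d = (0::complex)"
    then have "c = 0" "d = 0" using that by (auto simp: complex_eq_iff upper_half_plane_def)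
    then show False using D by simp
  qed
  have im: "Im (f w) = D * Im w / (norm (of_real c * w + of_real d))\<^sup>2" if w: "w \<in> upper_half_plane" for w
  proof -
    have "f w = (of_real a * w + of_real b) / (of_real c * w + of_real d)"
      using fw[OF w] nz[OF w] by (simp add: field_simps)
    then show ?thesis unfolding cmod_power2 by (simp add: Im_divide D_def algebra_simps)
  qed
  show ?thesis
  proof (cases x)
    case None
    have e: "kern x (f w) = D * Im w / (norm (of_real c * w + of_real d))\<^sup>2" if "w \<in> upper_half_plane" for w
      using im[OF that] None by simp
    show ?thesis
    proof (cases "c = 0")
      case True
      then have "d \<noteq> 0" using D by auto
      then show ?thesis using e True D 
        by (intro exI[of _ None] exI[of _ "D / d\<^sup>2"]) (auto simp: D_def)
    next
      case False
      have "norm (of_real c * w + of_real d) = \<bar>c\<bar> * norm (w - of_real (- d / c))" for w :: complex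
      proof -
        have "of_real c * w + of_real d = of_real c * (w - of_real (- d / c))" using False by (simp add: field_simps)
        then show ?thesis by (simp only: norm_mult norm_of_real)
      qed
      then have "kern x (f w) = (D / c\<^sup>2) * kern (Some (- d / c)) w" if "w \<in> upper_half_plane" for w
        using e[OF that] unfolding kern_eq_norm by (simp add: power_mult_distrib)
      then show ?thesis using False D by (intro exI[of _ "Some (- d / c)"] exI[of _ "D / c\<^sup>2"]) (auto simp: D_def)
    qed
  next
    case (Some t)
    have e: "kern x (f w) = D * Im w / (norm (of_real (a - t * c) * w - of_real (t * d - b)))\<^sup>2" if w: "w \<in> upper_half_plane" for w
    proof -
      have "(f w - of_real t) * (of_real c * w + of_real d) = of_real (a - t * c) * w - of_real (t * d - b)"
        using fw[OF w] by (simp add: algebra_simps)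
      then have "norm (of_real (a - t * c) * w - of_real (t * d - b)) = norm (f w - of_real t) * norm (of_real c * w + of_real d)"
        by (metis norm_mult)
      then show ?thesis unfolding Some kern_eq_norm im[OF w] using nz[OF w]
        by (simp add: power_mult_distrib mult.commute)
    qed
    show ?thesis
    proof (cases "a - t * c = 0")
      case True
      have "t * d - b \<noteq> 0"
      proof
        assume "t * d - b = 0"
        then have "a = t * c" "b = t * d" using True by auto
        then show False using D by simp
      qed
      moreover have "norm (of_real (a - t * c) * w - of_real (t * d - b)) = \<bar>t * d - b\<bar>" for w :: complex
        unfolding True by (simp only: of_real_0 mult_zero_left diff_0 norm_minus_cancel norm_of_real)
      then have "kern x (f w) = (D / (t * d - b)\<^sup>2) * kern None w" if "w \<in> upper_half_plane" for w
        using e[OF that] by simp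
      ultimately show ?thesis using D
        by (intro exI[of _ None] exI[of _ "D / (t * d - b)\<^sup>2"]) (auto simp: D_def)
    next
      case False
      define A B where "A = a - t * c" and "B = t * d - b"
      have A: "A \<noteq> 0" using False by (simp add: A_def)
      have "norm (of_real A * w - of_real B) = \<bar>A\<bar> * norm (w - of_real (B / A))" for w :: complex
      proof -
        have "of_real A * w - of_real B = of_real A * (w - of_real (B / A))" using A by (simp add: field_simps)
        then show ?thesis by (simp only: norm_mult norm_of_real)
      qed
      then have "kern x (f w) = (D / A\<^sup>2) * kern (Some (B / A)) w" if "w \<in> upper_half_plane" for w
        using e[OF that] unfolding kern_eq_norm A_def[symmetric] B_def[symmetric] by (simp add: power_mult_distrib)
      then show ?thesis using A D by (intro exI[of _ "Some (B / A)"] exI[of _ "D / A\<^sup>2"]) (auto simp: D_def)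
    qed
  qed
qed

text \<open>Kernels of different boundary points depend differently on the height. Heights 1 and 2
  over one well-chosen abscissa already separate them. This gives injectivity of the action on
  boundary points.\<close>

lemma kern_proportional_imp_eq:
  assumes "\<And>w. w \<in> upper_half_plane \<Longrightarrow> kern x w = k * kern y w"
  shows "x = y"
proof -
  have *: "kern x (Complex s n) = k * kern y (Complex s n)" if "n > 0" for s n
    using assms[of "Complex s n"] that by (simp add: upper_half_plane_def)
  show ?thesis
  proof (cases x; cases y)
    fix t assume "x = None" "y = Some t"
    then show ?thesis using *[of 1 0] *[of 2 0] 
      by (auto simp: field_simps add_nonneg_eq_0_iff)
  next
    fix t assume xy: "x = Some t" "y = None"
    have nn: "t\<^sup>2 + 1 > 0" "t\<^sup>2 + 4 > 0" by (auto intro: add_nonneg_pos)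
    have 1: "1 = k * t\<^sup>2 + k" using *[of 1 0] xy nn by (simp add: divide_eq_eq distrib_left)
    have "1 = k * t\<^sup>2 + 4 * k" using *[of 2 0] xy nn by (simp add: divide_eq_eq distrib_left)
    with 1 have "k = 0" by simp
    then show ?thesis using 1 by simp
  next
    fix t t' assume xy: "x = Some t" "y = Some t'"
    have nn: "(t - t')\<^sup>2 + 1 > 0" "(t - t')\<^sup>2 + 4 > 0" by (auto intro: add_nonneg_pos)
    have "(t - t')\<^sup>2 + 1 = k" using *[of 1 t] xy nn by (simp add: divide_eq_eq eq_divide_eq)
    moreover have "(t - t')\<^sup>2 + 4 = 4 * k" using *[of 2 t] xy nn by (simp add: divide_eq_eq eq_divide_eq)
    ultimately have "(t - t')\<^sup>2 = 0" by linarith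
    then show ?thesis using xy by simp
  qed auto
qed

section \<open>Poisson integrals\<close>

lemma kern_nonneg: "w \<in> upper_half_plane \<Longrightarrow> 0 \<le> kern x w"
  by (cases x) (auto simp: upper_half_plane_def)

lemma measurable_kern[measurable]: "(\<lambda>t. kern (Some t) w) \<in> borel_measurable borel"
  by simp

declare kern.simps [simp del]

locale poisson_integrable =
  fixes \<mu> :: "real measure"
  assumes sets_mu[measurable_cong]: "sets \<mu> = sets borel"
    and integrable_kern: "\<And>w. w \<in> upper_half_plane \<Longrightarrow> integrable \<mu> (\<lambda>t. kern (Some t) w)"
begin

definition poisson_integral :: "real set \<Rightarrow> complex \<Rightarrow> real" where
  "poisson_integral Y w = (\<integral>t. indicator Y t * kern (Some t) w \<partial>\<mu>)"

lemma integrable_indicator_kern: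
  assumes "Y \<in> sets borel" "w \<in> upper_half_plane"
  shows "integrable \<mu> (\<lambda>t. indicator Y t * kern (Some t) w)"
  by (rule Bochner_Integration.integrable_bound[OF integrable_kern[OF assms(2)]])
    (use assms in \<open>auto simp: indicator_def\<close>)

lemma poisson_integral_mono:
  assumes "Y \<in> sets borel" "Y' \<in> sets borel" "Y \<subseteq> Y'" "w \<in> upper_half_plane"
  shows "poisson_integral Y w \<le> poisson_integral Y' w"
  unfolding poisson_integral_def
proof (rule integral_mono)
  show "indicator Y t * kern (Some t) w \<le> indicator Y' t * kern (Some t) w" for t
    using assms(3) kern_nonneg[OF assms(4), of "Some t"] by (intro mult_right_mono) (auto simp: indicator_def)
qed (use assms integrable_indicator_kern in auto)

lemma poisson_integral_nonneg:
  assumes "w \<in> upper_half_plane"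
  shows "0 \<le> poisson_integral Y w"
  unfolding poisson_integral_def
  by (rule integral_nonneg_AE) (use kern_nonneg[OF assms] in auto)

text \<open>The integrand \<open>k\<close> is the Herglotz kernel: \<open>\<i> / (w - t)\<close> has
  the Poisson kernel as real part, and the imaginary term \<open>t / (1 + t\<^sup>2) * \<i>\<close>
  improves the decay from \<open>1 / t\<close> to \<open>1 / t\<^sup>2\<close> without changing that
  real part.\<close>

lemma holomorphic_poisson_integral:
  assumes Y: "Y \<in> sets borel"
  obtains F where "F holomorphic_on upper_half_plane"
    "\<And>w. w \<in> upper_half_plane \<Longrightarrow> poisson_integral Y w = Re (F w)"
proof -
  note [measurable] = Y
  define k where "k w t = of_real (indicator Y t) * (\<i> / (w - of_real t) + of_real (t / (1 + t\<^sup>2)) * \<i>)" for w :: complex and t :: real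
  define k' where "k' w t = of_real (indicator Y t) * (- \<i> / (w - of_real t)\<^sup>2)" for w :: complex and t :: real
  have nz: "w - of_real t \<noteq> 0" if "w \<in> upper_half_plane" for w t
    using that by (auto simp: upper_half_plane_def complex_eq_iff)
  have sq: "1 + t\<^sup>2 > 0" for t :: real by (auto intro: add_pos_nonneg)
  have nsq: "1 / (norm (w - of_real t))\<^sup>2 = kern (Some t) w / Im w" if "w \<in> upper_half_plane" for w t
    using that unfolding kern_eq_norm by (simp add: upper_half_plane_def)
  have mk[measurable]: "k w \<in> borel_measurable \<mu>" "k' w \<in> borel_measurable \<mu>" for w
    unfolding k_def[abs_def] k'_def[abs_def] by measurable
  have ik': "integrable \<mu> (k' w)" if w: "w \<in> upper_half_plane" for w
  proof (rule Bochner_Integration.integrable_bound)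
    show "integrable \<mu> (\<lambda>t. kern (Some t) w / Im w)" using integrable_kern[OF w] by simp
    show "AE t in \<mu>. norm (k' w t) \<le> norm (kern (Some t) w / Im w)"
      unfolding nsq[OF w, symmetric] by (auto simp: k'_def norm_mult norm_divide norm_power indicator_def)
  qed simp
  have ii: "\<i> \<in> upper_half_plane" by (simp add: upper_half_plane_def)
  have ik: "integrable \<mu> (k w)" if w: "w \<in> upper_half_plane" for w
  proof (rule Bochner_Integration.integrable_bound)
    show "integrable \<mu> (\<lambda>t. norm (w - \<i>) * (kern (Some t) w / Im w + kern (Some t) \<i>) + kern (Some t) \<i>)"
      using integrable_kern[OF w] integrable_kern[OF ii] by simp
    show "AE t in \<mu>. norm (k w t) \<le> norm (norm (w - \<i>) * (kern (Some t) w / Im w + kern (Some t) \<i>) + kern (Some t) \<i>)"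
    proof (rule AE_I2)
      fix t
      have "of_real (1 + t\<^sup>2) = (\<i> - of_real t) * (- \<i> - of_real t)"
        by (simp add: algebra_simps power2_eq_square)
      \<comment> \<open>At \<open>w = \<i>\<close> the Herglotz kernel is the Poisson kernel itself.
        The difference to a general \<open>w\<close> contains a product of two Cauchy factors, which
        \<open>a * b \<le> a\<^sup>2 + b\<^sup>2\<close> splits into Poisson kernels.\<close>
      then have e: "\<i> / (\<i> - of_real t) + of_real (t / (1 + t\<^sup>2)) * \<i> = of_real (1 / (1 + t\<^sup>2))"
        using nz[OF ii, of t] sq[of t]
        by (simp add: complex_eq_iff Re_divide Im_divide power2_eq_square)
      have "\<i> / (w - of_real t) - \<i> / (\<i> - of_real t) = \<i> * (\<i> - w) / ((w - of_real t) * (\<i> - of_real t))"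
        using nz[OF w, of t] nz[OF ii, of t] by (simp add: field_simps)
      then have "\<i> / (w - of_real t) + of_real (t / (1 + t\<^sup>2)) * \<i> =
          \<i> * (\<i> - w) / ((w - of_real t) * (\<i> - of_real t)) + of_real (1 / (1 + t\<^sup>2))"
        using e by (simp add: algebra_simps)
      then have "norm (\<i> / (w - of_real t) + of_real (t / (1 + t\<^sup>2)) * \<i>) \<le>
          norm (\<i> * (\<i> - w) / ((w - of_real t) * (\<i> - of_real t))) + norm (of_real (1 / (1 + t\<^sup>2)) :: complex)"
        by (metis norm_triangle_ineq)
      also have "\<dots> = norm (w - \<i>) * (1 / norm (w - of_real t) * (1 / norm (\<i> - of_real t))) + 1 / (1 + t\<^sup>2)"
        using sq[of t] by (simp add: norm_mult norm_divide norm_minus_commute del: of_real_add of_real_divide of_real_power)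
      also have "1 / norm (w - of_real t) * (1 / norm (\<i> - of_real t)) \<le> (1 / norm (w - of_real t))\<^sup>2 + (1 / norm (\<i> - of_real t))\<^sup>2"
      proof -
        have "2 * a * b \<le> a\<^sup>2 + b\<^sup>2" "0 \<le> a\<^sup>2 + b\<^sup>2" for a b :: real
          using sum_squares_bound[of a b] by auto
        from this(1)[of "1 / norm (w - of_real t)" "1 / norm (\<i> - of_real t)"] this(2)[of "1 / norm (w - of_real t)" "1 / norm (\<i> - of_real t)"]
        show ?thesis by linarith
      qed
      also have "\<dots> = kern (Some t) w / Im w + kern (Some t) \<i>"
        using nsq[OF w, of t] nsq[OF ii, of t] by (simp add: power_divide)
      also have "1 / (1 + t\<^sup>2) = kern (Some t) \<i>" by (simp add: add.commute kern.simps)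
      finally have "norm (\<i> / (w - of_real t) + of_real (t / (1 + t\<^sup>2)) * \<i>) \<le> 
         norm (w - \<i>) * (kern (Some t) w / Im w + kern (Some t) \<i>) + kern (Some t) \<i>"
        by (simp add: mult_left_mono)
      moreover have "norm (k w t) \<le> norm (\<i> / (w - of_real t) + of_real (t / (1 + t\<^sup>2)) * \<i>)"
        by (simp add: k_def norm_mult indicator_def)
      ultimately show "norm (k w t) \<le> norm (norm (w - \<i>) * (kern (Some t) w / Im w + kern (Some t) \<i>) + kern (Some t) \<i>)"
        by (metis abs_ge_self order_trans real_norm_def)
    qed
  qed simp
  define F where "F w = (\<integral>t. k w t \<partial>\<mu>)" for w
  have der: "(F has_field_derivative (\<integral>t. k' w t \<partial>\<mu>)) (at w)" if w: "w \<in> upper_half_plane" for w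
  proof -
    define \<eta> where "\<eta> = Im w"
    have \<eta>: "\<eta> > 0" using w by (simp add: \<eta>_def upper_half_plane_def)
    define C where "C = (\<integral>t. kern (Some t) w / \<eta> * (2 / \<eta>) \<partial>\<mu>)"
    \<comment> \<open>The second-order remainder of the integrand is at most
      \<open>(norm (w' - w))\<^sup>2 * 2 / \<eta>\<^sup>2\<close> times the kernel at
      \<open>w\<close>: a displacement below half the height keeps \<open>w'\<close> at distance at
      least \<open>\<eta> / 2\<close> from the real line.\<close>
    have bd: "norm (F w' - F w - (w' - w) * (\<integral>t. k' w t \<partial>\<mu>)) \<le> (norm (w' - w))\<^sup>2 * C"
      if d: "norm (w' - w) < \<eta> / 2" for w'
    proof -
      have "\<bar>Im (w' - w)\<bar> < \<eta> / 2" using d abs_Im_le_cmod[of "w' - w"] by linarith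
      then have im: "Im w' > \<eta> / 2" using abs_ge_minus_self[of "Im (w' - w)"] by (simp add: \<eta>_def)
      then have w': "w' \<in> upper_half_plane" using \<eta> by (simp add: upper_half_plane_def)
      have pt: "k w' t - k w t - (w' - w) * k' w t = of_real (indicator Y t) * (\<i> * (w' - w)\<^sup>2 / ((w' - of_real t) * (w - of_real t)\<^sup>2))" for t
      proof -
        have "\<i> / A - \<i> / B - (A - B) * (- \<i> / B\<^sup>2) = \<i> * (A - B)\<^sup>2 / (A * B\<^sup>2)" if "A \<noteq> 0" "B \<noteq> 0" for A B :: complex
          using that by (simp add: divide_simps power2_eq_square) (simp add: algebra_simps)
        from this[OF nz[OF w', of t] nz[OF w, of t]]
        have "\<i> / (w' - of_real t) - \<i> / (w - of_real t) - (w' - w) * (- \<i> / (w - of_real t)\<^sup>2) = \<i> * (w' - w)\<^sup>2 / ((w' - of_real t) * (w - of_real t)\<^sup>2)" by simp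
        then show ?thesis unfolding k_def k'_def by (cases "t \<in> Y") (auto simp: algebra_simps)
      qed
      have "F w' - F w - (w' - w) * (\<integral>t. k' w t \<partial>\<mu>) = (\<integral>t. k w' t - k w t - (w' - w) * k' w t \<partial>\<mu>)"
        unfolding F_def using ik[OF w] ik[OF w'] ik'[OF w] by simp
      also have "norm \<dots> \<le> (\<integral>t. (norm (w' - w))\<^sup>2 * (kern (Some t) w / \<eta> * (2 / \<eta>)) \<partial>\<mu>)"
      proof (rule Bochner_Integration.integral_norm_bound_integral)
        show "integrable \<mu> (\<lambda>t. k w' t - k w t - (w' - w) * k' w t)" using ik[OF w] ik[OF w'] ik'[OF w] by simp
        show "integrable \<mu> (\<lambda>t. (norm (w' - w))\<^sup>2 * (kern (Some t) w / \<eta> * (2 / \<eta>)))" using integrable_kern[OF w] by simp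
        fix t
        have "\<eta> / 2 \<le> norm (w' - of_real t)" using im abs_Im_le_cmod[of "w' - of_real t"] by simp
        then have "inverse (norm (w' - of_real t)) \<le> inverse (\<eta> / 2)" using \<eta> by (intro le_imp_inverse_le) auto
        then have "1 / norm (w' - of_real t) \<le> 2 / \<eta>" by (simp add: inverse_eq_divide)
        then have "1 / (norm (w - of_real t))\<^sup>2 * (1 / norm (w' - of_real t)) \<le> 1 / (norm (w - of_real t))\<^sup>2 * (2 / \<eta>)"
          by (intro mult_left_mono) auto
        also have "1 / (norm (w - of_real t))\<^sup>2 = kern (Some t) w / \<eta>" unfolding nsq[OF w] \<eta>_def ..
        finally have 1: "kern (Some t) w / \<eta> * (1 / norm (w' - of_real t)) \<le> kern (Some t) w / \<eta> * (2 / \<eta>)" .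
        have "norm (k w' t - k w t - (w' - w) * k' w t) \<le> norm (\<i> * (w' - w)\<^sup>2 / ((w' - of_real t) * (w - of_real t)\<^sup>2))"
          unfolding pt by (simp add: norm_mult indicator_def)
        also have "\<dots> = (norm (w' - w))\<^sup>2 * (1 / (norm (w - of_real t))\<^sup>2 * (1 / norm (w' - of_real t)))"
          by (simp add: norm_mult norm_divide norm_power)
        also have "\<dots> = (norm (w' - w))\<^sup>2 * (kern (Some t) w / \<eta> * (1 / norm (w' - of_real t)))"
          unfolding nsq[OF w] \<eta>_def ..
        also have "\<dots> \<le> (norm (w' - w))\<^sup>2 * (kern (Some t) w / \<eta> * (2 / \<eta>))"
          using 1 by (rule mult_left_mono) simp
        finally show "norm (k w' t - k w t - (w' - w) * k' w t) \<le> (norm (w' - w))\<^sup>2 * (kern (Some t) w / \<eta> * (2 / \<eta>))" .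
      qed
      also have "\<dots> = (norm (w' - w))\<^sup>2 * C" unfolding C_def by (rule integral_mult_right_zero)
      finally show ?thesis .
    qed
    have C: "0 \<le> C" unfolding C_def using kern_nonneg[OF w] \<eta> by (intro integral_nonneg_AE) auto
    have "((\<lambda>w'. (F w' - F w) / (w' - w) - (\<integral>t. k' w t \<partial>\<mu>)) \<longlongrightarrow> 0) (at w)"
    proof (rule Lim_null_comparison)
      show "((\<lambda>w'. norm (w' - w) * C) \<longlongrightarrow> 0) (at w)"
        by (auto intro!: tendsto_eq_intros)
      show "\<forall>\<^sub>F w' in at w. norm ((F w' - F w) / (w' - w) - (\<integral>t. k' w t \<partial>\<mu>)) \<le> norm (w' - w) * C"
        unfolding eventually_at
      proof (intro exI[of _ "\<eta> / 2"] conjI ballI impI)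
        show "\<eta> / 2 > 0" using \<eta> by simp
        fix w' assume "w' \<noteq> w \<and> dist w' w < \<eta> / 2"
        then have ne: "norm (w' - w) > 0" and d: "norm (w' - w) < \<eta> / 2" by (auto simp: dist_norm)
        have "(F w' - F w) / (w' - w) - (\<integral>t. k' w t \<partial>\<mu>) = (F w' - F w - (w' - w) * (\<integral>t. k' w t \<partial>\<mu>)) / (w' - w)"
          using ne by (simp add: diff_divide_distrib)
        then have "norm ((F w' - F w) / (w' - w) - (\<integral>t. k' w t \<partial>\<mu>)) = norm (F w' - F w - (w' - w) * (\<integral>t. k' w t \<partial>\<mu>)) / norm (w' - w)"
          by (simp only: norm_divide)
        also have "\<dots> \<le> ((norm (w' - w))\<^sup>2 * C) / norm (w' - w)"
          using bd[OF d] by (rule divide_right_mono) simp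
        also have "\<dots> = norm (w' - w) * C" using ne by (simp add: power2_eq_square)
        finally show "norm ((F w' - F w) / (w' - w) - (\<integral>t. k' w t \<partial>\<mu>)) \<le> norm (w' - w) * C" .
      qed
    qed
    then show ?thesis
      unfolding has_field_derivative_iff by (rule LIM_zero_cancel)
  qed
  show ?thesis
  proof (rule that[of F])
    show "F holomorphic_on upper_half_plane"
      using der by (auto simp: holomorphic_on_open[OF open_upper_half_plane])
    fix w assume w: "w \<in> upper_half_plane"
    have "Re (F w) = (\<integral>t. Re (k w t) \<partial>\<mu>)" unfolding F_def by (rule integral_Re[OF ik[OF w], symmetric])
    also have "\<dots> = poisson_integral Y w" unfolding poisson_integral_def
      by (rule Bochner_Integration.integral_cong)
        (auto simp: k_def indicator_def Re_divide Im_divide power2_eq_square kern.simps)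
    finally show "poisson_integral Y w = Re (F w)" by simp
  qed
qed

text \<open>\<open>measure\<close> sends infinite mass to 0 and could overlook an atom. The kernel
  of \<open>t + \<i>\<close> equals 1 at \<open>t\<close>, and its integrability excludes
  this.\<close>

lemma emeasure_singleton_finite: "emeasure \<mu> {t} < \<infinity>"
proof -
  have w: "Complex t 1 \<in> upper_half_plane" by (simp add: upper_half_plane_def)
  have "integrable \<mu> (\<lambda>s. indicator {t} s * kern (Some s) (Complex t 1))"
    by (rule integrable_indicator_kern[OF _ w]) simp
  also have "(\<lambda>s. indicator {t} s * kern (Some s) (Complex t 1)) = (\<lambda>s. indicator {t} s :: real)"
    by (auto simp: indicator_def fun_eq_iff kern.simps)
  finally show ?thesis by (simp add: integrable_indicator_iff)
qed

lemma poisson_integral_finite: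
  assumes "finite X" "w \<in> upper_half_plane"
  shows "poisson_integral X w = (\<Sum>t\<in>X. measure \<mu> {t} * kern (Some t) w)"
proof -
  have 1: "indicator X t * kern (Some t) w = (\<Sum>s\<in>X. indicator {s} t * kern (Some t) w)" for t
  proof -
    have "indicator X t = (\<Sum>s\<in>X. indicator {s} t :: real)"
      using assms(1) by (simp add: indicator_def if_distrib cong: if_cong)
    then show ?thesis by (simp add: sum_distrib_right)
  qed
  have "poisson_integral X w = (\<Sum>s\<in>X. \<integral>t. indicator {s} t * kern (Some t) w \<partial>\<mu>)"
    unfolding poisson_integral_def 1
    by (rule Bochner_Integration.integral_sum) (rule integrable_indicator_kern[OF _ assms(2)], simp)
  also have "\<dots> = (\<Sum>s\<in>X. measure \<mu> {s} * kern (Some s) w)"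
  proof (rule sum.cong[OF refl])
    fix s
    have "(\<integral>t. indicator {s} t * kern (Some t) w \<partial>\<mu>) = (\<integral>t. indicator {s} t * kern (Some s) w \<partial>\<mu>)"
      by (rule Bochner_Integration.integral_cong) (auto simp: indicator_def)
    also have "\<dots> = measure \<mu> {s} * kern (Some s) w"
      using sets_mu sets_eq_imp_space_eq[OF sets_mu] by simp
    finally show "(\<integral>t. indicator {s} t * kern (Some t) w \<partial>\<mu>) = measure \<mu> {s} * kern (Some s) w" .
  qed
  finally show ?thesis .
qed

text \<open>Inequalities are available for finite sums of kernels; dominated convergence along an
  enumeration extends them to the whole atomic part.\<close>

lemma poisson_integral_countable_le:
  assumes A: "countable A" and w: "w \<in> upper_half_plane"
    and le: "\<And>X. finite X \<Longrightarrow> X \<subseteq> A \<Longrightarrow> poisson_integral X w \<le> B"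
  shows "poisson_integral A w \<le> B"
proof (cases "A = {}")
  case True
  then show ?thesis using le[of "{}"] by simp
next
  case False
  define X where "X n = from_nat_into A ` {..<n}" for n
  have X: "finite (X n)" "X n \<subseteq> A" for n using from_nat_into[OF False] by (auto simp: X_def)
  have A': "A \<in> sets borel" by (rule sets.countable[OF _ A]) simp
  have "(\<lambda>n. poisson_integral (X n) w) \<longlonglongrightarrow> poisson_integral A w"
    unfolding poisson_integral_def
  proof (rule integral_dominated_convergence[where w = "\<lambda>t. kern (Some t) w"])
    show "AE t in \<mu>. (\<lambda>n. indicator (X n) t * kern (Some t) w) \<longlonglongrightarrow> indicator A t * kern (Some t) w"
    proof (rule AE_I2)
      fix t
      have "\<forall>\<^sub>F n in sequentially. indicator (X n) t = (indicator A t :: real)"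
      proof (cases "t \<in> A")
        case True
        then obtain m where m: "t = from_nat_into A m" using from_nat_into_surj[OF A] by metis
        have "t \<in> X n" if "n > m" for n using that m by (auto simp: X_def)
        then show ?thesis using True by (intro eventually_sequentiallyI[of "Suc m"]) auto
      next
        case False
        then show ?thesis using X(2) by (intro always_eventually) (auto simp: indicator_def)
      qed
      then have "\<forall>\<^sub>F n in sequentially. indicator A t * kern (Some t) w = indicator (X n) t * kern (Some t) w"
        by eventually_elim simp
      then show "(\<lambda>n. indicator (X n) t * kern (Some t) w) \<longlonglongrightarrow> indicator A t * kern (Some t) w"
        by (rule Lim_transform_eventually[OF tendsto_const])
    qed
    show "AE t in \<mu>. norm (indicator (X n) t * kern (Some t) w) \<le> kern (Some t) w" for n
      using kern_nonneg[OF w] by (auto simp: indicator_def)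
  qed (use integrable_kern[OF w] integrable_indicator_kern[OF _ w] A' finite_imp_closed[OF X(1)] in \<open>auto intro: borel_measurable_integrable\<close>)
  then show ?thesis by (rule LIMSEQ_le_const2) (use le X in auto)
qed

section \<open>Atoms, their masses, and invariance of the pure point part\<close>

abbreviation mass :: "real \<Rightarrow> real option \<Rightarrow> real" where
  "mass b x \<equiv> case x of None \<Rightarrow> b | Some t \<Rightarrow> measure \<mu> {t}"

definition atoms :: "real set" where
  "atoms = {t. measure \<mu> {t} \<noteq> 0}"

text \<open>\<open>\<mu>\<close> itself may be infinite. Weighted with the positive kernel at
  \<open>\<i>\<close> it becomes finite and keeps its atoms.\<close>

lemma countable_atoms: "countable atoms"
proof -
  have ii: "\<i> \<in> upper_half_plane" by (simp add: upper_half_plane_def)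
  define N where "N = density \<mu> (\<lambda>t. ennreal (kern (Some t) \<i>))"
  have int: "(\<integral>\<^sup>+ t. ennreal (indicator Y t * kern (Some t) \<i>) \<partial>\<mu>) = ennreal (poisson_integral Y \<i>)" if "Y \<in> sets borel" for Y
    unfolding poisson_integral_def
    by (rule nn_integral_eq_integral[OF integrable_indicator_kern[OF that ii]]) (use kern_nonneg[OF ii] in auto)
  have N: "emeasure N Y = ennreal (poisson_integral Y \<i>)" if Y: "Y \<in> sets borel" for Y
  proof -
    have "emeasure N Y = (\<integral>\<^sup>+ t. ennreal (kern (Some t) \<i>) * indicator Y t \<partial>\<mu>)"
      unfolding N_def using Y sets_mu by (intro emeasure_density) auto
    also have "\<dots> = (\<integral>\<^sup>+ t. ennreal (indicator Y t * kern (Some t) \<i>) \<partial>\<mu>)"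
      by (rule nn_integral_cong) (auto simp: indicator_def)
    finally show ?thesis using int[OF Y] by simp
  qed
  interpret N: finite_measure N
  proof
    have "space N = UNIV" using sets_eq_imp_space_eq[OF sets_mu] by (simp add: N_def)
    then show "emeasure N (space N) \<noteq> \<infinity>" using N[of UNIV] by simp
  qed
  have "atoms \<subseteq> {t. measure N {t} \<noteq> 0}"
  proof
    fix t assume "t \<in> atoms"
    then have "measure \<mu> {t} > 0" by (simp add: atoms_def zero_less_measure_iff)
    moreover have "kern (Some t) \<i> > 0" by (simp add: kern.simps add_nonneg_pos)
    ultimately have "poisson_integral {t} \<i> > 0" using poisson_integral_finite[of "{t}" \<i>] ii by simp
    then show "t \<in> {t. measure N {t} \<noteq> 0}" using N[of "{t}"] by (simp add: measure_def)
  qed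
  then show ?thesis using N.countable_support countable_subset by blast
qed

lemma sets_atoms: "atoms \<in> sets borel"
  by (rule sets.countable[OF _ countable_atoms]) simp

text \<open>Masses are limits of \<open>p\<close> along vertical lines: \<open>p\<close> divided by
  the height tends to \<open>b\<close> at infinity, and \<open>p\<close> times the height tends to
  the mass of \<open>s\<close> above a real point \<open>s\<close>. The same normalisation turns
  \<open>c * kern x\<close> into \<open>c\<close>.\<close>

lemma mass_ge:
  assumes p: "\<And>w. w \<in> upper_half_plane \<Longrightarrow> p w = b * Im w + poisson_integral UNIV w"
    and c: "\<And>w. w \<in> upper_half_plane \<Longrightarrow> c * kern x w \<le> p w"
  shows "c \<le> mass b x"
proof (cases x)
  case None
  \<comment> \<open>Heights \<open>real n + 1\<close> are at least 1, so the integrands stay below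
    the kernel at \<open>\<i>\<close> for every \<open>n\<close>.\<close>
  define X where "X n = (\<integral>t. 1 / (t\<^sup>2 + (real n + 1)\<^sup>2) \<partial>\<mu>)" for n
  have "X \<longlonglongrightarrow> (\<integral>t. 0 \<partial>\<mu>)" unfolding X_def
  proof (rule integral_dominated_convergence)
    show "integrable \<mu> (\<lambda>t. kern (Some t) \<i>)" by (rule integrable_kern) (simp add: upper_half_plane_def)
    show "AE t in \<mu>. (\<lambda>n. 1 / (t\<^sup>2 + (real n + 1)\<^sup>2)) \<longlonglongrightarrow> 0"
    proof (rule AE_I2)
      fix t :: real
      show "(\<lambda>n. 1 / (t\<^sup>2 + (real n + 1)\<^sup>2)) \<longlonglongrightarrow> 0" by real_asymp
    qed
    show "AE t in \<mu>. norm (1 / (t\<^sup>2 + (real n + 1)\<^sup>2)) \<le> kern (Some t) \<i>" for n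
    proof (rule AE_I2)
      fix t :: real
      have "1 \<le> (real n + 1)\<^sup>2" by (simp add: one_le_power)
      then have "1 / (t\<^sup>2 + (real n + 1)\<^sup>2) \<le> 1 / (t\<^sup>2 + 1)" by (intro divide_left_mono mult_pos_pos add_nonneg_pos) auto
      then show "norm (1 / (t\<^sup>2 + (real n + 1)\<^sup>2)) \<le> kern (Some t) \<i>" by (simp add: kern.simps)
    qed
  qed auto
  then have "(\<lambda>n. b + X n) \<longlonglongrightarrow> b + 0" by (intro tendsto_intros) simp
  moreover have "c \<le> b + X n" for n
  proof -
    define w where "w = Complex 0 (real n + 1)"
    have w: "w \<in> upper_half_plane" by (simp add: w_def upper_half_plane_def)
    have "poisson_integral UNIV w = (\<integral>t. (real n + 1) * (1 / (t\<^sup>2 + (real n + 1)\<^sup>2)) \<partial>\<mu>)"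
      unfolding poisson_integral_def by (rule Bochner_Integration.integral_cong) (auto simp: w_def kern.simps)
    also have "\<dots> = (real n + 1) * X n" unfolding X_def by (rule integral_mult_right_zero)
    finally have "c * (real n + 1) \<le> (b + X n) * (real n + 1)"
      using c[OF w] p[OF w] None by (simp add: w_def kern.simps algebra_simps)
    then show ?thesis by (rule mult_right_le_imp_le) simp
  qed
  ultimately show ?thesis using None by (auto intro: LIMSEQ_le_const)
next
  case (Some s)
  define \<eta> where "\<eta> n = 1 / (real n + 1)" for n
  have \<eta>: "0 < \<eta> n" "\<eta> n \<le> 1" for n by (auto simp: \<eta>_def)
  define X where "X n = (\<integral>t. (\<eta> n)\<^sup>2 / ((s - t)\<^sup>2 + (\<eta> n)\<^sup>2) \<partial>\<mu>)" for n
  have \<eta>0: "\<eta> \<longlonglongrightarrow> 0" unfolding \<eta>_def by real_asymp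
  have "X \<longlonglongrightarrow> (\<integral>t. indicator {s} t \<partial>\<mu>)" unfolding X_def
  proof (rule integral_dominated_convergence)
    show "integrable \<mu> (\<lambda>t. kern (Some t) (Complex s 1))" by (rule integrable_kern) (simp add: upper_half_plane_def)
    show "AE t in \<mu>. (\<lambda>n. (\<eta> n)\<^sup>2 / ((s - t)\<^sup>2 + (\<eta> n)\<^sup>2)) \<longlonglongrightarrow> indicator {s} t"
    proof (rule AE_I2)
      fix t :: real
      show "(\<lambda>n. (\<eta> n)\<^sup>2 / ((s - t)\<^sup>2 + (\<eta> n)\<^sup>2)) \<longlonglongrightarrow> indicator {s} t"
      proof (cases "t = s")
        case True
        have "\<eta> n \<noteq> 0" for n using \<eta>(1)[of n] by simp
        then show ?thesis using True by simp
      next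
        case False
        then have "(\<lambda>n. (\<eta> n)\<^sup>2 / ((s - t)\<^sup>2 + (\<eta> n)\<^sup>2)) \<longlonglongrightarrow> 0\<^sup>2 / ((s - t)\<^sup>2 + 0\<^sup>2)"
          by (intro tendsto_intros \<eta>0) auto
        then show ?thesis using False by simp
      qed
    qed
    show "AE t in \<mu>. norm ((\<eta> n)\<^sup>2 / ((s - t)\<^sup>2 + (\<eta> n)\<^sup>2)) \<le> kern (Some t) (Complex s 1)" for n
    proof (rule AE_I2)
      fix t :: real
      have 1: "(\<eta> n)\<^sup>2 \<le> 1" "0 < (\<eta> n)\<^sup>2" using \<eta>[of n] by (auto simp: power_le_one)
      have "(\<eta> n)\<^sup>2 * (s - t)\<^sup>2 \<le> 1 * (s - t)\<^sup>2" using 1 by (intro mult_right_mono) auto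
      then have "(\<eta> n)\<^sup>2 * ((s - t)\<^sup>2 + 1) \<le> 1 * ((s - t)\<^sup>2 + (\<eta> n)\<^sup>2)" by (simp add: algebra_simps)
      then have "(\<eta> n)\<^sup>2 / ((s - t)\<^sup>2 + (\<eta> n)\<^sup>2) \<le> 1 / ((s - t)\<^sup>2 + 1)"
        using 1 by (simp add: frac_le_eq divide_le_eq le_divide_eq add_nonneg_pos)
      then show "norm ((\<eta> n)\<^sup>2 / ((s - t)\<^sup>2 + (\<eta> n)\<^sup>2)) \<le> kern (Some t) (Complex s 1)" by (simp add: kern.simps)
    qed
  qed auto
  then have "X \<longlonglongrightarrow> measure \<mu> {s}"
    using sets_eq_imp_space_eq[OF sets_mu] by simp
  then have "(\<lambda>n. b * (\<eta> n)\<^sup>2 + X n) \<longlonglongrightarrow> b * 0\<^sup>2 + measure \<mu> {s}" by (intro tendsto_intros \<eta>0)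
  moreover have "c \<le> b * (\<eta> n)\<^sup>2 + X n" for n
  proof -
    define w where "w = Complex s (\<eta> n)"
    have w: "w \<in> upper_half_plane" using \<eta> by (simp add: w_def upper_half_plane_def)
    have "X n = (\<integral>t. \<eta> n * (indicator UNIV t * kern (Some t) w) \<partial>\<mu>)" unfolding X_def
      by (rule Bochner_Integration.integral_cong) (auto simp: w_def kern.simps power2_eq_square)
    also have "\<dots> = \<eta> n * poisson_integral UNIV w" unfolding poisson_integral_def by (rule integral_mult_right_zero)
    finally have X: "X n = \<eta> n * poisson_integral UNIV w" .
    have "c * (1 / \<eta> n) \<le> b * \<eta> n + poisson_integral UNIV w"
      using c[OF w] p[OF w] Some \<eta>(1)[of n] by (simp add: w_def kern.simps power2_eq_square)
    then have "\<eta> n * (c * (1 / \<eta> n)) \<le> \<eta> n * (b * \<eta> n + poisson_integral UNIV w)"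
      using \<eta>(1)[of n] by (intro mult_left_mono) auto
    then show ?thesis using \<eta>(1)[of n] X by (simp add: power2_eq_square algebra_simps)
  qed
  ultimately show ?thesis using Some by (auto intro: LIMSEQ_le_const)
qed

text \<open>\<open>X\<close> is not restricted to atoms, since points without mass contribute
  nothing. Images of atoms under an automorphism can thus be inserted before they are known to be
  atoms.\<close>

lemma sum_mass_kern_le:
  assumes b: "0 \<le> b" and X: "finite X" and w: "w \<in> upper_half_plane"
  shows "(\<Sum>x\<in>X. mass b x * kern x w) \<le> b * Im w + poisson_integral atoms w"
proof -
  define Y where "Y = {t\<in>atoms. Some t \<in> X}"
  have "finite (Some -` X)" using X by (rule finite_vimageI) simp
  then have Y: "finite Y" by (rule finite_subset[rotated]) (auto simp: Y_def)
  define Z where "Z = insert None (Some ` Y)"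
  have Z: "finite Z" using Y by (simp add: Z_def)
  have nn: "0 \<le> mass b x * kern x w" for x using b kern_nonneg[OF w] by (auto split: option.split)
  have "(\<Sum>x\<in>X. mass b x * kern x w) = (\<Sum>x\<in>X \<inter> Z. mass b x * kern x w)"
  proof (rule sum.mono_neutral_right[OF X])
    show "\<forall>x\<in>X - X \<inter> Z. mass b x * kern x w = 0"
      by (auto simp: Z_def Y_def atoms_def split: option.split)
  qed auto
  also have "\<dots> \<le> (\<Sum>x\<in>Z. mass b x * kern x w)" using Z nn by (intro sum_mono2) auto
  also have "\<dots> = b * Im w + (\<Sum>t\<in>Y. measure \<mu> {t} * kern (Some t) w)"
    unfolding Z_def using Y by (subst sum.insert) (auto simp: kern.simps sum.reindex)
  also have "\<dots> = b * Im w + poisson_integral Y w" using poisson_integral_finite[OF Y w] by simp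
  also have "\<dots> \<le> b * Im w + poisson_integral atoms w"
    using poisson_integral_mono[OF finite_imp_closed[OF Y, THEN borel_closed] sets_atoms _ w] by (auto simp: Y_def)
  finally show ?thesis .
qed

text \<open>The mass at \<open>x\<close> is the largest \<open>c\<close> with \<open>c * kern x \<le> p\<close>, a description that is
  invariant under the automorphisms of the half-plane that preserve \<open>p\<close>.\<close>

lemma pure_point_part_automorphism_le:
  assumes b: "0 \<le> b" and p: "\<And>w. w \<in> upper_half_plane \<Longrightarrow> p w = b * Im w + poisson_integral UNIV w"
    and \<gamma>: "\<gamma> holomorphic_on upper_half_plane" "\<gamma> \<in> upper_half_plane \<rightarrow> upper_half_plane"
    and \<delta>: "\<delta> holomorphic_on upper_half_plane" "\<delta> \<in> upper_half_plane \<rightarrow> upper_half_plane"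
    and inv: "\<And>w. w \<in> upper_half_plane \<Longrightarrow> \<delta> (\<gamma> w) = w" "\<And>w. w \<in> upper_half_plane \<Longrightarrow> \<gamma> (\<delta> w) = w"
    and pinv: "\<And>w. w \<in> upper_half_plane \<Longrightarrow> p (\<gamma> w) = p w"
    and w: "w \<in> upper_half_plane"
  shows "b * Im (\<gamma> w) + poisson_integral atoms (\<gamma> w) \<le> b * Im w + poisson_integral atoms w"
proof -
  have \<gamma>w: "\<gamma> w \<in> upper_half_plane" using \<gamma>(2) w by auto
  have "\<exists>y k. k > 0 \<and> (\<forall>w\<in>upper_half_plane. kern x (\<gamma> w) = k * kern y w)" for x
    by (rule kern_automorphism[OF \<gamma> \<delta> inv(1)])
  \<comment> \<open>\<open>\<sigma>\<close> is the boundary action of the inverse of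
    \<open>\<gamma>\<close>, and \<open>k\<close> the factor by which the kernel changes.
    Injectivity of \<open>\<sigma>\<close> allows the sum over atoms to be reindexed.\<close>
  then obtain \<sigma> k where \<sigma>: "\<And>x. k x > 0" "\<And>x v. v \<in> upper_half_plane \<Longrightarrow> kern x (\<gamma> v) = k x * kern (\<sigma> x) v"
    by metis
  have "inj \<sigma>"
  proof (rule injI)
    fix x y assume eq: "\<sigma> x = \<sigma> y"
    show "x = y"
    proof (rule kern_proportional_imp_eq)
      fix v assume v: "v \<in> upper_half_plane"
      then have dv: "\<delta> v \<in> upper_half_plane" using \<delta>(2) by auto
      have "kern x v = k x * kern (\<sigma> x) (\<delta> v)" "kern y v = k y * kern (\<sigma> x) (\<delta> v)"
        using \<sigma>(2)[OF dv, of x] \<sigma>(2)[OF dv, of y] inv(2)[OF v] eq by auto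
      then show "kern x v = k x / k y * kern y v" using \<sigma>(1)[of y] by simp
    qed
  qed
  have Aw: "poisson_integral atoms v \<le> poisson_integral UNIV v" if "v \<in> upper_half_plane" for v
    by (rule poisson_integral_mono[OF sets_atoms _ _ that]) auto
  \<comment> \<open>The inequality \<open>mass b x * kern x \<le> p\<close>, composed with
    \<open>\<gamma>\<close> under which \<open>p\<close> is invariant, makes
    \<open>mass b x * k x\<close> an admissible coefficient at \<open>\<sigma> x\<close>.\<close>
  have m: "mass b x * k x \<le> mass b (\<sigma> x)" for x
  proof (rule mass_ge[OF p])
    fix v assume v: "v \<in> upper_half_plane"
    then have gv: "\<gamma> v \<in> upper_half_plane" using \<gamma>(2) by auto
    have "mass b x * k x * kern (\<sigma> x) v = (\<Sum>x\<in>{x}. mass b x * kern x (\<gamma> v))" using \<sigma>(2)[OF v] by simp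
    also have "\<dots> \<le> b * Im (\<gamma> v) + poisson_integral atoms (\<gamma> v)" by (rule sum_mass_kern_le[OF b _ gv]) simp
    also have "\<dots> \<le> p (\<gamma> v)" using Aw[OF gv] p[OF gv] by simp
    finally show "mass b x * k x * kern (\<sigma> x) v \<le> p v" using pinv[OF v] by simp
  qed
  have "poisson_integral atoms (\<gamma> w) \<le> b * Im w + poisson_integral atoms w - b * Im (\<gamma> w)"
  proof (rule poisson_integral_countable_le[OF countable_atoms \<gamma>w])
    fix X assume X: "finite X" "X \<subseteq> atoms"
    define Z where "Z = insert None (Some ` X)"
    have Z: "finite Z" using X by (simp add: Z_def)
    have "b * Im (\<gamma> w) + poisson_integral X (\<gamma> w) = (\<Sum>x\<in>Z. mass b x * kern x (\<gamma> w))"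
      unfolding Z_def poisson_integral_finite[OF X(1) \<gamma>w] using X(1)
      by (subst sum.insert) (auto simp: kern.simps sum.reindex)
    also have "\<dots> = (\<Sum>x\<in>Z. mass b x * k x * kern (\<sigma> x) w)" using \<sigma>(2)[OF w] by (simp add: mult.assoc)
    also have "\<dots> \<le> (\<Sum>x\<in>Z. mass b (\<sigma> x) * kern (\<sigma> x) w)"
      using m kern_nonneg[OF w] by (intro sum_mono mult_right_mono) auto
    also have "\<dots> = (\<Sum>x\<in>\<sigma> ` Z. mass b x * kern x w)"
      using \<open>inj \<sigma>\<close> by (subst sum.reindex) (auto intro: inj_on_subset)
    also have "\<dots> \<le> b * Im w + poisson_integral atoms w"
      by (rule sum_mass_kern_le[OF b _ w]) (use Z in simp)
    finally show "poisson_integral X (\<gamma> w) \<le> b * Im w + poisson_integral atoms w - b * Im (\<gamma> w)" by simp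
  qed
  then show ?thesis by simp
qed

lemma emeasure_zero_if_poisson_integral_zero:
  assumes Y: "Y \<in> sets borel" and 0: "poisson_integral Y \<i> = 0"
  shows "emeasure \<mu> Y = 0"
proof -
  have ii: "\<i> \<in> upper_half_plane" by (simp add: upper_half_plane_def)
  have "AE t in \<mu>. indicator Y t * kern (Some t) \<i> = 0"
    using 0 integral_nonneg_eq_0_iff_AE[OF integrable_indicator_kern[OF Y ii]] kern_nonneg[OF ii]
    unfolding poisson_integral_def by auto
  moreover have "kern (Some t) \<i> \<noteq> 0" for t
    by (simp add: kern.simps add_nonneg_eq_0_iff)
  ultimately have "AE t in \<mu>. t \<notin> Y" by (auto simp: indicator_def)
  then show ?thesis using Y sets_mu sets_eq_imp_space_eq[OF sets_mu] by (simp add: AE_iff_measurable[OF _ refl])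
qed

text \<open>As the pure point part equals \<open>c * p\<close>, the coefficient
  \<open>mass b x / c\<close> is admissible at \<open>x\<close>, hence at most
  \<open>mass b x\<close>, so \<open>1 \<le> c\<close>. The atomic part then exhausts
  \<open>p\<close>, and nothing is left for the complement of the atoms.\<close>

lemma pure_point_if_pure_point_part_proportional:
  assumes b: "0 \<le> b" and p: "\<And>w. w \<in> upper_half_plane \<Longrightarrow> p w = b * Im w + poisson_integral UNIV w"
    and c: "\<And>w. w \<in> upper_half_plane \<Longrightarrow> b * Im w + poisson_integral atoms w = c * p w"
    and x: "mass b x \<noteq> 0"
  shows "emeasure \<mu> (- atoms) = 0"
proof (rule emeasure_zero_if_poisson_integral_zero)
  show "- atoms \<in> sets borel" using sets_atoms by auto
  have ii: "\<i> \<in> upper_half_plane" by (simp add: upper_half_plane_def)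
  have p0: "0 \<le> p w" if "w \<in> upper_half_plane" for w
    using p[OF that] b poisson_integral_nonneg[OF that] that by (simp add: upper_half_plane_def)
  have mx: "mass b x > 0" using x b zero_less_measure_iff by (auto split: option.splits)
  have kx: "kern x \<i> > 0" by (cases x) (auto simp: kern.simps add_nonneg_pos)
  have le: "mass b x * kern x w \<le> c * p w" if w: "w \<in> upper_half_plane" for w
    using sum_mass_kern_le[OF b _ w, of "{x}"] c[OF w] by simp
  have "0 < c * p \<i>" using le[OF ii] mult_pos_pos[OF mx kx] by linarith
  then have c0: "c > 0" using p0[OF ii] by (simp add: zero_less_mult_iff)
  have "mass b x / c \<le> mass b x"
  proof (rule mass_ge[OF p])
    show "mass b x / c * kern x w \<le> p w" if "w \<in> upper_half_plane" for w
      using le[OF that] c0 by (simp add: pos_divide_le_eq mult.commute)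
  qed
  then have "1 \<le> c" using mx c0 by (simp add: pos_divide_le_eq)
  then have "p \<i> \<le> c * p \<i>" using p0[OF ii] mult_right_mono[of 1 c "p \<i>"] by simp
  then have ge: "poisson_integral UNIV \<i> \<le> poisson_integral atoms \<i>" using c[OF ii] p[OF ii] by simp
  have "poisson_integral UNIV \<i> = (\<integral>t. indicator atoms t * kern (Some t) \<i> + indicator (- atoms) t * kern (Some t) \<i> \<partial>\<mu>)"
    unfolding poisson_integral_def by (rule Bochner_Integration.integral_cong) (auto simp: indicator_def)
  also have "\<dots> = poisson_integral atoms \<i> + poisson_integral (- atoms) \<i>" unfolding poisson_integral_def
    using sets_atoms by (intro Bochner_Integration.integral_add integrable_indicator_kern ii) auto
  finally show "poisson_integral (- atoms) \<i> = 0"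
    using ge poisson_integral_nonneg[OF ii, of "- atoms"] by simp
qed

lemma pure_point_representing_measure:
  assumes "emeasure \<mu> (- atoms) = 0"
  shows "pure_point (representing_measure b \<mu>)"
proof -
  \<comment> \<open>Codes that the enumeration does not use get the empty set, so finite sets of
    atoms need no separate treatment: the default points \<open>from_nat_into atoms n\<close> then
    carry weight 0. Index 0 is reserved for infinity.\<close>
  define B where "B n = (if n \<in> to_nat_on atoms ` atoms then {from_nat_into atoms n} else {})" for n
  define x where "x n = (case n of 0 \<Rightarrow> None | Suc n \<Rightarrow> Some (from_nat_into atoms n))" for n
  define wt where "wt n = (case n of 0 \<Rightarrow> ennreal b | Suc n \<Rightarrow> emeasure \<mu> (B n))" for n
  have Bat: "B n = {t\<in>atoms. to_nat_on atoms t = n}" for n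
    using from_nat_into_to_nat_on[OF countable_atoms] inj_on_to_nat_on[OF countable_atoms]
    by (auto simp: B_def dest: inj_onD)
  have "emeasure (representing_measure b \<mu>) A = (\<Sum>n. wt n * indicator A (x n))"
    if A: "A \<in> sets (representing_measure b \<mu>)" for A
  proof -
    define S where "S = Some -` A"
    have S: "S \<in> sets borel" using A by (simp add: S_def sets_representing_measure)
    have sB: "B n \<in> sets borel" for n by (simp add: B_def)
    have "emeasure \<mu> S = emeasure \<mu> (S \<inter> atoms)"
    proof (rule antisym)
      have "emeasure \<mu> S \<le> emeasure \<mu> ((S \<inter> atoms) \<union> (- atoms))"
        using S sets_atoms sets_mu by (intro emeasure_mono) auto
      also have "\<dots> \<le> emeasure \<mu> (S \<inter> atoms) + emeasure \<mu> (- atoms)"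
        using S sets_atoms sets_mu by (intro emeasure_subadditive) auto
      finally show "emeasure \<mu> S \<le> emeasure \<mu> (S \<inter> atoms)" using assms by simp
    qed (use S sets_mu in \<open>auto intro: emeasure_mono\<close>)
    also have "S \<inter> atoms = (\<Union>n. B n \<inter> S)" by (auto simp: Bat)
    also have "emeasure \<mu> \<dots> = (\<Sum>n. emeasure \<mu> (B n \<inter> S))"
      by (rule suminf_emeasure[symmetric]) (use sB S sets_mu in \<open>auto simp: disjoint_family_on_def Bat\<close>)
    also have "\<dots> = (\<Sum>n. wt (Suc n) * indicator A (x (Suc n)))"
      by (rule suminf_cong) (auto simp: wt_def x_def B_def S_def indicator_def)
    finally have "emeasure \<mu> S = (\<Sum>n. wt (Suc n) * indicator A (x (Suc n)))" .
    moreover have "(\<Sum>n. wt n * indicator A (x n)) = (\<Sum>n. wt (n + 1) * indicator A (x (n + 1))) + (\<Sum>n<1. wt n * indicator A (x n))"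
      by (rule suminf_offset) auto
    ultimately show ?thesis
      unfolding emeasure_representing_measure[OF sets_mu S[unfolded S_def]]
      by (simp add: S_def wt_def x_def add.commute)
  qed
  then show ?thesis unfolding pure_point_def by blast
qed

end

section \<open>Bounded densities and singularity with respect to Lebesgue measure\<close>

lemma nn_integral_kern_lborel:
  assumes w: "w \<in> upper_half_plane"
  shows "(\<integral>\<^sup>+ t. ennreal (kern (Some t) w) \<partial>lborel) = (\<integral>\<^sup>+ t. ennreal (inverse (1 + t\<^sup>2)) \<partial>lborel)"
proof -
  define \<eta> where "\<eta> = Im w"
  have \<eta>: "\<eta> > 0" using w by (simp add: \<eta>_def upper_half_plane_def)
  \<comment> \<open>Substituting \<open>Re w + \<eta> * t\<close> for \<open>t\<close> removes the
    dependence on \<open>w\<close>. This common value is what bounds the Poisson integrals of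
    bounded densities.\<close>
  have "(\<integral>\<^sup>+ t. ennreal (kern (Some t) w) \<partial>lborel) = \<bar>\<eta>\<bar> * (\<integral>\<^sup>+ t. ennreal (kern (Some (Re w + \<eta> * t)) w) \<partial>lborel)"
    by (rule nn_integral_real_affine) (use \<eta> in auto)
  also have "\<dots> = (\<integral>\<^sup>+ t. ennreal \<bar>\<eta>\<bar> * ennreal (kern (Some (Re w + \<eta> * t)) w) \<partial>lborel)"
    by (rule nn_integral_cmult[symmetric]) (simp add: kern.simps)
  also have "\<dots> = (\<integral>\<^sup>+ t. ennreal (inverse (1 + t\<^sup>2)) \<partial>lborel)"
  proof (rule nn_integral_cong)
    fix t
    have "kern (Some (Re w + \<eta> * t)) w = \<eta> / (\<eta>\<^sup>2 * (1 + t\<^sup>2))"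
      by (simp add: kern.simps \<eta>_def power_mult_distrib algebra_simps)
    moreover have "\<bar>\<eta>\<bar> * (\<eta> / (\<eta>\<^sup>2 * q)) = inverse q" for q
      using \<eta> by (simp add: power2_eq_square inverse_eq_divide)
    ultimately have "\<bar>\<eta>\<bar> * kern (Some (Re w + \<eta> * t)) w = inverse (1 + t\<^sup>2)" by simp
    then show "ennreal \<bar>\<eta>\<bar> * ennreal (kern (Some (Re w + \<eta> * t)) w) = ennreal (inverse (1 + t\<^sup>2))"
      by (simp add: ennreal_mult'[symmetric])
  qed
  finally show ?thesis .
qed

lemma nn_integral_inverse_1_plus_square_finite: "(\<integral>\<^sup>+ t. ennreal (inverse (1 + t\<^sup>2)) \<partial>lborel) < \<infinity>"
  using integrable_inverse_1_plus_square
  by (simp add: set_integrable_def integrable_iff_bounded)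

context poisson_integrable
begin

text \<open>The domination is stated with the weight \<open>kern (Some t) \<i>\<close>, which makes
  both measures finite. Integrating the ratio \<open>g\<close> of the kernels at \<open>w\<close>
  and at \<open>\<i>\<close> exchanges this weight for the kernel at \<open>w\<close>, and the
  Lebesgue side does not depend on \<open>w\<close>.\<close>

lemma poisson_integral_bounded_if_dominated:
  assumes Y[measurable]: "Y \<in> sets borel"
    and dom: "\<And>X. X \<in> sets borel \<Longrightarrow> X \<subseteq> Y \<Longrightarrow>
      (\<integral>\<^sup>+ t. ennreal (kern (Some t) \<i>) * indicator X t \<partial>\<mu>) \<le> real n * (\<integral>\<^sup>+ t. ennreal (kern (Some t) \<i>) * indicator X t \<partial>lborel)"
  obtains K where "\<And>w. w \<in> upper_half_plane \<Longrightarrow> poisson_integral Y w \<le> K"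
proof
  fix w assume w: "w \<in> upper_half_plane"
  define f where "f t = ennreal (kern (Some t) \<i>)" for t
  define g where "g t = ennreal (kern (Some t) w / kern (Some t) \<i>)" for t
  have ii: "\<i> \<in> upper_half_plane" by (simp add: upper_half_plane_def)
  have f0: "kern (Some t) \<i> > 0" for t by (simp add: kern.simps add_nonneg_pos)
  have fg: "f t * g t = ennreal (kern (Some t) w)" for t
    unfolding f_def g_def using f0[of t] kern_nonneg[OF w, of "Some t"] by (subst ennreal_mult[symmetric]) auto
  have [measurable]: "f \<in> borel_measurable borel" "g \<in> borel_measurable borel"
    unfolding f_def[abs_def] g_def[abs_def] by measurable
  define N where "N = density \<mu> (\<lambda>t. f t * indicator Y t)"
  define L where "L = density lborel (\<lambda>t. of_nat n * (f t * indicator Y t))"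
  have "N \<le> L"
  proof (subst le_measure)
    show sets: "sets N = sets L" by (simp add: N_def L_def sets_mu)
    show "\<forall>X\<in>sets N. emeasure N X \<le> emeasure L X"
    proof
      fix X assume "X \<in> sets N"
      then have [measurable]: "X \<in> sets borel" by (simp add: N_def sets_mu)
      have "emeasure N X = (\<integral>\<^sup>+ t. f t * indicator Y t * indicator X t \<partial>\<mu>)"
        unfolding N_def by (rule emeasure_density) (auto simp: sets_mu)
      also have "\<dots> = (\<integral>\<^sup>+ t. f t * indicator (X \<inter> Y) t \<partial>\<mu>)"
        by (rule nn_integral_cong) (auto simp: indicator_def)
      also have "\<dots> \<le> real n * (\<integral>\<^sup>+ t. f t * indicator (X \<inter> Y) t \<partial>lborel)"
        unfolding f_def by (rule dom) auto
      also have "\<dots> = (\<integral>\<^sup>+ t. of_nat n * (f t * indicator (X \<inter> Y) t) \<partial>lborel)"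
        by (subst nn_integral_cmult) (auto simp: ennreal_of_nat_eq_real_of_nat)
      also have "\<dots> = (\<integral>\<^sup>+ t. of_nat n * (f t * indicator Y t) * indicator X t \<partial>lborel)"
        by (rule nn_integral_cong) (auto simp: indicator_def)
      also have "\<dots> = emeasure L X"
        unfolding L_def by (rule emeasure_density[symmetric]) auto
      finally show "emeasure N X \<le> emeasure L X" .
    qed
  qed
  have "ennreal (poisson_integral Y w) = (\<integral>\<^sup>+ t. ennreal (indicator Y t * kern (Some t) w) \<partial>\<mu>)"
    unfolding poisson_integral_def
    by (rule nn_integral_eq_integral[symmetric, OF integrable_indicator_kern[OF Y w]]) (use kern_nonneg[OF w] in auto)
  also have "\<dots> = (\<integral>\<^sup>+ t. f t * indicator Y t * g t \<partial>\<mu>)"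
    by (rule nn_integral_cong) (auto simp: indicator_def fg)
  also have "\<dots> = (\<integral>\<^sup>+ t. g t \<partial>N)" unfolding N_def by (rule nn_integral_density[symmetric]) auto
  also have "\<dots> \<le> (\<integral>\<^sup>+ t. g t \<partial>L)"
    by (rule nn_integral_mono_measure[OF _ \<open>N \<le> L\<close>]) (simp add: N_def L_def sets_mu)
  also have "\<dots> = (\<integral>\<^sup>+ t. of_nat n * (f t * indicator Y t) * g t \<partial>lborel)"
    unfolding L_def by (rule nn_integral_density) auto
  also have "\<dots> \<le> (\<integral>\<^sup>+ t. of_nat n * ennreal (kern (Some t) w) \<partial>lborel)"
    by (rule nn_integral_mono) (auto simp: indicator_def fg[symmetric] mult.assoc)
  also have "\<dots> = of_nat n * (\<integral>\<^sup>+ t. ennreal (inverse (1 + t\<^sup>2)) \<partial>lborel)"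
    unfolding nn_integral_kern_lborel[OF w, symmetric] by (rule nn_integral_cmult) simp
  finally have le: "ennreal (poisson_integral Y w) \<le> of_nat n * (\<integral>\<^sup>+ t. ennreal (inverse (1 + t\<^sup>2)) \<partial>lborel)" .
  have "of_nat n * (\<integral>\<^sup>+ t. ennreal (inverse (1 + t\<^sup>2)) \<partial>lborel) < \<infinity>"
    using nn_integral_inverse_1_plus_square_finite by (simp add: ennreal_mult_less_top ennreal_of_nat_eq_real_of_nat)
  then have "enn2real (ennreal (poisson_integral Y w)) \<le> enn2real (of_nat n * (\<integral>\<^sup>+ t. ennreal (inverse (1 + t\<^sup>2)) \<partial>lborel))"
    using le by (intro enn2real_mono) auto
  then show "poisson_integral Y w \<le> enn2real (of_nat n * (\<integral>\<^sup>+ t. ennreal (inverse (1 + t\<^sup>2)) \<partial>lborel))"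
    using poisson_integral_nonneg[OF w] by simp
qed

text \<open>The Hahn decompositions of \<open>\<mu> - n * lborel\<close> (with the weight \<open>1 / (1 + t\<^sup>2)\<close>, which makes both
  measures finite) replace the Lebesgue decomposition of \<open>\<mu>\<close>.\<close>

lemma mutually_singular_lborel_if_bounded_poisson_integrals_zero:
  assumes zero: "\<And>Y K. Y \<in> sets borel \<Longrightarrow> (\<And>w. w \<in> upper_half_plane \<Longrightarrow> poisson_integral Y w \<le> K) \<Longrightarrow> emeasure \<mu> Y = 0"
  shows "mutually_singular \<mu> lborel"
proof -
  define f where "f t = ennreal (kern (Some t) \<i>)" for t
  have ii: "\<i> \<in> upper_half_plane" by (simp add: upper_half_plane_def)
  have [measurable]: "f \<in> borel_measurable borel" unfolding f_def[abs_def] by measurable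
  define M where "M = density \<mu> f"
  define L where "L n = density lborel (\<lambda>t. of_nat n * f t)" for n :: nat
  have sets: "sets M = sets borel" "sets (L n) = sets borel" for n by (auto simp: M_def L_def sets_mu)
  have M: "emeasure M X = (\<integral>\<^sup>+ t. f t * indicator X t \<partial>\<mu>)" if "X \<in> sets borel" for X
    unfolding M_def by (rule emeasure_density) (use that in \<open>auto simp: sets_mu\<close>)
  have L: "emeasure (L n) X = of_nat n * (\<integral>\<^sup>+ t. f t * indicator X t \<partial>lborel)" if [measurable]: "X \<in> sets borel" for X n
  proof -
    have "emeasure (L n) X = (\<integral>\<^sup>+ t. of_nat n * f t * indicator X t \<partial>lborel)"
      unfolding L_def by (rule emeasure_density) auto
    also have "\<dots> = (\<integral>\<^sup>+ t. of_nat n * (f t * indicator X t) \<partial>lborel)" by (simp add: mult.assoc)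
    also have "\<dots> = of_nat n * (\<integral>\<^sup>+ t. f t * indicator X t \<partial>lborel)" by (rule nn_integral_cmult) auto
    finally show ?thesis .
  qed
  have Mfin: "emeasure M UNIV < \<infinity>"
    using integrable_kern[OF ii] kern_nonneg[OF ii] by (simp add: M f_def integrable_iff_bounded)
  have Lfin: "emeasure (L n) UNIV < \<infinity>" for n
    using nn_integral_inverse_1_plus_square_finite
    by (simp add: L f_def nn_integral_kern_lborel[OF ii] ennreal_mult_less_top ennreal_of_nat_eq_real_of_nat)
  have "\<exists>Y\<in>sets (L n). Y \<subseteq> UNIV \<and> (\<forall>X\<in>sets (L n). X \<subseteq> Y \<longrightarrow> M X \<le> L n X) \<and> (\<forall>X\<in>sets (L n). X \<subseteq> UNIV \<longrightarrow> X \<inter> Y = {} \<longrightarrow> L n X \<le> M X)" for n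
    by (rule unsigned_Hahn_decomposition) (use Mfin Lfin[of n] sets in auto)
  then obtain Y where Y: "\<And>n. Y n \<in> sets borel" "\<And>n X. X \<in> sets borel \<Longrightarrow> X \<subseteq> Y n \<Longrightarrow> M X \<le> L n X"
    "\<And>n X. X \<in> sets borel \<Longrightarrow> X \<inter> Y n = {} \<Longrightarrow> L n X \<le> M X"
    unfolding sets by (metis subset_UNIV)
  have Y0: "emeasure \<mu> (Y n) = 0" for n
  proof -
    obtain K where "\<And>w. w \<in> upper_half_plane \<Longrightarrow> poisson_integral (Y n) w \<le> K"
    proof (rule poisson_integral_bounded_if_dominated[OF Y(1)[of n], of n])
      fix X assume X: "X \<in> sets borel" "X \<subseteq> Y n"
      show "(\<integral>\<^sup>+ t. ennreal (kern (Some t) \<i>) * indicator X t \<partial>\<mu>) \<le> real n * (\<integral>\<^sup>+ t. ennreal (kern (Some t) \<i>) * indicator X t \<partial>lborel)"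
        using Y(2)[OF X] unfolding M[OF X(1)] L[OF X(1)] f_def by (simp add: ennreal_of_nat_eq_real_of_nat)
    qed blast
    then show ?thesis by (rule zero[OF Y(1)])
  qed
  \<comment> \<open>Outside all \<open>Y n\<close> the weighted \<open>\<mu>\<close> dominates every
    multiple of the weighted Lebesgue measure; being finite, it forces \<open>N\<close> to be a
    Lebesgue null set. Each \<open>Y n\<close> is \<open>\<mu>\<close>-null, as its Poisson integral
    is bounded.\<close>
  define N where "N = - (\<Union>n. Y n)"
  have N[measurable]: "N \<in> sets borel" using Y(1) by (auto simp: N_def)
  define I where "I = (\<integral>\<^sup>+ t. f t * indicator N t \<partial>lborel)"
  have le: "of_nat n * I \<le> emeasure M UNIV" for n
  proof -
    have "of_nat n * I = emeasure (L n) N" unfolding I_def L[OF N] ..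
    also have "\<dots> \<le> emeasure M N" by (rule Y(3)[OF N]) (auto simp: N_def)
    also have "\<dots> \<le> emeasure M UNIV" by (rule emeasure_mono) (auto simp: sets)
    finally show ?thesis .
  qed
  have "I = 0"
  proof (rule ccontr)
    assume "I \<noteq> 0"
    have "I \<le> emeasure M UNIV" using le[of 1] by simp
    then have "I < \<infinity>" using Mfin by (rule le_less_trans)
    then obtain i where i: "I = ennreal i" "i \<ge> 0" by (cases I) auto
    obtain m where m: "emeasure M UNIV = ennreal m" "m \<ge> 0" using Mfin by (cases "emeasure M UNIV") auto
    have "real n * i \<le> m" for n
      using le[of n] i m by (simp add: ennreal_of_nat_eq_real_of_nat ennreal_mult[symmetric])
    moreover have "i > 0" using i \<open>I \<noteq> 0\<close> by (cases "i = 0") auto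
    ultimately show False using reals_Archimedean3[of i] by (meson not_le)
  qed
  then have "AE t in lborel. f t * indicator N t = 0"
    unfolding I_def by (subst (asm) nn_integral_0_iff_AE) auto
  moreover have "f t \<noteq> 0" for t by (simp add: f_def kern.simps add_nonneg_pos ennreal_eq_0_iff not_le)
  ultimately have "AE t in lborel. t \<notin> N" by (auto simp: indicator_def)
  then have N0: "emeasure lborel N = 0" by (simp add: AE_iff_measurable[OF _ refl])
  have "emeasure \<mu> (space \<mu> - N) = 0"
  proof -
    have "space \<mu> - N = (\<Union>n. Y n)" using sets_eq_imp_space_eq[OF sets_mu] by (auto simp: N_def)
    moreover have "emeasure \<mu> (\<Union>n. Y n) \<le> (\<Sum>n. emeasure \<mu> (Y n))"
      using Y(1) by (intro emeasure_subadditive_countably) (auto simp: sets_mu)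
    ultimately show ?thesis using Y0 by simp
  qed
  then show ?thesis unfolding mutually_singular_def using N N0 sets_mu by auto
qed

end

section \<open>Singularity and purity\<close>

text \<open>At points of \<open>E\<close> the function is squeezed between 0 and \<open>M\<close>,
  so domination alone supplies the boundary values.\<close>

lemma continuous_on_UNIV_if_dominated:
  fixes v :: "complex \<Rightarrow> real"
  assumes E: "closed E" and M: "continuous_on UNIV M" "\<And>z. z \<in> E \<Longrightarrow> M z = 0"
    and v: "\<And>z. z \<in> - E \<Longrightarrow> isCont v z" "\<And>z. 0 \<le> v z" "\<And>z. v z \<le> M z"
  shows "continuous_on UNIV v"
  unfolding continuous_on_eq_continuous_at[OF open_UNIV]
proof
  fix z
  show "isCont v z"
  proof (cases "z \<in> E")
    case True
    then have "M z = 0" "v z = 0" using M(2)[OF True] v(2)[of z] v(3)[of z] by auto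
    have "(M \<longlongrightarrow> 0) (at z)" using M(1) \<open>M z = 0\<close> by (metis UNIV_I continuous_on_eq_continuous_at isCont_def open_UNIV)
    then have "(v \<longlongrightarrow> 0) (at z)" 
      using tendsto_sandwich[of "\<lambda>_. 0" v "at z" M 0] v(2,3) by auto
    then show ?thesis using \<open>v z = 0\<close> by (simp add: isCont_def)
  qed (use v in auto)
qed

text \<open>Comparison with \<open>\<epsilon> * ln (norm z)\<close> on an annulus shows that the maximum of \<open>S\<close>
  over the unit circle is a global one.\<close>

lemma bounded_Re_holomorphic_sup_nonpos:
  assumes E: "closed E" "e \<in> E" and S: "Re_holomorphic_sup_on S (- E)" "continuous_on UNIV S"
    and bd: "\<And>z. S z \<le> K" and S0: "\<And>z. z \<in> E \<Longrightarrow> S z = 0"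
  shows "S z \<le> 0"
proof -
  have "continuous_on (sphere 0 1) S" using S(2) continuous_on_subset by blast
  then obtain y where y: "norm y = 1" "\<And>z. norm z = 1 \<Longrightarrow> S z \<le> S y"
    using continuous_attains_sup[of "sphere (0::complex) 1" S] by auto
  define m where "m = max (S y) 0"
  have inside: "S z \<le> m" if "norm z \<le> 1" for z
  proof (rule vanishing_positive_max_principle[OF S(1) E(1) S(2) _ _ that])
    show "S z \<le> m" if "norm z = 1" for z using y(2)[OF that] by (simp add: m_def)
  qed (simp add: S0 m_def)
  have eps: "S z \<le> m + \<epsilon> * ln (norm z)" if z: "norm z > 1" and \<epsilon>: "\<epsilon> > 0" for z \<epsilon>
  proof -
    \<comment> \<open>The radius is so large that \<open>\<epsilon> * ln R\<close> outweighs the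
      bound \<open>K\<close> on the outer circle.\<close>
    define R where "R = max (norm z) (exp (\<bar>K\<bar> / \<epsilon>))"
    have R: "norm z \<le> R" "R > 1" "\<bar>K\<bar> / \<epsilon> \<le> ln R"
    proof -
      show "norm z \<le> R" "R > 1" using z by (auto simp: R_def)
      have "\<bar>K\<bar> / \<epsilon> = ln (exp (\<bar>K\<bar> / \<epsilon>))" by simp
      also have "\<dots> \<le> ln R" by (subst ln_le_cancel_iff) (use \<open>R > 1\<close> in \<open>auto simp: R_def\<close>)
      finally show "\<bar>K\<bar> / \<epsilon> \<le> ln R" .
    qed
    have "S z - \<epsilon> * ln (norm z) \<le> m"
    proof (rule Re_holomorphic_sup_max_principle[where S = "\<lambda>z. S z - \<epsilon> * ln (norm z)"
          and U = "(ball 0 R - cball 0 1) - E" and K = "cball 0 R - ball 0 1"])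
      have "(\<lambda>z. \<epsilon> * ln (norm z) + 0 * ln (norm z)) locally_Re_holomorphic_on ball 0 R - cball 0 1 - E"
        by (intro locally_Re_holomorphic_on_lincomb ln_norm_locally_Re_holomorphic) auto
      then show "Re_holomorphic_sup_on (\<lambda>z. S z - \<epsilon> * ln (norm z)) (ball 0 R - cball 0 1 - E)"
        by (intro Re_holomorphic_sup_on_diff Re_holomorphic_sup_on_subset[OF S(1)]) auto
      show "continuous_on (cball 0 R - ball 0 1) (\<lambda>z. S z - \<epsilon> * ln (norm z))"
        by (intro continuous_intros continuous_on_subset[OF S(2)]) auto
      show "open (ball 0 R - cball 0 1 - E)" using E(1) by (intro open_Diff) auto
      show "compact (cball (0::complex) R - ball 0 1)" by (intro compact_diff) auto
      show "z \<in> cball 0 R - ball 0 1" using z R by auto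
      fix x assume x: "x \<in> cball 0 R - ball 0 1 - (ball 0 R - cball 0 1 - E)"
      then have lx: "0 \<le> ln (norm x)" by auto
      consider "x \<in> E" | "norm x = 1" | "norm x = R" using x by fastforce
      then show "S x - \<epsilon> * ln (norm x) \<le> m"
      proof cases
        case 1
        have "0 \<le> \<epsilon> * ln (norm x)" using lx \<epsilon> by simp
        moreover have "0 \<le> m" by (simp add: m_def)
        ultimately show ?thesis using S0[OF 1] by linarith
      next
        case 2
        then show ?thesis using y(2)[OF 2] by (simp add: m_def)
      next
        case 3
        have "\<bar>K\<bar> \<le> \<epsilon> * ln R" using R(3) \<epsilon> by (simp add: pos_divide_le_eq mult.commute)
        then show ?thesis using bd[of x] 3 by (simp add: m_def)
      qed
    qed auto
    then show ?thesis by simp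
  qed
  have le: "S z \<le> m" for z
  proof (cases "norm z \<le> 1")
    case False
    then have l: "ln (norm z) > 0" by (intro ln_gt_zero) simp
    show ?thesis
    proof (rule ccontr)
      assume "\<not> S z \<le> m"
      then have "S z \<le> m + (S z - m) / (2 * ln (norm z)) * ln (norm z)" using False l by (intro eps) auto
      then show False using l \<open>\<not> S z \<le> m\<close> by (simp add: field_simps)
    qed
  qed (rule inside)
  have "m = 0"
  proof (rule ccontr)
    assume "m \<noteq> 0"
    then have m: "m > 0" "S y = m" by (auto simp: m_def max_def split: if_splits)
    \<comment> \<open>A positive maximum is attained off \<open>E\<close>. Of all maximum points one
      closest to \<open>e\<close> is taken; the maximum spreads to a ball around it and hence to a
      point closer to \<open>e\<close>.\<close>
    define Z where "Z = {z. S z = m}"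
    have "closed Z" unfolding Z_def
      using continuous_closed_preimage_constant[OF S(2) closed_UNIV] by simp
    moreover have "y \<in> Z" using m by (simp add: Z_def)
    ultimately obtain x where x: "x \<in> Z" "\<And>z. z \<in> Z \<Longrightarrow> dist e x \<le> dist e z"
      using distance_attains_inf[of Z e] by blast
    have "x \<in> - E" using x(1) m S0 by (auto simp: Z_def)
    then obtain r where r: "r > 0" "ball x r \<subseteq> - E" using E(1) openE[of "- E"] by blast
    define d where "d = dist e x"
    have d: "r \<le> d" using r E(2) by (force simp: d_def dist_commute)
    define t where "t = r / (2 * d)"
    have t: "0 < t" "t < 1" "t * d = r / 2" using r d by (auto simp: t_def)
    define x' where "x' = x + of_real t * (e - x)"
    have "dist x x' = t * d" using t by (simp add: x'_def d_def dist_norm norm_mult)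
    then have x': "x' \<in> ball x r" using t r by simp
    have "S x' = m"
      by (rule Re_holomorphic_sup_max_propagates[OF S(1) r(2) le _ x']) (use x in \<open>simp add: Z_def\<close>)
    moreover have "dist e x' = (1 - t) * d"
    proof -
      have eq: "e - x' = of_real (1 - t) * (e - x)" by (simp add: x'_def algebra_simps)
      have "dist e x' = \<bar>1 - t\<bar> * d" unfolding dist_norm d_def eq by (simp only: norm_mult norm_of_real)
      then show ?thesis using t by simp
    qed
    ultimately have "d \<le> (1 - t) * d" using x(2)[of x'] by (simp add: Z_def d_def)
    then show False using t r by (simp add: algebra_simps)
  qed
  then show ?thesis using le[of z] by simp
qed

theorem mainTheorem5:
  fixes E :: "complex set" and M :: "complex \<Rightarrow> real" and \<pi> :: "complex \<Rightarrow> complex"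
    and b :: real and \<mu> :: "real measure"
  assumes "closed E" and "\<not> bounded E" and "E \<subseteq> \<real>\<^sub>\<le>\<^sub>0"
    and "\<forall>\<zeta>\<in>E. dirichlet_regular (- E) \<zeta>"
    and "symmetric_martin_function E M"
    and "holomorphic_universal_covering upper_half_plane \<pi> (- E)"
    and "poisson_representation (M \<circ> \<pi>) b \<mu>"
  shows "mutually_singular \<mu> lborel \<and>
    (pure_point (representing_measure b \<mu>) \<or>
     purely_continuous (representing_measure b \<mu>)) \<and>
    \<not> (pure_point (representing_measure b \<mu>) \<and>
       purely_continuous (representing_measure b \<mu>)) \<and>
    ((\<exists>x. atom_of (representing_measure b \<mu>) x) \<longrightarrow>
     pure_point (representing_measure b \<mu>))"
proof -
  define C where "C = upper_half_plane"
  define p where "p = M \<circ> \<pi>"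
  \<comment> \<open>\<open>M\<close> is unspecified on \<open>E\<close>. Its extension
    \<open>m\<close> by the boundary value 0 agrees with \<open>M\<close> wherever
    \<open>\<pi>\<close> takes values.\<close>
  define m where "m z = (if z \<in> E then 0 else M z)" for z
  note E = assms(1,3)
  have martin: "M locally_Re_holomorphic_on - E" "\<And>z. z \<in> - E \<Longrightarrow> 0 \<le> M z" "\<exists>z\<in>- E. M z \<noteq> 0"
    "continuous_on UNIV m"
    using assms(5) unfolding symmetric_martin_function_def m_def[abs_def]
    by (auto dest: harmonic_on_imp_locally_Re_holomorphic)
  have cov: "covering_space C \<pi> (- E)" "\<pi> holomorphic_on C" "open C" "open (- E)" "simply_connected C"
    using assms(1,6) open_upper_half_plane unfolding holomorphic_universal_covering_def C_def by auto
  have \<pi>: "\<pi> w \<in> - E" if "w \<in> C" for w using covering_space_imp_surjective[OF cov(1)] that by auto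
  have rep: "0 \<le> b" "sets \<mu> = sets borel"
    "\<And>\<xi> \<eta>. 0 < \<eta> \<Longrightarrow> integrable \<mu> (\<lambda>t. \<eta> / ((\<xi> - t)\<^sup>2 + \<eta>\<^sup>2))"
    "\<And>\<xi> \<eta>. 0 < \<eta> \<Longrightarrow> p (Complex \<xi> \<eta>) = b * \<eta> + (\<integral>t. \<eta> / ((\<xi> - t)\<^sup>2 + \<eta>\<^sup>2) \<partial>\<mu>)"
    using assms(7) unfolding poisson_representation_def p_def by auto
  interpret poisson_integrable \<mu>
  proof
    show "integrable \<mu> (\<lambda>t. kern (Some t) w)" if "w \<in> upper_half_plane" for w
      using rep(3)[of "Im w" "Re w"] that by (simp add: kern.simps upper_half_plane_def)
  qed (rule rep)
  have p: "p w = b * Im w + poisson_integral UNIV w" if "w \<in> upper_half_plane" for w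
    using rep(4)[of "Im w" "Re w"] that by (simp add: poisson_integral_def kern.simps upper_half_plane_def)
  have pm: "p w = m (\<pi> w)" if "w \<in> C" for w using \<pi>[OF that] by (simp add: p_def m_def)
  have ii: "\<i> \<in> upper_half_plane" by (simp add: upper_half_plane_def)
  have vm: "vanishing_positive E m" unfolding vanishing_positive_def
  proof (intro conjI)
    show "m locally_Re_holomorphic_on - E"
      by (rule locally_Re_holomorphic_on_cong[OF _ martin(1)]) (simp add: m_def)
  qed (use E martin in \<open>auto simp: m_def\<close>)
  have m0: "0 \<le> m z" for z using martin(2)[of z] by (simp add: m_def)
  have m1: "m 1 > 0"
  proof -
    obtain z where "z \<in> - E" "M z \<noteq> 0" using martin(3) by blast
    then have "m z \<noteq> 0" by (simp add: m_def)
    then show ?thesis by (rule vanishing_positive_pos[OF vm])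
  qed
  obtain e where e: "e \<in> E" using assms(2) by fastforce

  have singular: "mutually_singular \<mu> lborel"
  proof (rule mutually_singular_lborel_if_bounded_poisson_integrals_zero)
    fix Y :: "real set" and K assume Y: "Y \<in> sets borel" and K': "\<And>w. w \<in> upper_half_plane \<Longrightarrow> poisson_integral Y w \<le> K"
    \<comment> \<open>\<open>Y\<close> need not be invariant under deck transformations, so its
      Poisson integral does not descend. The supremum over each fibre does, and it stays below
      \<open>M\<close> because \<open>M \<circ> \<pi>\<close> is constant on fibres.\<close>
    define S where "S z = (if z \<in> E then 0 else (SUP w\<in>{w\<in>C. \<pi> w = z}. poisson_integral Y w))" for z
    obtain H where H: "H holomorphic_on C" "\<And>w. w \<in> C \<Longrightarrow> poisson_integral Y w = Re (H w)"
      using holomorphic_poisson_integral[OF Y] unfolding C_def by blast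
    have K: "poisson_integral Y w \<le> K" if "w \<in> C" for w using K' that by (simp add: C_def)
    have h0: "0 \<le> poisson_integral Y w" if "w \<in> C" for w using poisson_integral_nonneg that by (simp add: C_def)
    have hp: "poisson_integral Y w \<le> p w" if "w \<in> C" for w
    proof -
      have w: "w \<in> upper_half_plane" "0 \<le> b * Im w" using that rep(1) by (auto simp: C_def upper_half_plane_def)
      have "poisson_integral Y w \<le> poisson_integral UNIV w" by (rule poisson_integral_mono[OF Y _ _ w(1)]) auto
      then show ?thesis using p[OF w(1)] w(2) by simp
    qed
    have fib: "bdd_above (poisson_integral Y ` {w\<in>C. \<pi> w = z})" for z
      using K by (auto intro!: bdd_aboveI[of _ K])
    have ne: "{w\<in>C. \<pi> w = z} \<noteq> {}" if "z \<in> - E" for z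
      using that unfolding covering_space_imp_surjective[OF cov(1), symmetric] by blast
    have up: "poisson_integral Y w \<le> S (\<pi> w)" if "w \<in> C" for w
      using cSUP_upper[OF _ fib[of "\<pi> w"], of w] \<pi>[OF that] that by (auto simp: S_def)
    have S0: "0 \<le> S z" for z
    proof (cases "z \<in> E")
      case False
      then obtain w where w: "w \<in> C" "\<pi> w = z" using ne[of z] by auto
      then show ?thesis using up[OF w(1)] h0[OF w(1)] by simp
    qed (simp add: S_def)
    have Sle: "S z \<le> B" if "z \<in> - E" "\<And>w. w \<in> C \<Longrightarrow> \<pi> w = z \<Longrightarrow> poisson_integral Y w \<le> B" for z B
      using cSUP_least[OF ne[OF that(1)], of "poisson_integral Y" B] that by (auto simp: S_def)
    have Sm: "S z \<le> m z" for z
    proof (cases "z \<in> E")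
      case False
      then show ?thesis using hp pm by (intro Sle) auto
    qed (simp add: S_def m_def)
    have SK: "S z \<le> max K 0" for z
    proof (cases "z \<in> E")
      case False
      then show ?thesis using K by (intro Sle) (auto simp: le_max_iff_disj)
    qed (simp add: S_def)
    have S: "Re_holomorphic_sup_on S (- E)"
      by (rule fibre_sup_Re_holomorphic_sup[OF cov(1-4) H K]) (auto simp: S_def)
    have "continuous_on UNIV S"
      by (rule continuous_on_UNIV_if_dominated[OF E(1) martin(4) _ _ S0 Sm])
        (use isCont_Re_holomorphic_sup[OF S cov(4) _ S0 SK] in \<open>auto simp: m_def\<close>)
    then have "S z \<le> 0" for z
      by (rule bounded_Re_holomorphic_sup_nonpos[OF E(1) e S _ SK]) (simp add: S_def)
    then have "poisson_integral Y \<i> = 0" using up[of \<i>] h0[of \<i>] ii unfolding C_def by (metis order_antisym order_trans)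
    then show "emeasure \<mu> Y = 0" by (rule emeasure_zero_if_poisson_integral_zero[OF Y])
  qed

  have atom: "atom_of (representing_measure b \<mu>) x \<longleftrightarrow> mass b x \<noteq> 0" for x
  proof (cases x)
    case None
    moreover have "Some -` {None :: real option} = {}" by auto
    ultimately show ?thesis using rep(1)
      by (auto simp: atom_of_def emeasure_representing_measure[OF rep(2)] ennreal_eq_0_iff)
  next
    case (Some t)
    have "Some -` {Some t} = {t}" by auto
    then show ?thesis using Some emeasure_singleton_finite[of t] rep(2)
      by (auto simp: atom_of_def emeasure_representing_measure[OF rep(2)] measure_def enn2real_eq_0_iff)
  qed

  have pp: "pure_point (representing_measure b \<mu>)" if x: "atom_of (representing_measure b \<mu>) x" for x
  proof -
    define u where "u w = b * Im w + poisson_integral atoms w" for w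
    define v where "v z = (if z \<in> E then 0 else u (SOME w. w \<in> C \<and> \<pi> w = z))" for z
    \<comment> \<open>One inequality suffices: with \<open>w\<close> and \<open>w'\<close> exchanged
      it gives the other. So \<open>u\<close> is constant on fibres, and the choice made in
      \<open>v\<close> is immaterial.\<close>
    have inv: "u w' \<le> u w" if w: "w \<in> C" "w' \<in> C" "\<pi> w = \<pi> w'" for w w'
    proof -
      obtain \<gamma> \<delta> where g: "\<gamma> holomorphic_on C" "\<gamma> \<in> C \<rightarrow> C" "\<delta> holomorphic_on C" "\<delta> \<in> C \<rightarrow> C"
        "\<gamma> w = w'" "\<And>z. z \<in> C \<Longrightarrow> \<delta> (\<gamma> z) = z" "\<And>z. z \<in> C \<Longrightarrow> \<gamma> (\<delta> z) = z"
        "\<And>z. z \<in> C \<Longrightarrow> \<pi> (\<gamma> z) = \<pi> z"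
        using obtain_deck_transformation[OF cov w] by blast
      have "u (\<gamma> w) \<le> u w" unfolding u_def
        by (rule pure_point_part_automorphism_le[of b p, OF rep(1) p g(1-4)[unfolded C_def] g(6,7)[unfolded C_def]])
          (use g(8) w(1) in \<open>auto simp: C_def p_def\<close>)
      then show ?thesis using g(5) by simp
    qed
    have vu: "v (\<pi> w) = u w" if w: "w \<in> C" for w
    proof -
      have "(SOME w'. w' \<in> C \<and> \<pi> w' = \<pi> w) \<in> C \<and> \<pi> (SOME w'. w' \<in> C \<and> \<pi> w' = \<pi> w) = \<pi> w"
        by (rule someI[of _ w]) (use w in auto)
      then have "u (SOME w'. w' \<in> C \<and> \<pi> w' = \<pi> w) = u w" using inv w by (intro antisym) auto
      then show ?thesis using \<pi>[OF w] by (simp add: v_def)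
    qed
    obtain F where F: "F holomorphic_on C" "\<And>w. w \<in> C \<Longrightarrow> poisson_integral atoms w = Re (F w)"
      using holomorphic_poisson_integral[OF sets_atoms] unfolding C_def by blast
    have v: "v locally_Re_holomorphic_on - E"
    proof (rule descends_locally_Re_holomorphic[OF cov(1-4)])
      \<comment> \<open>The term \<open>- \<i> * b * w\<close> has real part
        \<open>b * Im w\<close>, the contribution of the point infinity.\<close>
      show "(\<lambda>w. F w - \<i> * of_real b * w) holomorphic_on C" by (intro holomorphic_intros F)
      show "v (\<pi> w) = Re (F w - \<i> * of_real b * w)" if "w \<in> C" for w
        using vu[OF that] F(2)[OF that] by (simp add: u_def)
    qed
    have u0: "0 \<le> u w" "u w \<le> p w" if w: "w \<in> C" for w
      using poisson_integral_nonneg[of w] poisson_integral_mono[OF sets_atoms, of UNIV w] p[of w] rep(1) w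
      by (auto simp: u_def C_def upper_half_plane_def)
    have vm': "0 \<le> v z" "v z \<le> m z" for z
    proof -
      have "0 \<le> v z \<and> v z \<le> m z"
      proof (cases "z \<in> E")
        case False
        then have "z \<in> \<pi> ` C" using covering_space_imp_surjective[OF cov(1)] by simp
        then obtain w where w: "w \<in> C" "\<pi> w = z" by blast
        then show ?thesis using vu[OF w(1)] u0[OF w(1)] pm[OF w(1)] by simp
      qed (simp add: v_def m_def)
      then show "0 \<le> v z" "v z \<le> m z" by auto
    qed
    have "continuous_on UNIV v"
    proof (rule continuous_on_UNIV_if_dominated[OF E(1) martin(4) _ _ vm'])
      show "isCont v z" if "z \<in> - E" for z
        using locally_Re_holomorphic_imp_continuous_on[OF v cov(4)] that cov(4) by (simp add: continuous_on_eq_continuous_at)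
    qed (simp add: m_def)
    then have "vanishing_positive E v" using E v vm' by (auto simp: vanishing_positive_def v_def)
    then obtain c where c: "\<And>z. v z = c * m z" using vanishing_positive_unique[OF _ vm m1] by blast
    have "emeasure \<mu> (- atoms) = 0"
    proof (rule pure_point_if_pure_point_part_proportional[of b p, OF rep(1) p])
      show "b * Im w + poisson_integral atoms w = c * p w" if "w \<in> upper_half_plane" for w
        using vu[of w] c[of "\<pi> w"] pm[of w] that by (simp add: C_def u_def)
      show "mass b x \<noteq> 0" using x by (simp add: atom)
    qed
    then show ?thesis by (rule pure_point_representing_measure)
  qed

  \<comment> \<open>Only the zero measure is both pure point and continuous. It is excluded because
    \<open>m 1 > 0\<close> and 1 lies in the image of \<open>\<pi>\<close>.\<close>
  have not_both: "\<not> (pure_point (representing_measure b \<mu>) \<and> purely_continuous (representing_measure b \<mu>))"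
  proof
    assume *: "pure_point (representing_measure b \<mu>) \<and> purely_continuous (representing_measure b \<mu>)"
    have pc: "emeasure (representing_measure b \<mu>) {x} = 0" for x
      using * by (simp add: purely_continuous_def atom_of_def)
    obtain x :: "nat \<Rightarrow> real option" and wt :: "nat \<Rightarrow> ennreal" where
      xw: "\<And>A. A \<in> sets (representing_measure b \<mu>) \<Longrightarrow> emeasure (representing_measure b \<mu>) A = (\<Sum>n. wt n * indicator A (x n))"
      using * unfolding pure_point_def by blast
    have "Some -` {y} \<in> sets borel" for y :: "real option"
      by (cases y) (auto simp: vimage_def)
    then have sing: "{y} \<in> sets (representing_measure b \<mu>)" for y
      by (simp add: sets_representing_measure)
    have "wt n = 0" for n
    proof -
      have "wt n * indicator {x n} (x n) \<le> (\<Sum>k. wt k * indicator {x n} (x k))"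
        using sum_le_suminf[of "\<lambda>k. wt k * indicator {x n} (x k)" "{n}"] by simp
      then show ?thesis using xw[OF sing, of "x n"] pc[of "x n"] by simp
    qed
    then have "emeasure (representing_measure b \<mu>) UNIV = 0"
      using xw[of UNIV] by (simp add: sets_representing_measure)
    then have "b = 0" "emeasure \<mu> UNIV = 0"
      using rep(1) by (auto simp: emeasure_representing_measure[OF rep(2)] ennreal_eq_0_iff)
    then have "AE t in \<mu>. False" using sets_eq_imp_space_eq[OF rep(2)] by (simp add: AE_iff_measurable[OF _ refl] rep(2))
    then have "poisson_integral UNIV w = 0" for w
      unfolding poisson_integral_def by (intro integral_eq_zero_AE) auto
    then have "p w = 0" if "w \<in> C" for w using p[of w] that \<open>b = 0\<close> by (simp add: C_def)
    moreover have "1 \<in> - E" using E(2) by (auto simp: complex_nonpos_Reals_iff subset_iff)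
    ultimately show False using m1 pm covering_space_imp_surjective[OF cov(1)] by (metis imageE less_irrefl)
  qed
  show ?thesis using singular pp not_both by (auto simp: purely_continuous_def)
qed

end
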